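(* Let $1\le A<B\le\infty$, $\psi\in\Psi(A,B)$, and $\psi^{(H)}(p)=K_H(p)\,\psi(p)$ for $p\in(A,B)$, where $K_H(p)=\tan(\pi/(2p))$ for $p\in(1,2]$ and $K_H(p)=\cot(\pi/(2p))$ for $p\in[2,\infty)$. Then for every $f\in G\psi$ on $[-\pi,\pi]$ the Hilbert transform $H[f]$ satisfies $$\|H[f]\|_{G\psi^{(H)}}\le 1\cdot\|f\|_{G\psi},$$ and the constant $1$ is best possible, i.e. $$\sup_{\psi}\ \sup_{f\in G\psi,\ f\ne0}\frac{\|H[f]\|_{G\psi^{(H)}}}{\|f\|_{G\psi}}=1,$$ where the outer supremum is over all such $\psi$ (with support in $(1,\infty)$).
   Context: $[-\pi,\pi]$ carries Lebesgue measure and $|f|_p$ is the corresponding $L_p$ norm of real-valued functions. For integrable $f$ with Fourier series $\frac{a(0)}2+\sum_{k\ge1}[a(k)\cos kx+b(k)\sin kx]$, $H[f](x)=\sum_{n\ge1}[a(n)\sin nx-b(n)\cos nx]$, equivalently $H[f](x)=\frac1{2\pi}\,\mathrm{p.v.}\int_{-\pi}^{\pi}f(x-t)\cot(t/2)\,dt$ ($f$ extended $2\pi$-periodically). $\Psi(A,B)$ is the set of continuous positive functions $\psi$ on the open interval $(A,B)$ with $\inf_{(A,B)}\psi>0$; $\|f\|_{G\psi}=\sup_{p\in(A,B)}|f|_p/\psi(p)$, and $G\psi$ is the space of measurable $f$ with finite norm. *)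

theory Defs
  imports "HOL-Analysis.Analysis" "HOL-Library.Real_Mod"
begin

text \<open>
  The norms take values in \<^typ>\<open>ennreal\<close>, so that divergence is recorded as \<open>\<infinity>\<close>;
  \<^const>\<open>powr\<close> is only available on the reals, hence the case distinction.
\<close>

definition Lp_norm :: "real \<Rightarrow> (real \<Rightarrow> real) \<Rightarrow> ennreal" where
  "Lp_norm p f =
     (let I = (\<integral>\<^sup>+ x. ennreal (\<bar>f x\<bar> powr p) \<partial>lebesgue_on {-pi..pi})
      in if I = \<infinity> then \<infinity> else ennreal (enn2real I powr (1 / p)))"

text \<open>The exponent interval \<open>(A, B)\<close>; the right end point may be \<open>\<infinity>\<close>.\<close>

definition exponents :: "real \<Rightarrow> ereal \<Rightarrow> real set" where
  "exponents A B = {p. A < p \<and> ereal p < B}"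

definition Psi :: "real \<Rightarrow> ereal \<Rightarrow> (real \<Rightarrow> real) set" where
  "Psi A B = {\<psi>. continuous_on (exponents A B) \<psi> \<and> (\<forall>p\<in>exponents A B. \<psi> p > 0)
                  \<and> (INF p\<in>exponents A B. \<psi> p) > 0}"

definition Gnorm :: "real \<Rightarrow> ereal \<Rightarrow> (real \<Rightarrow> real) \<Rightarrow> (real \<Rightarrow> real) \<Rightarrow> ennreal" where
  "Gnorm A B \<psi> f = (SUP p\<in>exponents A B. Lp_norm p f / ennreal (\<psi> p))"

text \<open>Elements are functions rather than classes modulo a.e. equality.\<close>

definition Gspace :: "real \<Rightarrow> ereal \<Rightarrow> (real \<Rightarrow> real) \<Rightarrow> (real \<Rightarrow> real) set" where
  "Gspace A B \<psi> = {f \<in> borel_measurable (lebesgue_on {-pi..pi}). Gnorm A B \<psi> f < \<infinity>}"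

text \<open>
  The \<open>2\<pi>\<close>-periodic extension of the restriction of \<open>f\<close> to \<open>[-\<pi>, \<pi>)\<close>; values of \<open>f\<close> elsewhere
  are ignored.
\<close>

definition periodic_ext :: "(real \<Rightarrow> real) \<Rightarrow> real \<Rightarrow> real" where
  "periodic_ext f x = f ((x + pi) rmod (2 * pi) - pi)"

text \<open>
  The principal value is the limit of the integrals over \<open>\<epsilon> \<le> \<bar>t\<bar> \<le> \<pi>\<close> as \<open>\<epsilon>\<close> decreases to \<open>0\<close>.
  For integrable \<open>f\<close> it exists for almost every \<open>x\<close>; at the remaining points \<^const>\<open>Lim\<close> is an
  unspecified real number.
\<close>

definition hilbert :: "(real \<Rightarrow> real) \<Rightarrow> real \<Rightarrow> real" where
  "hilbert f x = 1 / (2 * pi) *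
     Lim (at_right 0) (\<lambda>\<epsilon>. LINT t:{t. \<epsilon> \<le> \<bar>t\<bar> \<and> \<bar>t\<bar> \<le> pi}|lebesgue. periodic_ext f (x - t) * cot (t / 2))"

definition K_H :: "real \<Rightarrow> real" where
  "K_H p = (if p \<le> 2 then tan (pi / (2 * p)) else cot (pi / (2 * p)))"

definition psi_H :: "(real \<Rightarrow> real) \<Rightarrow> real \<Rightarrow> real" where
  "psi_H \<psi> p = K_H p * \<psi> p"

end

theory Submission
  imports Defs
begin

text \<open>
  The bound on \<open>G\<psi>\<close> is the sharp inequality of Riesz and Pichorides
  \<open>\<parallel>H[f]\<parallel>\<^sub>p \<le> K\<^sub>H(p) \<parallel>f\<parallel>\<^sub>p\<close>, applied to every exponent \<open>p\<close>.
  For a trigonometric polynomial and \<open>p \<le> 2\<close> it follows from the pointwise inequality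
  \<open>\<bar>y\<bar>\<^sup>p \<le> tan\<^sup>p(\<pi>/2p) \<bar>x\<bar>\<^sup>p - D Re((\<bar>x\<bar> + iy)\<^sup>p)\<close>, where \<open>Re((\<bar>x\<bar> + iy)\<^sup>p)\<close> is subharmonic and
  so has nonnegative mean over the boundary values of an analytic polynomial with real constant term;
  duality gives \<open>p > 2\<close>. For general \<open>f\<close> one compares the truncated singular integrals with the
  conjugate Fejer means: their difference tends to \<open>0\<close> at every Lebesgue point of \<open>f\<close>, and the
  conjugate means of \<open>f\<close> are the Fejer means of the \<open>L\<^sub>1\<close>-limit \<open>g\<close> of the conjugate means, so they
  converge to \<open>g\<close> almost everywhere. Fatou's lemma then carries the inequality over to \<open>g = H[f]\<close>.
  Equality is attained at \<open>p = 2\<close> by \<open>H[cos] = sin\<close>, since \<open>K\<^sub>H(2) = 1\<close>.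
\<close>

subsection \<open>The pointwise inequality of Pichorides\<close>

text \<open>The constants of the pointwise inequality come from contact. With \<gamma> = \<pi>/(2p)
  both sides agree at the angle \<gamma>, where cos (p \<gamma>) = 0, and D is the one value that
  also makes them tangent there. The cotangent for p > 2 is the tangent at the conjugate exponent,
  because \<pi>/(2q) = \<pi>/2 - \<pi>/(2p). Two obstacles shape the rest. The map x + iy to |x| +
  iy is not smooth on x = 0, so the mean value inequality is proved with sqrt(x^2 + eps^2) in place
  of |x|, and eps is removed after integration. Circular means are taken in the variable log z,
  where they become integrals over vertical segments and convexity is an ordinary second derivative.
  The other obstacle is that \<open>hilbert\<close> is a pointwise limit, so the principal value
  must be shown to exist almost everywhere. For p > 1 the polynomial inequality turns L_p
  convergence of the Fejer means into an L_1 Cauchy property of the conjugate means; this produces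
  g, and the differentiation theorem applied to f and to g does the rest. All of this is done for
  Borel periodic functions, and Lebesgue measurable functions are replaced by such representatives
  at the end.\<close>

text \<open>The logarithm of sin (a t) / (sin t)^a has derivative a sin (t - a t) / (sin (a t) sin
  t), which is nonnegative. With a = p - 1 this decides the sign of a derivative on either side of
  the contact angle.\<close>

lemma sin_ratio_mono:
  fixes a x y :: real
  assumes a: "0 < a" "a \<le> 1" and xy: "0 < x" "x \<le> y" "y < pi / 2"
  shows "sin (a * x) * sin y powr a \<le> sin (a * y) * sin x powr a"
proof -
  have sa: "sin (a * t) > 0" "sin t > 0" "a * t \<le> t" "a * t > 0" if "t \<in> {x..y}" for t
  proof -
    have t: "0 < t" "t < pi/2" using that xy by auto
    show "a * t \<le> t" using a t by (simp add: mult_left_le_one_le)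
    show "a * t > 0" using a t by simp
    then show "sin (a * t) > 0" "sin t > 0" using t \<open>a * t \<le> t\<close> by (auto intro!: sin_gt_zero)
  qed
  define L where "L t = ln (sin (a * t)) - a * ln (sin t)" for t
  have "L x \<le> L y"
  proof (rule DERIV_nonneg_imp_nondecreasing[OF xy(2)])
    fix t assume t: "x \<le> t" "t \<le> y"
    then have T: "t \<in> {x..y}" by simp
    note s = sa[OF T]
    have "(L has_real_derivative (a * cos (a * t) / sin (a * t) - a * cos t / sin t)) (at t)"
      unfolding L_def using s by (auto intro!: derivative_eq_intros simp: field_simps)
    moreover have "a * cos (a * t) / sin (a * t) - a * cos t / sin t = a * sin (t - a * t) / (sin (a*t) * sin t)"
      using s by (simp add: field_simps sin_diff)
    moreover have "sin (t - a * t) \<ge> 0"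
      using s t xy by (intro sin_ge_zero) auto
    ultimately show "\<exists>d. (L has_real_derivative d) (at t) \<and> d \<ge> 0"
      using s a by (intro exI[of _ "a * sin (t - a * t) / (sin (a*t) * sin t)"]) auto
  qed
  then have "ln (sin (a * x)) + a * ln (sin y) \<le> ln (sin (a * y)) + a * ln (sin x)"
    by (simp add: L_def)
  moreover have "sin (a * x) > 0" "sin x > 0" "sin (a * y) > 0" "sin y > 0" using sa xy by auto
  ultimately have "ln (sin (a * x) * sin y powr a) \<le> ln (sin (a * y) * sin x powr a)"
    by (simp add: ln_mult ln_powr)
  then show ?thesis
    using \<open>sin (a * x) > 0\<close> \<open>sin x > 0\<close> \<open>sin (a * y) > 0\<close> \<open>sin y > 0\<close> by (subst (asm) ln_le_cancel_iff) auto
qed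

text \<open>After division by (cos t)^p the difference \<open>k\<close> of the two sides has a
  derivative with the sign of D sin ((p-1) t) - (sin t)^(p-1). Since sin ((p-1) \<gamma>) = cos
  \<gamma>, this vanishes at \<gamma>, and by \<open>sin_ratio_mono\<close> it is nonpositive before
  and nonnegative after. Hence \<open>k\<close> has its minimum at \<gamma>, with value 0.\<close>

lemma pichorides_angle:
  fixes p \<theta> :: real
  defines "\<gamma> \<equiv> pi / (2 * p)"
  assumes p: "1 < p" "p \<le> 2" and th: "0 \<le> \<theta>" "\<theta> < pi / 2"
  shows "sin \<theta> powr p \<le> tan \<gamma> powr p * cos \<theta> powr p - (sin \<gamma> powr (p - 1) / cos \<gamma>) * cos (p * \<theta>)"
proof -
  have g: "0 < \<gamma>" "\<gamma> < pi / 2" "p * \<gamma> = pi / 2" using p by (auto simp: \<gamma>_def field_simps)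
  have sg: "sin \<gamma> > 0" "cos \<gamma> > 0" using g by (auto intro!: sin_gt_zero cos_gt_zero)
  define D where "D = sin \<gamma> powr (p - 1) / cos \<gamma>"
  have sing: "sin ((p - 1) * \<gamma>) = cos \<gamma>"
  proof -
    have "(p - 1) * \<gamma> = pi / 2 - \<gamma>" using g by (simp add: algebra_simps)
    then show ?thesis by (simp add: cos_sin_eq)
  qed
  define k where "k t = tan \<gamma> powr p - tan t powr p - D * cos (p * t) / cos t powr p" for t
  have der: "(k has_real_derivative (p / cos t powr (p + 1) * (D * sin ((p - 1) * t) - sin t powr (p - 1)))) (at t)"
    if t: "0 < t" "t < pi / 2" for t
  proof -
    have c: "cos t > 0" "sin t > 0" "tan t > 0" using t by (auto intro!: sin_gt_zero cos_gt_zero tan_gt_zero)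
    have "(k has_real_derivative (- (p * tan t powr (p - 1) * (1 / (cos t)\<^sup>2))
        - D * ((- p * sin (p * t)) * cos t powr p - cos (p * t) * (p * cos t powr (p - 1) * - sin t)) / (cos t powr p)\<^sup>2)) (at t)"
      unfolding k_def using c
      by (auto intro!: derivative_eq_intros simp: field_simps power2_eq_square)
    also have "- (p * tan t powr (p - 1) * (1 / (cos t)\<^sup>2)) = p / cos t powr (p + 1) * (- (sin t powr (p - 1)))"
      using c by (simp add: tan_def powr_divide powr_diff powr_add field_simps power2_eq_square)
    also have "D * ((- p * sin (p * t)) * cos t powr p - cos (p * t) * (p * cos t powr (p - 1) * - sin t)) / (cos t powr p)\<^sup>2
       = - (p / cos t powr (p + 1)) * (D * sin ((p - 1) * t))"
      using c by (simp add: powr_diff powr_add field_simps power2_eq_square sin_diff)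
    finally show ?thesis by (simp add: algebra_simps)
  qed
  have cont: "continuous_on {0..t} k" if "t < pi / 2" for t
  proof -
    have c: "cos x > 0" "tan x \<ge> 0" if "x \<in> {0..t}" for x
      using that \<open>t < pi / 2\<close> by (auto intro!: cos_gt_zero_pi tan_pos_pi2_le)
    have c': "cos x \<noteq> 0" "cos x powr p \<noteq> 0" if "x \<in> {0..t}" for x using c[OF that] by auto
    have 1: "continuous_on {0..t} (\<lambda>t. tan t powr p)"
      using c c' p by (intro continuous_on_powr' continuous_on_tan continuous_on_const continuous_on_id) auto
    have 2: "continuous_on {0..t} (\<lambda>t. cos t powr p)"
      using c c' p by (intro continuous_on_powr' continuous_on_cos continuous_on_const continuous_on_id) (auto intro: less_imp_le)
    have 3: "continuous_on {0..t} (\<lambda>t. D * cos (p * t))"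
      by (intro continuous_intros)
    show ?thesis
      unfolding k_def using c'
      by (intro continuous_on_diff[OF continuous_on_diff[OF continuous_on_const 1] continuous_on_divide[OF 3 2]]) auto
  qed
  have kg: "k \<gamma> = 0" by (simp add: k_def g)
  have "k \<theta> \<ge> 0"
  proof (cases "\<theta> \<le> \<gamma>")
    case True
    have "k \<gamma> \<le> k \<theta>"
    proof (rule DERIV_nonpos_imp_decreasing_open[OF True])
      fix t assume t: "\<theta> < t" "t < \<gamma>"
      have "sin ((p-1) * t) * sin \<gamma> powr (p-1) \<le> sin ((p-1) * \<gamma>) * sin t powr (p-1)"
        by (rule sin_ratio_mono) (use t p g th in auto)
      note this[unfolded sing]
      then have "D * sin ((p - 1) * t) \<le> sin t powr (p - 1)"
        using sg by (simp add: D_def field_simps)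
      then have "p / cos t powr (p + 1) * (D * sin ((p - 1) * t) - sin t powr (p - 1)) \<le> 0"
        using p by (intro mult_nonneg_nonpos) auto
      then show "\<exists>y. (k has_real_derivative y) (at t) \<and> y \<le> 0"
        using der[of t] t g th by auto
    next
      show "continuous_on {\<theta>..\<gamma>} k" using cont[of \<gamma>] g th by (auto elim: continuous_on_subset)
    qed
    then show ?thesis using kg by simp
  next
    case False
    have "k \<gamma> \<le> k \<theta>"
    proof (rule DERIV_nonneg_imp_increasing_open[of \<gamma> \<theta>])
      show "\<gamma> \<le> \<theta>" using False by simp
      fix t assume t: "\<gamma> < t" "t < \<theta>"
      have "sin ((p-1) * \<gamma>) * sin t powr (p-1) \<le> sin ((p-1) * t) * sin \<gamma> powr (p-1)"
        by (rule sin_ratio_mono) (use t p g th in auto)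
      note this[unfolded sing]
      then have "D * sin ((p - 1) * t) \<ge> sin t powr (p - 1)"
        using sg by (simp add: D_def field_simps)
      then have "p / cos t powr (p + 1) * (D * sin ((p - 1) * t) - sin t powr (p - 1)) \<ge> 0"
        using p by (intro mult_nonneg_nonneg) auto
      then show "\<exists>y. (k has_real_derivative y) (at t) \<and> y \<ge> 0"
        using der[of t] t g th by auto
    next
      show "continuous_on {\<gamma>..\<theta>} k" using cont[of \<theta>] g th by (auto elim: continuous_on_subset)
    qed
    then show ?thesis using kg by simp
  qed
  moreover have c: "cos \<theta> > 0" "sin \<theta> \<ge> 0" using th by (auto intro!: cos_gt_zero_pi sin_ge_zero)
  ultimately have "0 \<le> k \<theta> * cos \<theta> powr p" by simp
  also have "k \<theta> * cos \<theta> powr p = tan \<gamma> powr p * cos \<theta> powr p - D * cos (p * \<theta>) - sin \<theta> powr p"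
    using c by (simp add: k_def tan_def powr_divide field_simps)
  finally show ?thesis by (simp add: D_def)
qed

lemma powr_of_real_polar:
  assumes "w \<noteq> 0" shows "w powr of_real b = of_real (cmod w powr b) * cis (b * Arg w)"
  using assms by (simp add: powr_def Ln_Arg exp_add[symmetric] cis_conv_exp exp_of_real[symmetric] algebra_simps)

text \<open>Both sides are homogeneous of degree p in (X, y) and even in y, so polar coordinates
  reduce the claim to the inequality for angles.\<close>

lemma pichorides_pointwise:
  fixes p X y :: real
  defines "\<gamma> \<equiv> pi / (2 * p)"
  assumes p: "1 < p" "p \<le> 2" and X: "X > 0"
  shows "\<bar>y\<bar> powr p \<le> tan \<gamma> powr p * X powr p - (sin \<gamma> powr (p - 1) / cos \<gamma>) * Re (Complex X y powr of_real p)"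
proof -
  define w where "w = Complex X y"
  define r where "r = cmod w"
  define \<theta> where "\<theta> = Arg w"
  have w: "w \<noteq> 0" "r > 0" using X by (auto simp: w_def r_def complex_eq_iff)
  have wr: "w = rcis r \<theta>" using w by (simp add: r_def \<theta>_def rcis_cmod_Arg)
  have th: "\<bar>\<theta>\<bar> < pi / 2"
    using X w by (simp add: \<theta>_def w_def Arg_Re_pos abs_less_iff) (use Arg_Re_pos[of w] in \<open>auto simp: w_def\<close>)
  have Xr: "X = r * cos \<theta>" using wr by (metis w_def complex.sel(1) Re_rcis)
  have yr: "y = r * sin \<theta>" using wr by (metis w_def complex.sel(2) Im_rcis)
  have "w powr of_real p = of_real (r powr p) * cis (p * \<theta>)"
    unfolding r_def \<theta>_def by (rule powr_of_real_polar[OF w(1)])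
  then have R: "Re (w powr of_real p) = r powr p * cos (p * \<bar>\<theta>\<bar>)"
    by (cases "\<theta> \<ge> 0") auto
  have c: "cos \<theta> > 0" "sin \<bar>\<theta>\<bar> \<ge> 0" using th by (auto intro!: cos_gt_zero_pi sin_ge_zero)
  have ab: "\<bar>y\<bar> = r * sin \<bar>\<theta>\<bar>" using w c by (cases "\<theta> \<ge> 0") (auto simp: yr abs_mult)
  have "sin \<bar>\<theta>\<bar> powr p \<le> tan \<gamma> powr p * cos \<bar>\<theta>\<bar> powr p - (sin \<gamma> powr (p - 1) / cos \<gamma>) * cos (p * \<bar>\<theta>\<bar>)"
    unfolding \<gamma>_def by (rule pichorides_angle) (use p th in auto)
  then have "r powr p * sin \<bar>\<theta>\<bar> powr p \<le> r powr p * (tan \<gamma> powr p * cos \<bar>\<theta>\<bar> powr p - (sin \<gamma> powr (p - 1) / cos \<gamma>) * cos (p * \<bar>\<theta>\<bar>))"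
    by (intro mult_left_mono) auto
  moreover have "\<bar>y\<bar> powr p = r powr p * sin \<bar>\<theta>\<bar> powr p" "X powr p = r powr p * cos \<bar>\<theta>\<bar> powr p"
    using w c by (auto simp: ab Xr powr_mult)
  ultimately show ?thesis
    by (simp add: R[unfolded w_def] algebra_simps)
qed

subsection \<open>Subharmonicity and conjugate trigonometric polynomials\<close>

text \<open>In polar form the claim is a cos t cos ((1-a) t) \<le> cos (a t), and the right side
  equals cos t cos ((1-a) t) + sin t sin ((1-a) t) with all factors nonnegative. For a = p - 1 it
  gives the sign of the Laplacian below.\<close>

lemma Re_powr_ge:
  fixes w :: complex
  assumes w: "Re w > 0" and a: "0 \<le> a" "a \<le> 1"
  shows "a * Re w * Re (w powr of_real (a - 1)) \<le> Re (w powr of_real a)"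
proof -
  define r where "r = cmod w"
  define \<theta> where "\<theta> = \<bar>Arg w\<bar>"
  have w0: "w \<noteq> 0" "r > 0" using w by (auto simp: r_def)
  have th: "0 \<le> \<theta>" "\<theta> < pi / 2" using Arg_Re_pos[of w] w by (auto simp: \<theta>_def)
  have R: "Re (w powr of_real b) = r powr b * cos (b * \<theta>)" for b
  proof -
    have "w powr of_real b = of_real (r powr b) * cis (b * Arg w)"
      unfolding r_def by (rule powr_of_real_polar[OF w0(1)])
    then show ?thesis by (cases "Arg w \<ge> 0") (auto simp: \<theta>_def)
  qed
  have Rw: "Re w = r * cos \<theta>"
    using R[of 1] w0 by (simp add: powr_def)
  have c: "cos \<theta> \<ge> 0" "cos ((1 - a) * \<theta>) \<ge> 0"
  proof -
    have "0 \<le> (1 - a) * \<theta>" "(1 - a) * \<theta> \<le> \<theta>" using a th by (auto simp: mult_left_le_one_le)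
    then show "cos \<theta> \<ge> 0" "cos ((1 - a) * \<theta>) \<ge> 0" using th by (auto intro!: cos_ge_zero)
  qed
  have s: "sin \<theta> \<ge> 0" "sin ((1 - a) * \<theta>) \<ge> 0"
  proof -
    have "0 \<le> (1 - a) * \<theta>" "(1 - a) * \<theta> \<le> \<theta>" using a th by (auto simp: mult_left_le_one_le)
    then show "sin \<theta> \<ge> 0" "sin ((1 - a) * \<theta>) \<ge> 0" using th by (auto intro!: sin_ge_zero)
  qed
  have "a * (cos \<theta> * cos ((1 - a) * \<theta>)) \<le> 1 * (cos \<theta> * cos ((1 - a) * \<theta>))"
    using a c by (intro mult_right_mono) auto
  also have "... \<le> cos \<theta> * cos ((1 - a) * \<theta>) + sin \<theta> * sin ((1 - a) * \<theta>)"
    using s by simp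
  also have "... = cos (a * \<theta>)"
    by (simp add: cos_diff[symmetric] algebra_simps)
  finally have *: "a * (cos \<theta> * cos ((1 - a) * \<theta>)) \<le> cos (a * \<theta>)" .
  have "(1 - a) * \<theta> = - ((a - 1) * \<theta>)" by (simp add: algebra_simps)
  then have e: "cos ((a - 1) * \<theta>) = cos ((1 - a) * \<theta>)" by (metis cos_minus)
  have "a * Re w * Re (w powr of_real (a - 1)) = r powr a * (a * (cos \<theta> * cos ((1 - a) * \<theta>)))"
    unfolding R Rw e using w0 by (simp add: powr_diff)
  also have "... \<le> r powr a * cos (a * \<theta>)" using * by (intro mult_left_mono) auto
  finally show ?thesis by (simp only: R)
qed

text \<open>
  A smooth substitute for \<open>\<bar>Re z\<bar> + \<i> Im z\<close>. The real part of its \<open>p\<close>-th power stays subharmonic, and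
  convexity in \<open>log r\<close> of circular means then needs only second derivatives. The constants with
  suffixes \<open>1\<close> and \<open>2\<close> are derivatives along a curve with velocity \<open>d\<close> and acceleration \<open>e\<close>.
\<close>

definition lift_re :: "real \<Rightarrow> complex \<Rightarrow> complex" where
  "lift_re eps z = Complex (sqrt ((Re z)\<^sup>2 + eps\<^sup>2)) (Im z)"

definition lift_re1 :: "real \<Rightarrow> complex \<Rightarrow> complex \<Rightarrow> complex" where
  "lift_re1 eps z d = Complex (Re z * Re d / sqrt ((Re z)\<^sup>2 + eps\<^sup>2)) (Im d)"

definition lift_re2 :: "real \<Rightarrow> complex \<Rightarrow> complex \<Rightarrow> complex \<Rightarrow> complex" where
  "lift_re2 eps z d e = Complex (eps\<^sup>2 * (Re d)\<^sup>2 / (sqrt ((Re z)\<^sup>2 + eps\<^sup>2)) ^ 3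
      + Re z * Re e / sqrt ((Re z)\<^sup>2 + eps\<^sup>2)) (Im e)"

definition lift_powr1 :: "real \<Rightarrow> real \<Rightarrow> complex \<Rightarrow> complex \<Rightarrow> complex" where
  "lift_powr1 p eps z d = of_real p * lift_re eps z powr of_real (p - 1) * lift_re1 eps z d"

definition lift_powr2 :: "real \<Rightarrow> real \<Rightarrow> complex \<Rightarrow> complex \<Rightarrow> complex \<Rightarrow> complex" where
  "lift_powr2 p eps z d e = of_real (p * (p - 1)) * lift_re eps z powr of_real (p - 2) * (lift_re1 eps z d)\<^sup>2
      + of_real p * lift_re eps z powr of_real (p - 1) * lift_re2 eps z d e"

lemma sqrt_sum_pos: "eps > 0 \<Longrightarrow> sqrt (x\<^sup>2 + eps\<^sup>2) > (0::real)"
  by (intro real_sqrt_gt_zero add_nonneg_pos) auto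

lemma Re_lift_re: "eps > 0 \<Longrightarrow> Re (lift_re eps z) > 0"
  using sqrt_sum_pos[of eps "Re z"] by (simp add: lift_re_def)

lemma has_vector_derivative_Complex:
  assumes "(f has_real_derivative f') (at x)" "(g has_real_derivative g') (at x)"
  shows "((\<lambda>x. Complex (f x) (g x)) has_vector_derivative Complex f' g') (at x)"
proof -
  have "((\<lambda>x. of_real (f x) + \<i> * of_real (g x)) has_vector_derivative (of_real f' + \<i> * of_real g')) (at x)"
    using assms by (auto intro!: derivative_eq_intros has_vector_derivative_of_real simp: has_real_derivative_iff_has_vector_derivative)
  then show ?thesis by (simp add: complex_eq_iff Complex_eq)
qed

lemma has_vector_derivative_Re_Im:
  assumes "(\<phi> has_vector_derivative d) (at x)"
  shows "((\<lambda>x. Re (\<phi> x)) has_real_derivative Re d) (at x)" "((\<lambda>x. Im (\<phi> x)) has_real_derivative Im d) (at x)"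
  using bounded_linear.has_vector_derivative[OF bounded_linear_Re assms]
    bounded_linear.has_vector_derivative[OF bounded_linear_Im assms]
  by (auto simp: has_real_derivative_iff_has_vector_derivative)

lemma DERIV_sqrt_sum:
  assumes e: "eps > 0" and u: "(u has_real_derivative u') (at x)"
  shows "((\<lambda>x. sqrt ((u x)\<^sup>2 + eps\<^sup>2)) has_real_derivative u x * u' / sqrt ((u x)\<^sup>2 + eps\<^sup>2)) (at x)"
proof -
  have "(u x)\<^sup>2 + eps\<^sup>2 > 0" using e by (intro add_nonneg_pos) auto
  then show ?thesis using u by (auto intro!: derivative_eq_intros simp: field_simps)
qed

lemma DERIV_sqrt_sum2:
  assumes e: "eps > 0" and u: "(u has_real_derivative u1 x) (at x)" and u1: "(u1 has_real_derivative u2) (at x)"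
  shows "((\<lambda>x. u x * u1 x / sqrt ((u x)\<^sup>2 + eps\<^sup>2)) has_real_derivative
    eps\<^sup>2 * (u1 x)\<^sup>2 / sqrt ((u x)\<^sup>2 + eps\<^sup>2) ^ 3 + u x * u2 / sqrt ((u x)\<^sup>2 + eps\<^sup>2)) (at x)"
proof -
  define X where "X = sqrt ((u x)\<^sup>2 + eps\<^sup>2)"
  have X: "X > 0" "X\<^sup>2 = (u x)\<^sup>2 + eps\<^sup>2" using sqrt_sum_pos[OF e] by (auto simp: X_def)
  have "((\<lambda>x. u x * u1 x / sqrt ((u x)\<^sup>2 + eps\<^sup>2)) has_real_derivative
     ((u1 x * u1 x + u2 * u x) * X - u x * u1 x * (u x * u1 x / X)) / (X * X)) (at x)"
    unfolding X_def using X(1)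
    by (intro DERIV_divide DERIV_mult u u1 DERIV_sqrt_sum e) (auto simp: X_def)
  also have "((u1 x * u1 x + u2 * u x) * X - u x * u1 x * (u x * u1 x / X)) / (X * X)
     = (X\<^sup>2 - (u x)\<^sup>2) * (u1 x)\<^sup>2 / X^3 + u x * u2 / X"
    using X(1) by (simp add: field_simps power2_eq_square power3_eq_cube)
  also have "X\<^sup>2 - (u x)\<^sup>2 = eps\<^sup>2" by (simp add: X)
  finally show ?thesis by (simp add: X_def)
qed

lemma lift_re_deriv:
  assumes e: "eps > 0" and d: "(\<phi> has_vector_derivative d) (at x)"
  shows "((\<lambda>x. lift_re eps (\<phi> x)) has_vector_derivative lift_re1 eps (\<phi> x) d) (at x)"
  unfolding lift_re_def lift_re1_def
  by (intro has_vector_derivative_Complex DERIV_sqrt_sum has_vector_derivative_Re_Im e d)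

lemma lift_re1_deriv:
  assumes e: "eps > 0" and d: "(\<phi> has_vector_derivative \<phi>1 x) (at x)" and d1: "(\<phi>1 has_vector_derivative d2) (at x)"
  shows "((\<lambda>x. lift_re1 eps (\<phi> x) (\<phi>1 x)) has_vector_derivative lift_re2 eps (\<phi> x) (\<phi>1 x) d2) (at x)"
  unfolding lift_re2_def lift_re1_def
  by (intro has_vector_derivative_Complex DERIV_sqrt_sum2[OF e, where ?u1.0 = "\<lambda>x. Re (\<phi>1 x)"] has_vector_derivative_Re_Im d d1)

lemma lift_powr_deriv:
  assumes e: "eps > 0" and d: "(\<phi> has_vector_derivative d) (at x)"
  shows "((\<lambda>x. lift_re eps (\<phi> x) powr of_real q) has_vector_derivative
     of_real q * lift_re eps (\<phi> x) powr of_real (q - 1) * lift_re1 eps (\<phi> x) d) (at x)"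
proof -
  have nz: "lift_re eps (\<phi> x) \<notin> \<real>\<^sub>\<le>\<^sub>0"
    using Re_lift_re[OF e, of "\<phi> x"] by (auto simp: complex_nonpos_Reals_iff)
  show ?thesis
    using field_vector_diff_chain_at[OF lift_re_deriv[OF e d] has_field_derivative_powr[OF nz, of "of_real q"]]
    by (simp add: o_def mult_ac)
qed

lemma lift_powr_has_derivative:
  assumes e: "eps > 0" and d: "(\<phi> has_vector_derivative d) (at x)"
  shows "((\<lambda>x. lift_re eps (\<phi> x) powr of_real p) has_vector_derivative lift_powr1 p eps (\<phi> x) d) (at x)"
  unfolding lift_powr1_def by (rule lift_powr_deriv[OF e d])

lemma lift_powr1_has_derivative:
  assumes e: "eps > 0" and d: "(\<phi> has_vector_derivative \<phi>1 x) (at x)" and d1: "(\<phi>1 has_vector_derivative d2) (at x)"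
  shows "((\<lambda>x. lift_powr1 p eps (\<phi> x) (\<phi>1 x)) has_vector_derivative lift_powr2 p eps (\<phi> x) (\<phi>1 x) d2) (at x)"
  unfolding lift_powr1_def lift_powr2_def
  by (rule has_vector_derivative_eq_rhs,
      rule has_vector_derivative_mult[OF has_vector_derivative_mult_right[OF lift_powr_deriv[OF e d]] lift_re1_deriv[OF e d d1]])
     (simp add: algebra_simps power2_eq_square)

text \<open>For holomorphic F with F' = d and F'' = e, a vertical line has velocity i d and
  acceleration -e, so the sum is the Laplacian. The squares of the first derivatives of the lifted
  map add up to the real number -c with c = eps^2 |d|^2 / X^2, and its second derivatives add up to
  c / X. What remains is \<open>Re_powr_ge\<close> with a = p - 1, because the lifted point has real
  part X.\<close>

lemma lift_powr2_laplacian_nonneg: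
  assumes e: "eps > 0" and p: "1 \<le> p" "p \<le> 2"
  shows "Re (lift_powr2 p eps z d e + lift_powr2 p eps z (\<i> * d) (- e)) \<ge> 0"
proof -
  define X where "X = sqrt ((Re z)\<^sup>2 + eps\<^sup>2)"
  have X: "X > 0" "X\<^sup>2 = (Re z)\<^sup>2 + eps\<^sup>2" using sqrt_sum_pos[OF e] by (auto simp: X_def)
  define W where "W = lift_re eps z"
  have W: "Re W = X" "Re W > 0" using X by (auto simp: W_def lift_re_def X_def)
  define c where "c = eps\<^sup>2 * (cmod d)\<^sup>2 / X\<^sup>2"
  have "(lift_re1 eps z d)\<^sup>2 + (lift_re1 eps z (\<i> * d))\<^sup>2 = of_real (((Re z)\<^sup>2 / X\<^sup>2 - 1) * (cmod d)\<^sup>2)"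
    using X(1) by (simp add: complex_eq_iff lift_re1_def X_def[symmetric] cmod_power2) (simp add: field_simps power2_eq_square)
  also have "((Re z)\<^sup>2 / X\<^sup>2 - 1) * (cmod d)\<^sup>2 = - c"
  proof -
    have rz: "(Re z)\<^sup>2 = X\<^sup>2 - eps\<^sup>2" using X(2) by simp
    show ?thesis unfolding rz c_def using X(1) by (simp add: field_simps)
  qed
  finally have 1: "(lift_re1 eps z d)\<^sup>2 + (lift_re1 eps z (\<i> * d))\<^sup>2 = - of_real c" by simp
  have 2: "lift_re2 eps z d e + lift_re2 eps z (\<i> * d) (- e) = of_real (c / X)"
    using X(1) by (simp add: complex_eq_iff lift_re2_def X_def[symmetric] cmod_power2 c_def) (simp add: field_simps power2_eq_square power3_eq_cube)
  have "lift_powr2 p eps z d e + lift_powr2 p eps z (\<i> * d) (- e)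
     = of_real (p * (p - 1)) * W powr of_real (p - 2) * ((lift_re1 eps z d)\<^sup>2 + (lift_re1 eps z (\<i> * d))\<^sup>2)
      + of_real p * W powr of_real (p - 1) * (lift_re2 eps z d e + lift_re2 eps z (\<i> * d) (- e))"
    unfolding lift_powr2_def W_def by (simp add: algebra_simps)
  also have "... = of_real (p * c / X) * W powr of_real (p - 1) - of_real (p * c * (p - 1)) * W powr of_real (p - 2)"
    unfolding 1 2 by simp
  finally have "Re (lift_powr2 p eps z d e + lift_powr2 p eps z (\<i> * d) (- e))
     = p * c / X * Re (W powr of_real (p - 1)) - p * c * (p - 1) * Re (W powr of_real (p - 2))"
    by (simp del: of_real_mult of_real_divide of_real_diff of_real_numeral)
  also have "... = p * c / X * (Re (W powr of_real (p - 1)) - (p - 1) * Re W * Re (W powr of_real ((p - 1) - 1)))"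
    using X(1) W(1) by (simp add: field_simps)
  also have "... \<ge> 0"
    using Re_powr_ge[OF W(2), of "p - 1"] p X(1) by (intro mult_nonneg_nonneg) (auto simp: c_def)
  finally show ?thesis .
qed

lemma continuous_on_lift_powr:
  assumes "eps > 0" "continuous_on A f"
  shows "continuous_on A (\<lambda>x. lift_re eps (f x) powr of_real q)"
proof (intro continuous_on_powr_complex)
  show "continuous_on A (\<lambda>x. lift_re eps (f x))"
    unfolding lift_re_def Complex_eq by (intro continuous_intros assms)
  have "Re (lift_re eps (f x)) > 0" for x using Re_lift_re assms by blast
  then show "A \<subseteq> {z. 0 \<le> Re (lift_re eps (f z)) \<or> Im (lift_re eps (f z)) \<noteq> 0}"
     and "\<And>z. z \<in> A \<Longrightarrow> lift_re eps (f z) = 0 \<Longrightarrow> 0 < Re (complex_of_real q)"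
    by (auto intro: less_imp_le) (metis less_irrefl zero_complex.sel(1))
qed auto

lemma continuous_on_lift_powr12:
  assumes e: "eps > 0" and c: "continuous_on A f" "continuous_on A g" "continuous_on A h"
  shows "continuous_on A (\<lambda>x. lift_powr1 p eps (f x) (g x))" "continuous_on A (\<lambda>x. lift_powr2 p eps (f x) (g x) (h x))"
proof -
  have nz: "sqrt ((Re z)\<^sup>2 + eps\<^sup>2) \<noteq> 0" "sqrt ((Re z)\<^sup>2 + eps\<^sup>2) ^ 3 \<noteq> 0" for z
    using sqrt_sum_pos[OF e, of "Re z"] by (metis less_irrefl power_eq_0_iff)+
  have s: "continuous_on A (\<lambda>x. sqrt ((Re (f x))\<^sup>2 + eps\<^sup>2))" by (intro continuous_intros c)
  have l1: "continuous_on A (\<lambda>x. lift_re1 eps (f x) (g x))"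
    unfolding lift_re1_def Complex_eq
    by (intro continuous_on_add continuous_on_mult continuous_on_of_real continuous_on_divide continuous_on_const
        continuous_on_Re continuous_on_Im c s ballI nz)
  have l2: "continuous_on A (\<lambda>x. lift_re2 eps (f x) (g x) (h x))"
    unfolding lift_re2_def Complex_eq
    by (intro continuous_on_add continuous_on_mult continuous_on_of_real continuous_on_divide continuous_on_const
        continuous_on_power continuous_on_Re continuous_on_Im c s ballI nz)
  show "continuous_on A (\<lambda>x. lift_powr1 p eps (f x) (g x))" "continuous_on A (\<lambda>x. lift_powr2 p eps (f x) (g x) (h x))"
    unfolding lift_powr1_def lift_powr2_def
    by (intro continuous_on_add continuous_on_mult continuous_on_power continuous_on_const continuous_on_lift_powr c e l1 l2)+
qed

text \<open>With z = s + it as the logarithm of a disc variable, \<open>M s\<close> integrates over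
  the circle of radius exp s. It is convex in s and bounded above for s \<le> 0, hence nondecreasing
  there. Far to the left the values of F are nearly real and the integrand is nonnegative, so
  \<open>M 0\<close> is nonnegative as well.\<close>

lemma subharmonic_mean_nonneg:
  fixes F F1 F2 :: "complex \<Rightarrow> complex"
  assumes F: "\<And>z. (F has_field_derivative F1 z) (at z)" and F1: "\<And>z. (F1 has_field_derivative F2 z) (at z)"
    and contF2: "continuous_on UNIV F2"
    and per: "\<And>s. F (Complex s pi) = F (Complex s (-pi))" "\<And>s. F1 (Complex s pi) = F1 (Complex s (-pi))"
    and bd: "\<And>z. Re z \<le> 0 \<Longrightarrow> cmod (F z) \<le> B"
    and lim: "\<And>eps. eps > 0 \<Longrightarrow> \<exists>s\<le>0. \<forall>t. \<bar>Im (F (Complex s t))\<bar> \<le> eps"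
    and e: "eps > 0" and p: "1 < p" "p \<le> 2"
  shows "integral {-pi..pi} (\<lambda>t. Re (lift_re eps (F (Complex 0 t)) powr of_real p)) \<ge> 0"
proof -
  let ?v = "\<lambda>s t. Re (lift_re eps (F (Complex s t)) powr of_real p)"
  let ?v1 = "\<lambda>s t. Re (lift_powr1 p eps (F (Complex s t)) (F1 (Complex s t)))"
  let ?v2 = "\<lambda>s t. Re (lift_powr2 p eps (F (Complex s t)) (F1 (Complex s t)) (F2 (Complex s t)))"
  define M where "M s = integral {-pi..pi} (\<lambda>t. ?v s t)" for s
  define M1 where "M1 s = integral {-pi..pi} (\<lambda>t. ?v1 s t)" for s
  define M2 where "M2 s = integral {-pi..pi} (\<lambda>t. ?v2 s t)" for s
  have ds: "((\<lambda>s. G (Complex s t)) has_vector_derivative G' (Complex s t)) (at s)"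
    and dt: "((\<lambda>t. G (Complex s t)) has_vector_derivative \<i> * G' (Complex s t)) (at t)"
    if "\<And>z. (G has_field_derivative G' z) (at z)" for G G' :: "complex \<Rightarrow> complex" and s t
  proof -
    have "((\<lambda>s. Complex s t) has_vector_derivative Complex 1 0) (at s)" "((\<lambda>t. Complex s t) has_vector_derivative Complex 0 1) (at t)"
      by (rule has_vector_derivative_Complex; auto intro!: derivative_eq_intros)+
    from field_vector_diff_chain_at[OF this(1) that] field_vector_diff_chain_at[OF this(2) that]
    show "((\<lambda>s. G (Complex s t)) has_vector_derivative G' (Complex s t)) (at s)"
      and "((\<lambda>t. G (Complex s t)) has_vector_derivative \<i> * G' (Complex s t)) (at t)"
      by (auto simp: o_def complex_of_real_def[symmetric] imaginary_unit.code[symmetric] mult.commute Complex_eq)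
  qed
  have cF: "continuous_on A F" "continuous_on A F1" "continuous_on A F2" for A
    using DERIV_isCont[OF F] DERIV_isCont[OF F1] contF2
    by (auto intro: continuous_at_imp_continuous_on continuous_on_subset)
  have cc: "continuous_on A (\<lambda>x. G (Complex (f x) (g x)))" if "continuous_on UNIV G" "continuous_on A f" "continuous_on A g"
    for G :: "complex \<Rightarrow> complex" and f g :: "'x::topological_space \<Rightarrow> real" and A
    by (rule continuous_on_compose2[OF that(1)]) (auto simp: Complex_eq intro!: continuous_intros that)
  note cc' = cc[OF cF(1)[of UNIV]] cc[OF cF(2)[of UNIV]] cc[OF cF(3)[of UNIV]]
  have dM: "(M has_real_derivative M1 s) (at s)" for s
  proof -
    have "((\<lambda>s. integral (cbox (-pi) pi) (\<lambda>t. ?v s t)) has_vector_derivative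
       integral (cbox (-pi) pi) (\<lambda>t. ?v1 s t)) (at s within UNIV)"
      by (rule leibniz_rule_vector_derivative)
         (auto intro!: bounded_linear.has_vector_derivative[OF bounded_linear_Re] lift_powr_has_derivative[OF e] ds[OF F]
            integrable_continuous_interval continuous_on_Re continuous_on_lift_powr[OF e] continuous_on_lift_powr12[OF e] cc' continuous_intros simp: split_beta)
    then show ?thesis
      by (simp add: M_def[abs_def] M1_def has_real_derivative_iff_has_vector_derivative)
  qed
  have dM1: "(M1 has_real_derivative M2 s) (at s)" for s
  proof -
    have "((\<lambda>s. integral (cbox (-pi) pi) (\<lambda>t. ?v1 s t)) has_vector_derivative
       integral (cbox (-pi) pi) (\<lambda>t. ?v2 s t)) (at s within UNIV)"
      by (rule leibniz_rule_vector_derivative)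
         (auto intro!: bounded_linear.has_vector_derivative[OF bounded_linear_Re] lift_powr1_has_derivative[OF e] ds[OF F] ds[OF F1]
            integrable_continuous_interval continuous_on_Re continuous_on_lift_powr12[OF e] cc' continuous_intros simp: split_beta)
    then show ?thesis
      by (simp add: M1_def[abs_def] M2_def has_real_derivative_iff_has_vector_derivative)
  qed
  have M2: "M2 s \<ge> 0" for s
  proof -
    let ?f = "\<lambda>t. F (Complex s t)" and ?g = "\<lambda>t. F1 (Complex s t)" and ?h = "\<lambda>t. F2 (Complex s t)"
    have i2: "(\<lambda>t. Re (lift_powr2 p eps (?f t) (?g t) (?h t))) integrable_on {-pi..pi}"
      "(\<lambda>t. Re (lift_powr2 p eps (?f t) (\<i> * ?g t) (- ?h t))) integrable_on {-pi..pi}"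
      by (auto intro!: integrable_continuous_interval continuous_on_Re continuous_on_lift_powr12[OF e] cc' continuous_intros)
    \<comment> \<open>By periodicity the second derivative in t integrates to 0. Adding it to the
      integrand of \<open>M2\<close> therefore costs nothing and produces the Laplacian.\<close>
    have "((\<lambda>t. Re (lift_powr2 p eps (?f t) (\<i> * ?g t) (- ?h t))) has_integral
        (Re (lift_powr1 p eps (?f pi) (\<i> * ?g pi)) - Re (lift_powr1 p eps (?f (-pi)) (\<i> * ?g (-pi))))) {-pi..pi}"
    proof (rule fundamental_theorem_of_calculus)
      fix t assume "t \<in> {-pi..pi}"
      have "((\<lambda>t. \<i> * F1 (Complex s t)) has_vector_derivative \<i> * (\<i> * F2 (Complex s t))) (at t)"
        by (rule has_vector_derivative_mult_right[OF dt[OF F1]])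
      then have "((\<lambda>t. \<i> * F1 (Complex s t)) has_vector_derivative - F2 (Complex s t)) (at t)"
        by (simp add: mult.assoc[symmetric])
      note d2 = lift_powr1_has_derivative[OF e dt[OF F] this, of p]
      show "((\<lambda>t. Re (lift_powr1 p eps (?f t) (\<i> * ?g t))) has_vector_derivative Re (lift_powr2 p eps (?f t) (\<i> * ?g t) (- ?h t))) (at t within {-pi..pi})"
        by (rule bounded_linear.has_vector_derivative[OF bounded_linear_Re has_vector_derivative_at_within[OF d2]])
    qed simp
    then have z: "integral {-pi..pi} (\<lambda>t. Re (lift_powr2 p eps (?f t) (\<i> * ?g t) (- ?h t))) = 0"
      by (simp add: integral_unique per)
    have "M2 s = integral {-pi..pi} (\<lambda>t. Re (lift_powr2 p eps (?f t) (?g t) (?h t)) + Re (lift_powr2 p eps (?f t) (\<i> * ?g t) (- ?h t)))"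
      by (subst integral_add[OF i2]) (simp add: z M2_def)
    also have "... \<ge> 0"
    proof (rule integral_nonneg[OF integrable_add[OF i2]])
      fix t
      show "0 \<le> Re (lift_powr2 p eps (?f t) (?g t) (?h t)) + Re (lift_powr2 p eps (?f t) (\<i> * ?g t) (- ?h t))"
        using lift_powr2_laplacian_nonneg[OF e, of p "?f t" "?g t" "?h t"] p by simp
    qed
    finally show ?thesis .
  qed
  have M1mono: "M1 s \<le> M1 t" if "s \<le> t" for s t
    by (rule DERIV_nonneg_imp_nondecreasing[OF that]) (use dM1 M2 in blast)
  obtain C where C: "\<And>s. s \<le> 0 \<Longrightarrow> M s \<le> C"
  proof
    fix s :: real assume s: "s \<le> 0"
    \<comment> \<open>The lifted point has real part at most B + eps and imaginary part at most B in
      modulus.\<close>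
    let ?K = "(2 * B + eps) powr p"
    have K: "?v s t \<le> ?K" for t
    proof -
      let ?w = "F (Complex s t)"
      have b: "cmod ?w \<le> B" using bd s by simp
      have "cmod (lift_re eps ?w) \<le> sqrt ((Re ?w)\<^sup>2 + eps\<^sup>2) + \<bar>Im ?w\<bar>"
        using cmod_le[of "lift_re eps ?w"] by (simp add: lift_re_def)
      also have "sqrt ((Re ?w)\<^sup>2 + eps\<^sup>2) \<le> \<bar>Re ?w\<bar> + \<bar>eps\<bar>" by (rule sqrt_sum_squares_le_sum_abs)
      also have "... \<le> B + eps" using abs_Re_le_cmod[of ?w] b e by simp
      also have "\<bar>Im ?w\<bar> \<le> B" using abs_Im_le_cmod[of ?w] b by simp
      finally have "cmod (lift_re eps ?w) \<le> 2 * B + eps" by simp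
      then have "cmod (lift_re eps ?w) powr p \<le> ?K" using p by (intro powr_mono2) auto
      moreover have "cmod (lift_re eps ?w powr of_real p) = cmod (lift_re eps ?w) powr p"
        by (subst norm_powr_real_powr') auto
      ultimately show ?thesis using complex_Re_le_cmod order_trans by metis
    qed
    have "M s \<le> integral {-pi..pi} (\<lambda>t::real. ?K)"
      unfolding M_def
      by (rule integral_le) (auto intro!: K integrable_continuous_interval continuous_on_Re continuous_on_lift_powr[OF e] cc' continuous_intros)
    then show "M s \<le> integral {-pi..pi} (\<lambda>t::real. ?K)" .
  qed
  have M1: "M1 s \<ge> 0" if "s \<le> 0" for s
  proof (rule ccontr)
    assume neg: "\<not> M1 s \<ge> 0"
    \<comment> \<open>To the left of s a convex function lies above its tangent at s, so a negative
      slope would push \<open>M\<close> above the bound \<open>C\<close>. The point \<open>r\<close>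
      below is chosen so that the tangent gains \<open>\<bar>C - M s\<bar> + 1\<close>.\<close>
    have *: "M r \<ge> M s + M1 s * (r - s)" if "r \<le> s" for r
    proof -
      have "M s - M1 s * s \<le> M r - M1 s * r"
      proof (rule DERIV_nonpos_imp_nonincreasing[OF that])
        fix x assume x: "r \<le> x" "x \<le> s"
        show "\<exists>y. ((\<lambda>x. M x - M1 s * x) has_real_derivative y) (at x) \<and> y \<le> 0"
          using M1mono[OF x(2)] by (intro exI[of _ "M1 x - M1 s"]) (auto intro!: derivative_eq_intros dM)
      qed
      then show ?thesis by (simp add: algebra_simps)
    qed
    define r where "r = s - (\<bar>C - M s\<bar> + 1) / (- M1 s)"
    have r: "r \<le> s" using neg by (auto simp: r_def not_le intro!: divide_nonneg_neg)
    have "M1 s * (r - s) = \<bar>C - M s\<bar> + 1" using neg by (simp add: r_def)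
    then have "M r \<ge> M s + (\<bar>C - M s\<bar> + 1)" using *[OF r] by simp
    moreover have "M r \<le> C" using C r that by simp
    ultimately show False by linarith
  qed
  obtain s0 where s0: "s0 \<le> 0" "\<And>t. \<bar>Im (F (Complex s0 t))\<bar> \<le> eps" using lim[OF e] by blast
  have "M s0 \<ge> 0" unfolding M_def
  proof (rule integral_nonneg)
    show "(\<lambda>t. Re (lift_re eps (F (Complex s0 t)) powr of_real p)) integrable_on {-pi..pi}"
      by (auto intro!: integrable_continuous_interval continuous_on_Re continuous_on_lift_powr[OF e] cc' continuous_intros)
    fix t
    \<comment> \<open>Here |Im w| \<le> eps \<le> Re w, so the argument of w is at most \<pi>/4 in
      modulus. As p \<le> 2, the p-th power stays in the closed right half plane.\<close>
    define w where "w = lift_re eps (F (Complex s0 t))"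
    have "Re w \<ge> eps" using e by (simp add: w_def lift_re_def real_le_rsqrt)
    moreover have "Im w = Im (F (Complex s0 t))" by (simp add: w_def lift_re_def)
    ultimately have w: "Re w > 0" "\<bar>Im w\<bar> \<le> Re w" using s0(2)[of t] e by linarith+
    have w0: "w \<noteq> 0" using w by auto
    have A: "Arg w = arctan (Im w / Re w)" using w by (simp add: arg_conv_arctan)
    have "\<bar>Arg w\<bar> \<le> pi / 4"
    proof -
      have "Im w / Re w \<le> 1" "-1 \<le> Im w / Re w" using w by (auto simp: field_simps)
      then have "arctan (Im w / Re w) \<le> arctan 1" "arctan (-1) \<le> arctan (Im w / Re w)"
        by (simp_all only: arctan_le_iff)
      then show ?thesis unfolding A arctan_minus arctan_one by linarith
    qed
    then have "p * \<bar>Arg w\<bar> \<le> 2 * (pi / 4)" using p by (intro mult_mono) auto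
    then have "\<bar>p * Arg w\<bar> \<le> pi / 2" using p by (simp add: abs_mult)
    then have "cos (p * Arg w) \<ge> 0" by (intro cos_ge_zero) auto
    moreover have "w powr of_real p = of_real (cmod w powr p) * cis (p * Arg w)"
      by (rule powr_of_real_polar[OF w0])
    ultimately show "0 \<le> Re (lift_re eps (F (Complex s0 t)) powr of_real p)" by (simp add: w_def)
  qed
  also have "M s0 \<le> M 0"
    by (rule DERIV_nonneg_imp_nondecreasing[OF s0(1)]) (use dM M1 in auto)
  finally show ?thesis by (simp add: M_def)
qed

section \<open>Trigonometric polynomials and their conjugates, exponents up to 2\<close>

text \<open>Conjugation sends cos to sin, sin to -cos and constants to 0, so the conjugate of
  \<open>trigpoly n a \<alpha> \<beta>\<close> is always written
  \<open>trigpoly n 0 (\<lambda>k. - \<beta> k) \<alpha>\<close>, with the same degree.\<close>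

definition trigpoly :: "nat \<Rightarrow> real \<Rightarrow> (nat \<Rightarrow> real) \<Rightarrow> (nat \<Rightarrow> real) \<Rightarrow> real \<Rightarrow> real" where
  "trigpoly n a \<alpha> \<beta> x = a + (\<Sum>k=1..n. \<alpha> k * cos (real k * x) + \<beta> k * sin (real k * x))"

lemma continuous_on_trigpoly [continuous_intros]:
  fixes f :: "'a::metric_space \<Rightarrow> real"
  shows "continuous_on A f \<Longrightarrow> continuous_on A (\<lambda>x. trigpoly n a \<alpha> \<beta> (f x))"
  unfolding trigpoly_def by (intro continuous_intros)

text \<open>T + iS is the restriction to Re z = 0 of a + sum of (\<alpha>_k - i \<beta>_k) exp (k
  z). This function is entire, has period 2 \<pi> i, is bounded for Re z \<le> 0, and tends to the
  real constant a as Re z tends to minus infinity.\<close>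

lemma conjugate_trigpoly_mean_nonneg:
  fixes n :: nat and a :: real and \<alpha> \<beta> :: "nat \<Rightarrow> real"
  defines "T \<equiv> trigpoly n a \<alpha> \<beta>" and "S \<equiv> trigpoly n 0 (\<lambda>k. - \<beta> k) \<alpha>"
  assumes e: "eps > 0" and p: "1 < p" "p \<le> 2"
  shows "integral {-pi..pi} (\<lambda>t. Re (lift_re eps (Complex (T t) (S t)) powr of_real p)) \<ge> 0"
proof -
  define c where "c k = Complex (\<alpha> k) (- \<beta> k)" for k
  define F where "F z = of_real a + (\<Sum>k=1..n. c k * exp (of_nat k * z))" for z
  define F1 where "F1 z = (\<Sum>k=1..n. c k * (exp (of_nat k * z) * of_nat k))" for z
  define F2 where "F2 z = (\<Sum>k=1..n. c k * (exp (of_nat k * z) * of_nat k * of_nat k))" for z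
  have d: "(F has_field_derivative F1 z) (at z)" "(F1 has_field_derivative F2 z) (at z)" for z
    unfolding F_def F1_def F2_def by (auto intro!: derivative_eq_intros sum.cong simp: algebra_simps)
  have ep: "exp (Complex s pi) = exp (Complex s (-pi))" for s
    by (simp add: exp_eq_polar complex_eq_iff)
  have per: "F (Complex s pi) = F (Complex s (-pi))" "F1 (Complex s pi) = F1 (Complex s (-pi))" for s
    unfolding F_def F1_def exp_of_nat_mult ep by simp_all
  define C where "C = (\<Sum>k=1..n. cmod (c k))"
  have C0: "C \<ge> 0" unfolding C_def by (intro sum_nonneg) auto
  have ex: "(\<Sum>k=1..n. cmod (c k * exp (of_nat k * z))) \<le> C * exp (Re z)" if "Re z \<le> 0" for z
  proof -
    have "cmod (c k * exp (of_nat k * z)) \<le> cmod (c k) * exp (Re z)" if k: "k \<in> {1..n}" for k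
    proof -
      have "real k * Re z \<le> 1 * Re z" using k \<open>Re z \<le> 0\<close> by (intro mult_right_mono_neg) auto
      then show ?thesis by (auto simp: norm_mult intro!: mult_left_mono)
    qed
    then have "(\<Sum>k=1..n. cmod (c k * exp (of_nat k * z))) \<le> (\<Sum>k=1..n. cmod (c k) * exp (Re z))"
      by (rule sum_mono)
    then show ?thesis by (simp add: C_def sum_distrib_right)
  qed
  have "integral {-pi..pi} (\<lambda>t. Re (lift_re eps (F (Complex 0 t)) powr of_real p)) \<ge> 0"
  proof (rule subharmonic_mean_nonneg[OF d _ per _ _ e p])
    show "continuous_on UNIV F2" unfolding F2_def by (intro continuous_intros)
    show "cmod (F z) \<le> \<bar>a\<bar> + C" if z: "Re z \<le> 0" for z
    proof -
      have "cmod (F z) \<le> \<bar>a\<bar> + (\<Sum>k=1..n. cmod (c k * exp (of_nat k * z)))"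
        unfolding F_def by (rule order_trans[OF norm_triangle_ineq]) (auto intro: norm_sum)
      also have "... \<le> \<bar>a\<bar> + C * exp (Re z)" using ex[OF z] by simp
      also have "C * exp (Re z) \<le> C * 1" using C0 z by (intro mult_left_mono) auto
      finally show ?thesis by simp
    qed
    fix \<delta> :: real assume \<delta>: "\<delta> > 0"
    \<comment> \<open>The nonconstant part of F is at most \<open>C * exp s\<close>. The denominator
      \<open>C + 1\<close> keeps the quotient meaningful when all coefficients vanish.\<close>
    define s where "s = min 0 (ln (\<delta> / (C + 1)))"
    have es: "exp s \<le> \<delta> / (C + 1)"
    proof -
      have "exp s \<le> exp (ln (\<delta> / (C + 1)))" unfolding s_def by simp
      then show ?thesis using \<delta> C0 by simp
    qed
    have "\<bar>Im (F (Complex s t))\<bar> \<le> \<delta>" for t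
    proof -
      have "\<bar>Im (F (Complex s t))\<bar> \<le> cmod (\<Sum>k=1..n. c k * exp (of_nat k * Complex s t))"
        unfolding F_def using abs_Im_le_cmod[of "\<Sum>k=1..n. c k * exp (of_nat k * Complex s t)"] by simp
      also have "... \<le> (\<Sum>k=1..n. cmod (c k * exp (of_nat k * Complex s t)))" by (rule norm_sum)
      also have "... \<le> C * exp s" using ex[of "Complex s t"] by (simp add: s_def)
      also have "... \<le> C * (\<delta> / (C + 1))" using es C0 by (rule mult_left_mono)
      also have "... \<le> \<delta>" using \<delta> C0 by (simp add: field_simps)
      finally show ?thesis .
    qed
    then show "\<exists>s\<le>0. \<forall>t. \<bar>Im (F (Complex s t))\<bar> \<le> \<delta>"
      by (intro exI[of _ s]) (auto simp: s_def)
  qed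
  also have "(\<lambda>t. F (Complex 0 t)) = (\<lambda>t. Complex (T t) (S t))"
  proof
    fix t
    have "exp (of_nat k * Complex 0 t) = cis (real k * t)" for k
      by (simp add: cis_conv_exp Complex_eq mult_ac)
    then show "F (Complex 0 t) = Complex (T t) (S t)"
      unfolding F_def T_def S_def trigpoly_def c_def
      by (simp add: complex_eq_iff Re_sum Im_sum algebra_simps)
  qed
  finally show ?thesis unfolding fun_cong[OF \<open>(\<lambda>t. F (Complex 0 t)) = (\<lambda>t. Complex (T t) (S t))\<close>] .
qed

text \<open>The pointwise inequality is integrated with X = sqrt(T^2 + eps^2). The term with D has
  the right sign by the previous lemma and is dropped, and eps then tends to 0 by continuity of the
  parameter integral.\<close>

lemma conjugate_trigpoly_le_2:
  fixes n :: nat and a :: real and \<alpha> \<beta> :: "nat \<Rightarrow> real"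
  defines "T \<equiv> trigpoly n a \<alpha> \<beta>" and "S \<equiv> trigpoly n 0 (\<lambda>k. - \<beta> k) \<alpha>"
  assumes p: "1 < p" "p \<le> 2"
  shows "integral {-pi..pi} (\<lambda>t. \<bar>S t\<bar> powr p) \<le> tan (pi / (2 * p)) powr p * integral {-pi..pi} (\<lambda>t. \<bar>T t\<bar> powr p)"
proof -
  define \<gamma> where "\<gamma> = pi / (2 * p)"
  define D where "D = sin \<gamma> powr (p - 1) / cos \<gamma>"
  have g: "0 < \<gamma>" "\<gamma> < pi / 2" using p by (auto simp: \<gamma>_def field_simps)
  have D: "D \<ge> 0" using g by (auto simp: D_def intro!: divide_nonneg_pos cos_gt_zero)
  have cT: "continuous_on A T" "continuous_on A S" for A
    unfolding T_def S_def by (intro continuous_intros)+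
  define I where "I eps = integral {-pi..pi} (\<lambda>t. sqrt ((T t)\<^sup>2 + eps\<^sup>2) powr p)" for eps
  have le: "integral {-pi..pi} (\<lambda>t. \<bar>S t\<bar> powr p) \<le> tan \<gamma> powr p * I eps" if e: "eps > 0" for eps
  proof -
    let ?V = "\<lambda>t. Re (lift_re eps (Complex (T t) (S t)) powr of_real p)"
    have iS: "(\<lambda>t. \<bar>S t\<bar> powr p) integrable_on {-pi..pi}"
      using p by (intro integrable_continuous_interval continuous_on_powr' continuous_intros cT) auto
    have iX: "(\<lambda>t. sqrt ((T t)\<^sup>2 + eps\<^sup>2) powr p) integrable_on {-pi..pi}"
      using p by (intro integrable_continuous_interval continuous_on_powr' continuous_intros cT) auto
    have iV: "?V integrable_on {-pi..pi}"
      unfolding Complex_eq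
      by (intro integrable_continuous_interval continuous_on_Re continuous_on_lift_powr[OF e] continuous_intros cT)
    have "integral {-pi..pi} (\<lambda>t. \<bar>S t\<bar> powr p) \<le> integral {-pi..pi} (\<lambda>t. tan \<gamma> powr p * sqrt ((T t)\<^sup>2 + eps\<^sup>2) powr p - D * ?V t)"
    proof (rule integral_le[OF iS integrable_diff[OF integrable_on_mult_right[OF iX] integrable_on_mult_right[OF iV]]])
      fix t
      show "\<bar>S t\<bar> powr p \<le> tan \<gamma> powr p * sqrt ((T t)\<^sup>2 + eps\<^sup>2) powr p - D * ?V t"
        using pichorides_pointwise[OF p sqrt_sum_pos[OF e], of "S t" "T t"]
        by (simp add: \<gamma>_def D_def lift_re_def)
    qed
    also have "... = tan \<gamma> powr p * I eps - D * integral {-pi..pi} ?V"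
      by (simp add: integral_diff[OF integrable_on_mult_right[OF iX] integrable_on_mult_right[OF iV]] I_def)
    also have "... \<le> tan \<gamma> powr p * I eps"
      using conjugate_trigpoly_mean_nonneg[OF e p, of n a \<alpha> \<beta>] D by (simp add: T_def S_def)
    finally show ?thesis .
  qed
  have "continuous_on UNIV (\<lambda>eps. integral (cbox (-pi) pi) (\<lambda>t. sqrt ((T t)\<^sup>2 + eps\<^sup>2) powr p))"
  proof (rule integral_continuous_on_param)
    show "continuous_on (UNIV \<times> cbox (-pi) pi) (\<lambda>(eps, t). sqrt ((T t)\<^sup>2 + eps\<^sup>2) powr p)"
      unfolding split_beta T_def using p
      by (intro continuous_on_powr' continuous_intros) auto
  qed
  then have "isCont I 0"
    by (simp add: I_def[abs_def] continuous_on_eq_continuous_at)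
  then have "(I \<longlongrightarrow> I 0) (at_right 0)"
    by (metis filterlim_at_split isCont_def)
  then have "((\<lambda>eps. tan \<gamma> powr p * I eps) \<longlongrightarrow> tan \<gamma> powr p * I 0) (at_right 0)"
    by (intro tendsto_intros)
  then have "integral {-pi..pi} (\<lambda>t. \<bar>S t\<bar> powr p) \<le> tan \<gamma> powr p * I 0"
    by (rule tendsto_lowerbound) (auto simp: eventually_at_right_field intro!: le exI[of _ 1])
  then show ?thesis by (simp add: I_def \<gamma>_def)
qed

subsection \<open>The circle\<close>

text \<open>A density on the whole line instead of a restricted space: the space is
  \<open>UNIV\<close> and the sets are Borel, so translates and reflections of the integrand raise
  no domain questions.\<close>

definition circ :: "real measure" where
  "circ = density lborel (\<lambda>x. ennreal (indicator {-pi..pi} x))"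

lemma sets_circ [simp, measurable_cong]: "sets circ = sets borel"
  by (simp add: circ_def)

lemma space_circ [simp]: "space circ = UNIV"
  by (simp add: circ_def)

lemma nn_integral_circ:
  assumes [measurable]: "f \<in> borel_measurable borel"
  shows "(\<integral>\<^sup>+x. f x \<partial>circ) = (\<integral>\<^sup>+x. f x * indicator {-pi..pi} x \<partial>lborel)"
  unfolding circ_def by (subst nn_integral_density) (auto simp: ennreal_indicator mult.commute)

lemma emeasure_circ: "emeasure circ UNIV = ennreal (2 * pi)"
  using nn_integral_circ[of "\<lambda>_. 1"] by simp

interpretation circ: finite_measure circ
  by standard (simp add: emeasure_circ)

lemma AE_circ: "(AE x in circ. P x) \<longleftrightarrow> (AE x in lborel. x \<in> {-pi..pi} \<longrightarrow> P x)"
  unfolding circ_def by (subst AE_density) (auto simp: indicator_def intro!: AE_cong)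

lemma AE_circ_D: "AE x in lborel. P x \<Longrightarrow> AE x in circ. P x"
  unfolding AE_circ by auto

lemma AE_circ_range: "AE x in circ. x \<in> {-pi..pi}"
  unfolding AE_circ by auto

lemma integrable_circ:
  fixes f :: "real \<Rightarrow> real"
  assumes [measurable]: "f \<in> borel_measurable borel"
  shows "integrable circ f \<longleftrightarrow> set_integrable lborel {-pi..pi} f"
  unfolding circ_def set_integrable_def by (subst integrable_density) auto

lemma integral_circ:
  fixes f :: "real \<Rightarrow> real"
  assumes [measurable]: "f \<in> borel_measurable borel"
  shows "integral\<^sup>L circ f = (LINT x:{-pi..pi}|lborel. f x)"
  unfolding circ_def set_lebesgue_integral_def by (subst integral_density) auto

lemma integral_circ_HK:
  assumes f: "continuous_on UNIV f"
  shows "integrable circ f" "integral\<^sup>L circ f = integral {-pi..pi} (f :: real \<Rightarrow> real)"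
proof -
  have m[measurable]: "f \<in> borel_measurable borel" using f by (rule borel_measurable_continuous_onI)
  have "set_integrable lborel {-pi..pi} f"
    using f by (intro borel_integrable_atLeastAtMost') (auto intro: continuous_on_subset)
  then show "integrable circ f" "integral\<^sup>L circ f = integral {-pi..pi} f"
    using integrable_circ[OF m] integral_circ[OF m] set_borel_integral_eq_integral(2) by auto
qed

lemma integrable_circ_bounded:
  fixes f :: "real \<Rightarrow> real"
  assumes "f \<in> borel_measurable borel" "\<And>x. \<bar>f x\<bar> \<le> B"
  shows "integrable circ f"
  using assms by (intro circ.integrable_const_bound[of _ B]) auto

lemma integrable_circ_mult_bounded:
  fixes f g :: "real \<Rightarrow> real"
  assumes f: "integrable circ f" and [measurable]: "g \<in> borel_measurable borel" and g: "\<And>x. \<bar>g x\<bar> \<le> B"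
  shows "integrable circ (\<lambda>x. f x * g x)"
proof (rule Bochner_Integration.integrable_bound[OF integrable_mult_right[OF f, of B]])
  have [measurable]: "f \<in> borel_measurable borel" using borel_measurable_integrable[OF f] by simp
  show "(\<lambda>x. f x * g x) \<in> borel_measurable circ" by measurable
  have "\<bar>f x * g x\<bar> \<le> \<bar>B * f x\<bar>" for x
    using mult_left_mono[OF order_trans[OF g[of x] abs_ge_self[of B]], of "\<bar>f x\<bar>"] by (simp add: abs_mult mult_ac)
  then show "AE x in circ. norm (f x * g x) \<le> norm (B * f x)" by simp
qed

section \<open>Periodic functions: invariance of integrals over a period\<close>

definition periodic :: "(real \<Rightarrow> 'a) \<Rightarrow> bool" where
  "periodic f \<longleftrightarrow> (\<forall>x. f (x + 2 * pi) = f x)"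

lemma periodicD: "periodic f \<Longrightarrow> f (x + 2 * pi) = f x" "periodic f \<Longrightarrow> f (x - 2 * pi) = f x"
proof -
  assume p: "periodic f"
  show "f (x + 2 * pi) = f x" using p by (simp add: periodic_def)
  show "f (x - 2 * pi) = f x" using p[unfolded periodic_def, rule_format, of "x - 2 * pi"] by simp
qed

lemma periodic_int: "periodic f \<Longrightarrow> f (x + 2 * pi * of_int k) = f x"
proof (induction k)
  case (nonneg n)
  then show ?case
  proof (induction n)
    case (Suc n)
    have "f (x + 2 * pi * of_int (int (Suc n))) = f ((x + 2 * pi * of_int (int n)) + 2 * pi)"
      by (simp add: algebra_simps)
    then show ?case using Suc periodicD(1)[of f] by simp
  qed simp
next
  case (neg n)
  then show ?case
  proof (induction n)
    case 0
    then show ?case using periodicD(2)[of f x] by simp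
  next
    case (Suc n)
    have "f (x + 2 * pi * of_int (- int (Suc (Suc n)))) = f ((x + 2 * pi * of_int (- int (Suc n))) - 2 * pi)"
      by (simp add: algebra_simps)
    then show ?case using Suc periodicD(2)[of f] by simp
  qed
qed

lemma periodic_compose: "periodic f \<Longrightarrow> periodic (\<lambda>x. g (f x))"
  by (simp add: periodic_def)

lemma periodic_reflect:
  assumes p: "periodic f" shows "periodic (\<lambda>x. f (c - x))"
  unfolding periodic_def
proof
  fix x show "f (c - (x + 2 * pi)) = f (c - x)" using periodicD(2)[OF p, of "c - x"] by (simp add: algebra_simps)
qed

lemma nn_integral_translate:
  fixes f :: "real \<Rightarrow> ennreal"
  assumes [measurable]: "f \<in> borel_measurable borel"
  shows "(\<integral>\<^sup>+x. f (x + c) \<partial>lborel) = (\<integral>\<^sup>+x. f x \<partial>lborel)"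
  using nn_integral_real_affine[of f 1 c] by (simp add: add.commute)

lemma nn_integral_period_window:
  fixes f :: "real \<Rightarrow> ennreal"
  assumes [measurable]: "f \<in> borel_measurable borel" and p: "periodic f"
  shows "(\<integral>\<^sup>+x. f x * indicator {a..<a + 2 * pi} x \<partial>lborel) = (\<integral>\<^sup>+x. f x * indicator {-pi..<pi} x \<partial>lborel)"
proof -
  let ?I = "\<lambda>a b. \<integral>\<^sup>+x. f x * indicator {a..<b} x \<partial>lborel"
  define k where "k = \<lceil>(a + pi) / (2 * pi)\<rceil>"
  \<comment> \<open>The point of -\<pi> + 2 \<pi> Z in [a, a + 2 \<pi>). The window starting at c is
    a translate of [-\<pi>, \<pi>) by whole periods; its overhang beyond a + 2 \<pi> is moved back
    by one period to fill [a, c).\<close>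
  define c where "c = 2 * pi * of_int k - pi"
  have k: "of_int k \<ge> (a + pi) / (2 * pi)" "of_int k < (a + pi) / (2 * pi) + 1"
    unfolding k_def by linarith+
  have c: "a \<le> c" "c < a + 2 * pi"
    using k by (auto simp: c_def field_simps)
  have "?I (-pi) pi
      = (\<integral>\<^sup>+x. f (x + 2 * pi * of_int (- k)) * indicator {-pi..<pi} (x + 2 * pi * of_int (- k)) \<partial>lborel)"
    by (rule nn_integral_translate[symmetric]) auto
  also have "... = ?I c (c + 2 * pi)"
    unfolding periodic_int[OF p] by (intro nn_integral_cong) (auto simp: indicator_def c_def)
  also have "... = (\<integral>\<^sup>+x. f x * indicator {c..<a + 2 * pi} x + f x * indicator {a + 2 * pi..<c + 2 * pi} x \<partial>lborel)"
    using c by (intro nn_integral_cong) (auto simp: indicator_def)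
  also have "... = ?I c (a + 2 * pi) + ?I (a + 2 * pi) (c + 2 * pi)"
    by (rule nn_integral_add) auto
  also have "?I (a + 2 * pi) (c + 2 * pi)
     = (\<integral>\<^sup>+x. f (x + 2 * pi) * indicator {a + 2 * pi..<c + 2 * pi} (x + 2 * pi) \<partial>lborel)"
    by (rule nn_integral_translate[symmetric]) auto
  also have "... = ?I a c"
    by (intro nn_integral_cong) (auto simp: indicator_def periodicD[OF p])
  also have "?I c (a + 2 * pi) + ...
     = (\<integral>\<^sup>+x. f x * indicator {c..<a + 2 * pi} x + f x * indicator {a..<c} x \<partial>lborel)"
    by (rule nn_integral_add[symmetric]) auto
  also have "... = ?I a (a + 2 * pi)"
    using c by (intro nn_integral_cong) (auto simp: indicator_def)
  finally show ?thesis ..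
qed

lemma nn_integral_circ_half_open: 
  assumes [measurable]: "f \<in> borel_measurable borel"
  shows "(\<integral>\<^sup>+x. f x \<partial>circ) = (\<integral>\<^sup>+x. f x * indicator {-pi..<pi} x \<partial>lborel)"
  unfolding nn_integral_circ[OF assms]
  by (intro nn_integral_cong_AE, use AE_lborel_singleton[of pi] in eventually_elim) (auto simp: indicator_def)

lemma nn_integral_circ_shift:
  fixes f :: "real \<Rightarrow> ennreal"
  assumes [measurable]: "f \<in> borel_measurable borel" and p: "periodic f"
  shows "(\<integral>\<^sup>+x. f (x + c) \<partial>circ) = (\<integral>\<^sup>+x. f x \<partial>circ)"
proof -
  have "(\<integral>\<^sup>+x. f (x + c) \<partial>circ) = (\<integral>\<^sup>+x. f (x + c) * indicator {c-pi..<c-pi + 2 * pi} (x + c) \<partial>lborel)"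
    by (subst nn_integral_circ_half_open) (auto simp: indicator_def intro!: nn_integral_cong)
  also have "... = (\<integral>\<^sup>+x. f x * indicator {c-pi..<c-pi + 2 * pi} x \<partial>lborel)"
    by (rule nn_integral_translate) auto
  also have "... = (\<integral>\<^sup>+x. f x \<partial>circ)"
    by (subst nn_integral_period_window[OF _ p]) (auto simp: nn_integral_circ_half_open)
  finally show ?thesis .
qed

lemma nn_integral_circ_uminus:
  fixes f :: "real \<Rightarrow> ennreal"
  assumes [measurable]: "f \<in> borel_measurable borel"
  shows "(\<integral>\<^sup>+x. f (- x) \<partial>circ) = (\<integral>\<^sup>+x. f x \<partial>circ)"
proof -
  have "(\<integral>\<^sup>+x. f x \<partial>circ) = (\<integral>\<^sup>+x. f (-x) * indicator {-pi..pi} (- x) \<partial>lborel)"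
    using nn_integral_real_affine[of "\<lambda>x. f x * indicator {-pi..pi} x" "-1" 0] by (simp add: nn_integral_circ)
  also have "... = (\<integral>\<^sup>+x. f (- x) \<partial>circ)"
    by (subst nn_integral_circ) (auto simp: indicator_def intro!: nn_integral_cong)
  finally show ?thesis ..
qed

lemma nn_integral_circ_reflect:
  fixes f :: "real \<Rightarrow> ennreal"
  assumes [measurable]: "f \<in> borel_measurable borel" and p: "periodic f"
  shows "(\<integral>\<^sup>+x. f (c - x) \<partial>circ) = (\<integral>\<^sup>+x. f x \<partial>circ)"
  using nn_integral_circ_uminus[of "\<lambda>x. f (x + c)"] nn_integral_circ_shift[OF assms, of c]
  by simp

text \<open>The hypothesis \<open>eq\<close> says that f and g have the same distribution under
  \<open>circ\<close>. Integrability and the integral depend only on the distribution, so invariance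
  has to be checked for nonnegative integrals alone.\<close>

lemma circ_integral_transfer:
  fixes f g :: "real \<Rightarrow> real"
  assumes [measurable]: "f \<in> borel_measurable borel" "g \<in> borel_measurable borel"
    and eq: "\<And>h::real \<Rightarrow> ennreal. h \<in> borel_measurable borel \<Longrightarrow> (\<integral>\<^sup>+x. h (g x) \<partial>circ) = (\<integral>\<^sup>+x. h (f x) \<partial>circ)"
  shows "integrable circ g \<longleftrightarrow> integrable circ f" "integral\<^sup>L circ g = integral\<^sup>L circ f"
proof -
  have "(\<integral>\<^sup>+x. ennreal (norm (g x)) \<partial>circ) = (\<integral>\<^sup>+x. ennreal (norm (f x)) \<partial>circ)"
    by (rule eq[of "\<lambda>x. ennreal (norm x)"]) auto
  then show i: "integrable circ g \<longleftrightarrow> integrable circ f"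
    by (simp add: integrable_iff_bounded)
  show "integral\<^sup>L circ g = integral\<^sup>L circ f"
  proof (cases "integrable circ f")
    case True
    then show ?thesis
      using i eq[of "\<lambda>x. ennreal x"] eq[of "\<lambda>x. ennreal (- x)"] by (simp add: real_lebesgue_integral_def)
  next
    case False
    then show ?thesis using i by (simp add: not_integrable_integral_eq)
  qed
qed

lemma
  fixes f :: "real \<Rightarrow> real"
  assumes m[measurable]: "f \<in> borel_measurable borel" and p: "periodic f"
  shows integrable_circ_reflect: "integrable circ (\<lambda>x. f (c - x)) \<longleftrightarrow> integrable circ f"
    and integral_circ_reflect: "integral\<^sup>L circ (\<lambda>x. f (c - x)) = integral\<^sup>L circ f"
proof -
  have 1: "(\<integral>\<^sup>+x. h (f (c - x)) \<partial>circ) = (\<integral>\<^sup>+x. h (f x) \<partial>circ)"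
    if [measurable]: "h \<in> borel_measurable borel" for h :: "real \<Rightarrow> ennreal"
    using nn_integral_circ_reflect[of "\<lambda>x. h (f x)"] periodic_compose[OF p, of h] by simp
  have "(\<lambda>x. f (c - x)) \<in> borel_measurable borel" by measurable
  from circ_integral_transfer[OF m this 1]
  show "integrable circ (\<lambda>x. f (c - x)) \<longleftrightarrow> integrable circ f" "integral\<^sup>L circ (\<lambda>x. f (c - x)) = integral\<^sup>L circ f"
    by auto
qed

subsection \<open>The Fejer kernel and its conjugate\<close>

lemma trigpoly_measurable [measurable]: "trigpoly n a \<alpha> \<beta> \<in> borel_measurable borel"
  by (intro borel_measurable_continuous_onI continuous_intros)

lemma trigpoly_bounded: "\<exists>B. \<forall>x. \<bar>trigpoly n a \<alpha> \<beta> x\<bar> \<le> B"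
proof (intro exI allI)
  fix x
  have "\<bar>\<alpha> k * cos (real k * x) + \<beta> k * sin (real k * x)\<bar> \<le> \<bar>\<alpha> k\<bar> + \<bar>\<beta> k\<bar>" for k
  proof -
    have "\<bar>\<alpha> k * cos (real k * x)\<bar> \<le> \<bar>\<alpha> k\<bar> * 1" "\<bar>\<beta> k * sin (real k * x)\<bar> \<le> \<bar>\<beta> k\<bar> * 1"
      unfolding abs_mult by (intro mult_left_mono; simp)+
    then show ?thesis by linarith
  qed
  then have "\<bar>\<Sum>k=1..n. \<alpha> k * cos (real k * x) + \<beta> k * sin (real k * x)\<bar> \<le> (\<Sum>k=1..n. \<bar>\<alpha> k\<bar> + \<bar>\<beta> k\<bar>)"
    by (intro order_trans[OF sum_abs] sum_mono) auto
  then show "\<bar>trigpoly n a \<alpha> \<beta> x\<bar> \<le> \<bar>a\<bar> + (\<Sum>k=1..n. \<bar>\<alpha> k\<bar> + \<bar>\<beta> k\<bar>)"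
    unfolding trigpoly_def by linarith
qed

lemma periodic_trigpoly: "periodic (trigpoly n a \<alpha> \<beta>)"
proof -
  have "cos (real k * (x + 2 * pi)) = cos (real k * x)" "sin (real k * (x + 2 * pi)) = sin (real k * x)" for k x
  proof -
    have e: "real k * (x + 2 * pi) = real k * x + 2 * real k * pi" by (simp add: algebra_simps)
    show "cos (real k * (x + 2 * pi)) = cos (real k * x)" "sin (real k * (x + 2 * pi)) = sin (real k * x)"
      unfolding e cos_add sin_add cos_2npi sin_2npi by simp_all
  qed
  then show ?thesis by (simp add: periodic_def trigpoly_def)
qed

text \<open>The coefficient at k = N vanishes, so this is the usual Fejer kernel of degree N - 1,
  normalised to mean value 1. For N = 0 the sum is empty and the kernel is constant 1.\<close>

definition fejer :: "nat \<Rightarrow> real \<Rightarrow> real" where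
  "fejer N = trigpoly N 1 (\<lambda>k. 2 * (1 - k / N)) (\<lambda>_. 0)"

definition cfejer :: "nat \<Rightarrow> real \<Rightarrow> real" where
  "cfejer N = trigpoly N 0 (\<lambda>_. 0) (\<lambda>k. 2 * (1 - k / N))"

lemma fejer_measurable [measurable]: "fejer N \<in> borel_measurable borel" "cfejer N \<in> borel_measurable borel"
  by (auto simp: fejer_def cfejer_def)

lemma dirichlet_closed:
  "sin (t / 2) * (1 + 2 * (\<Sum>k=1..N. cos (real k * t))) = sin ((real N + 1/2) * t)"
  "sin (t / 2) * (2 * (\<Sum>k=1..N. sin (real k * t))) = cos (t / 2) - cos ((real N + 1/2) * t)"
proof (induction N)
  case (Suc N)
  have e1: "(real (Suc N) + 1/2) * t = real (Suc N) * t + t / 2" "(real N + 1/2) * t = real (Suc N) * t - t / 2"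
    by (simp_all add: algebra_simps)
  have e2: "sin (A - h) + 2 * sin h * cos A = sin (A + h)" "cos h - cos (A - h) + 2 * sin h * sin A = cos h - cos (A + h)" for A h :: real
    by (simp_all add: sin_add sin_diff cos_add cos_diff)
  { case 1
    have "sin (t / 2) * (1 + 2 * (\<Sum>k=1..Suc N. cos (real k * t)))
       = sin (t / 2) * (1 + 2 * (\<Sum>k=1..N. cos (real k * t))) + 2 * sin (t / 2) * cos (real (Suc N) * t)"
      by (simp add: algebra_simps)
    then show ?case unfolding Suc.IH(1) unfolding e1 e2 . }
  { case 2
    have "sin (t / 2) * (2 * (\<Sum>k=1..Suc N. sin (real k * t)))
       = sin (t / 2) * (2 * (\<Sum>k=1..N. sin (real k * t))) + 2 * sin (t / 2) * sin (real (Suc N) * t)"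
      by (simp add: algebra_simps)
    then show ?case unfolding Suc.IH(2) unfolding e1 e2 . }
qed simp_all

lemma fejer_sum_closed:
  "(sin (t / 2))\<^sup>2 * (real N + 2 * (\<Sum>k=1..N. (real N - real k) * cos (real k * t))) = (sin (real N * t / 2))\<^sup>2"
  "2 * (sin (t / 2))\<^sup>2 * (2 * (\<Sum>k=1..N. (real N - real k) * sin (real k * t))) = real N * sin t - sin (real N * t)"
proof (induction N)
  case (Suc N)
  \<comment> \<open>Passing from N to N + 1 raises every weight N - k by one, so the increment of a
    Fejer sum is a Dirichlet sum; the new top weight is 0.\<close>
  have s: "(\<Sum>k=1..Suc N. (real (Suc N) - real k) * f k) = (\<Sum>k=1..N. (real N - real k) * f k) + (\<Sum>k=1..N. f k)" for f :: "nat \<Rightarrow> real"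
    by (simp add: sum.distrib[symmetric] algebra_simps)
  let ?u = "(real N + 1/2) * t"
  { case 1
    have "(sin (t / 2))\<^sup>2 * (real (Suc N) + 2 * (\<Sum>k=1..Suc N. (real (Suc N) - real k) * cos (real k * t)))
      = (sin (t / 2))\<^sup>2 * (real N + 2 * (\<Sum>k=1..N. (real N - real k) * cos (real k * t)))
        + sin (t / 2) * (sin (t / 2) * (1 + 2 * (\<Sum>k=1..N. cos (real k * t))))"
      unfolding s by (simp add: algebra_simps power2_eq_square)
    also have "... = (sin (real N * t / 2))\<^sup>2 + sin (t / 2) * sin ?u"
      unfolding Suc.IH(1) dirichlet_closed ..
    also have "... = (sin (real (Suc N) * t / 2))\<^sup>2"
    proof -
      have e: "?u = real (Suc N) * t / 2 + real N * t / 2" "t / 2 = real (Suc N) * t / 2 - real N * t / 2"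
        by (simp_all add: algebra_simps add_divide_distrib)
      have "sin (x - y) * sin (x + y) = (sin x)\<^sup>2 - (sin y)\<^sup>2" for x y :: real
        by (simp add: sin_add sin_diff cos_squared_eq power_mult_distrib algebra_simps flip: power2_eq_square)
      from this[of "real (Suc N) * t / 2" "real N * t / 2"] show ?thesis unfolding e[symmetric] by simp
    qed
    finally show ?case . }
  { case 2
    have "2 * (sin (t / 2))\<^sup>2 * (2 * (\<Sum>k=1..Suc N. (real (Suc N) - real k) * sin (real k * t)))
      = 2 * (sin (t / 2))\<^sup>2 * (2 * (\<Sum>k=1..N. (real N - real k) * sin (real k * t)))
        + 2 * sin (t / 2) * (sin (t / 2) * (2 * (\<Sum>k=1..N. sin (real k * t))))"
      unfolding s by (simp add: algebra_simps power2_eq_square)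
    also have "... = real N * sin t - sin (real N * t) + 2 * sin (t / 2) * (cos (t / 2) - cos ?u)"
      unfolding Suc.IH(2) dirichlet_closed ..
    also have "2 * sin (t / 2) * cos (t / 2) = sin t" using sin_double[of "t / 2"] by simp
    then have "2 * sin (t / 2) * (cos (t / 2) - cos ?u) = sin t - 2 * sin (t / 2) * cos ?u"
      by (simp add: right_diff_distrib)
    also have "2 * sin (t / 2) * cos ?u = sin (?u + t / 2) - sin (?u - t / 2)"
      by (simp add: sin_add sin_diff)
    also have "?u + t / 2 = real (Suc N) * t" by (simp add: algebra_simps)
    also have "?u - t / 2 = real N * t" by (simp add: algebra_simps)
    finally show ?case by (simp add: algebra_simps) }
qed simp_all

text \<open>Multiplied out, the formulas also hold where sin (t/2) = 0. Elsewhere the second one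
  reads cfejer = cot (t/2) - sin (N t) / (2 N sin^2 (t/2)), which is how the truncated cotangent
  enters.\<close>

lemma fejer_closed:
  assumes "N > 0"
  shows "real N * (sin (t / 2))\<^sup>2 * fejer N t = (sin (real N * t / 2))\<^sup>2"
    and "real N * (2 * (sin (t / 2))\<^sup>2) * cfejer N t = real N * sin t - sin (real N * t)"
proof -
  have "real N * (\<Sum>k=1..N. 2 * (1 - real k / real N) * f k) = 2 * (\<Sum>k=1..N. (real N - real k) * f k)" for f :: "nat \<Rightarrow> real"
    unfolding sum_distrib_left using assms by (intro sum.cong) (auto simp: field_simps)
  then have "real N * fejer N t = real N + 2 * (\<Sum>k=1..N. (real N - real k) * cos (real k * t))"
    "real N * cfejer N t = 2 * (\<Sum>k=1..N. (real N - real k) * sin (real k * t))"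
    by (simp_all add: fejer_def cfejer_def trigpoly_def distrib_left)
  note * = this
  have "real N * (sin (t / 2))\<^sup>2 * fejer N t = (sin (t / 2))\<^sup>2 * (real N * fejer N t)" by simp
  also have "... = (sin (real N * t / 2))\<^sup>2" unfolding * by (rule fejer_sum_closed)
  finally show "real N * (sin (t / 2))\<^sup>2 * fejer N t = (sin (real N * t / 2))\<^sup>2" .
  have "real N * (2 * (sin (t / 2))\<^sup>2) * cfejer N t = 2 * (sin (t / 2))\<^sup>2 * (real N * cfejer N t)" by simp
  also have "... = real N * sin t - sin (real N * t)" unfolding * by (rule fejer_sum_closed)
  finally show "real N * (2 * (sin (t / 2))\<^sup>2) * cfejer N t = real N * sin t - sin (real N * t)" .
qed

lemma fejer_crude: "\<bar>fejer N t\<bar> \<le> 1 + 2 * N" "\<bar>cfejer N t\<bar> \<le> 2 * N"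
proof -
  have "\<bar>\<Sum>k=1..N. 2 * (1 - real k / real N) * f k\<bar> \<le> 2 * N" if f: "\<And>k. \<bar>f k\<bar> \<le> 1" for f :: "nat \<Rightarrow> real"
  proof -
    have "\<bar>\<Sum>k=1..N. 2 * (1 - real k / real N) * f k\<bar> \<le> (\<Sum>k=1..N. 2)"
    proof (rule order_trans[OF sum_abs sum_mono])
      fix k assume "k \<in> {1..N}"
      then have "\<bar>2 * (1 - real k / real N)\<bar> \<le> 2" by (auto simp: field_simps)
      then show "\<bar>2 * (1 - real k / real N) * f k\<bar> \<le> 2"
        using mult_mono[of "\<bar>2 * (1 - real k / real N)\<bar>" 2 "\<bar>f k\<bar>" 1] f[of k] by (simp add: abs_mult)
    qed
    then show ?thesis by simp
  qed
  from this[of "\<lambda>k. cos (real k * t)"] this[of "\<lambda>k. sin (real k * t)"]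
  show "\<bar>fejer N t\<bar> \<le> 1 + 2 * N" "\<bar>cfejer N t\<bar> \<le> 2 * N"
    by (auto simp: fejer_def cfejer_def trigpoly_def)
qed

lemma sin_half_zero: "sin (t / 2) = 0 \<Longrightarrow> sin (real k * t) = 0" "sin (t / 2) = 0 \<Longrightarrow> cos (real k * t) = 1"
proof -
  assume "sin (t / 2) = 0"
  then obtain i :: int where i: "t = 2 * pi * of_int i" by (auto simp: sin_zero_iff_int2)
  have "real k * t = 2 * pi * of_int (int k * i)" by (simp add: i)
  then show "sin (real k * t) = 0" "cos (real k * t) = 1"
    by (simp_all only: sin_integer_2pi cos_integer_2pi Ints_of_int)
qed

lemma fejer_nonneg: "fejer N t \<ge> 0"
proof (cases "N > 0")
  case True
  show ?thesis
  proof (cases "sin (t / 2) = 0")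
    case True
    have "(\<Sum>k=1..N. 2 * (1 - real k / real N)) \<ge> 0"
      using \<open>N > 0\<close> by (intro sum_nonneg) (auto simp: field_simps)
    then show ?thesis using sin_half_zero[OF True] by (simp add: fejer_def trigpoly_def)
  next
    case False
    then have "real N * (sin (t / 2))\<^sup>2 > 0" using \<open>N > 0\<close> by simp
    then show ?thesis using fejer_closed(1)[OF \<open>N > 0\<close>, of t] by (metis linorder_not_less mult_pos_neg zero_le_power2)
  qed
qed (simp add: fejer_def trigpoly_def)

text \<open>Jordan's inequality: sine is concave on [0, \<pi>] and so lies above its chord from 0 to
  \<pi>/2.\<close>

lemma sin_half_ge:
  assumes "\<bar>t\<bar> \<le> pi" shows "\<bar>sin (t / 2)\<bar> \<ge> \<bar>t\<bar> / pi"
proof -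
  have *: "sin (u / 2) \<ge> u / pi" if u: "0 \<le> u" "u \<le> pi" for u
  proof -
    have "concave_on {0..pi} sin"
      by (rule f''_le0_imp_concave[where f' = cos and f'' = "\<lambda>x. - sin x"])
         (auto intro!: derivative_eq_intros sin_ge_zero)
    moreover have "u / 2 = (1 - u / pi) * 0 + (u / pi) * (pi / 2)" by simp
    ultimately have "sin (u / 2) \<ge> (1 - u / pi) * sin 0 + (u / pi) * sin (pi / 2)"
      using concave_onD[of "{0..pi}" sin "u / pi" 0 "pi / 2"] u by simp
    then show ?thesis by simp
  qed
  show ?thesis
    using *[of "\<bar>t\<bar>"] assms by (cases "t \<ge> 0") auto
qed

section \<open>A common majorant for the kernels\<close>

text \<open>Of size N for |t| \<le> 1/N and of size 1/(N t^2) beyond: up to scaling a Poisson kernel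
  of the half plane. It dominates both the Fejer kernel and the difference of the conjugate Fejer
  kernel and the truncated cotangent.\<close>

definition kern :: "nat \<Rightarrow> real \<Rightarrow> real" where
  "kern N t = N / (1 + (N * t)\<^sup>2)"

lemma kern_measurable [measurable]: "kern N \<in> borel_measurable borel"
  unfolding kern_def by measurable

lemma kern_nonneg: "kern N t \<ge> 0"
  by (simp add: kern_def)

text \<open>The first bound is the one effective near 0, the second the one effective away from 0.
  The first plus N times the second is the claim multiplied by the denominator.\<close>

lemma le_kernI:
  assumes "A \<le> c * N" "A * (N * t\<^sup>2) \<le> d"
  shows "A \<le> (c + d) * kern N t"
proof -
  have pos: "1 + (N * t)\<^sup>2 > 0" by (intro add_pos_nonneg) auto
  have "A * (1 + (N * t)\<^sup>2) = A + (A * (N * t\<^sup>2)) * N" by (simp add: algebra_simps power_mult_distrib power2_eq_square)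
  also have "... \<le> c * N + d * N" using assms by (intro add_mono mult_right_mono) auto
  finally have "A * (1 + (N * t)\<^sup>2) \<le> (c + d) * N" by (simp add: algebra_simps)
  then show ?thesis using pos by (simp add: kern_def pos_le_divide_eq)
qed

lemma sin2_half_ge:
  assumes "\<bar>t\<bar> \<le> pi" shows "t\<^sup>2 \<le> pi\<^sup>2 * (sin (t / 2))\<^sup>2"
proof -
  have "\<bar>t\<bar> \<le> pi * \<bar>sin (t / 2)\<bar>" using sin_half_ge[OF assms] by (simp add: field_simps)
  then have "\<bar>t\<bar>\<^sup>2 \<le> (pi * \<bar>sin (t / 2)\<bar>)\<^sup>2" by (intro power_mono) auto
  then show ?thesis by (simp add: power_mult_distrib)
qed

lemma pi2_le: "pi\<^sup>2 \<le> 16"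
  using power_mono[of pi 4 2] pi_less_4 by simp

lemma fejer_le_kern:
  assumes N: "N > 0" and t: "\<bar>t\<bar> \<le> pi"
  shows "fejer N t \<le> 19 * kern N t"
proof -
  \<comment> \<open>3 comes from 1 + 2N \<le> 3N, and 16 from \<pi>^2 \<le> 16.\<close>
  have "fejer N t \<le> (3 + 16) * kern N t"
  proof (rule le_kernI)
    show "fejer N t \<le> 3 * real N" using fejer_crude(1)[of N t] N by auto
    have "fejer N t * (real N * t\<^sup>2) \<le> fejer N t * (real N * (pi\<^sup>2 * (sin (t / 2))\<^sup>2))"
      using sin2_half_ge[OF t] fejer_nonneg by (intro mult_left_mono) auto
    also have "... = pi\<^sup>2 * (sin (real N * t / 2))\<^sup>2" using fejer_closed(1)[OF N, of t] by (simp add: mult_ac)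
    also have "... \<le> 16 * 1" using pi2_le by (intro mult_mono) (auto simp: abs_square_le_1)
    finally show "fejer N t * (real N * t\<^sup>2) \<le> 16" by simp
  qed
  then show ?thesis by simp
qed

text \<open>Below the cut-off |t| < 1/N, where the crude bound 2N suffices. Above it the difference
  is sin (N t) / (2 N sin^2 (t/2)) up to sign, of order 1/(N t^2). Allowing a whole range of eps for
  each N lets N follow a continuous parameter later.\<close>

lemma cfejer_approx_cot:
  assumes N: "N > 0" and t: "\<bar>t\<bar> \<le> pi" and eps: "1 / (2 * N) \<le> eps" "eps \<le> 1 / N"
  shows "\<bar>cfejer N t - (if eps \<le> \<bar>t\<bar> then cot (t / 2) else 0)\<bar> \<le> 40 * kern N t"
proof (cases "eps \<le> \<bar>t\<bar>")
  case False
  have "\<bar>cfejer N t\<bar> \<le> (2 + 2) * kern N t"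
  proof (rule le_kernI)
    show "\<bar>cfejer N t\<bar> \<le> 2 * real N" using fejer_crude(2)[of N t] by simp
    have "\<bar>t\<bar> \<le> 1 / N" using False eps(2) by linarith
    then have "N * \<bar>t\<bar> \<le> 1" using N by (simp add: field_simps)
    then have "(N * \<bar>t\<bar>)\<^sup>2 \<le> 1\<^sup>2" by (intro power_mono) auto
    then have "(N * t)\<^sup>2 \<le> 1" by (simp add: power_mult_distrib)
    have "\<bar>cfejer N t\<bar> * (real N * t\<^sup>2) \<le> (2 * N) * (real N * t\<^sup>2)"
      using fejer_crude(2)[of N t] by (intro mult_right_mono) auto
    also have "... = 2 * (N * t)\<^sup>2" by (simp add: power2_eq_square)
    also have "... \<le> 2" using \<open>(N * t)\<^sup>2 \<le> 1\<close> by simp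
    finally show "\<bar>cfejer N t\<bar> * (real N * t\<^sup>2) \<le> 2" .
  qed
  also have "... \<le> 40 * kern N t" using kern_nonneg[of N t] by simp
  finally show ?thesis using False by simp
next
  case True
  define A where "A = \<bar>cfejer N t - cot (t / 2)\<bar>"
  have "0 < 1 / (2 * real N)" using N by simp
  then have "\<bar>t\<bar> > 0" using True eps(1) by linarith
  then have t0: "t \<noteq> 0" by simp
  have "0 < \<bar>t\<bar> / pi" using t0 by simp
  then have s0: "sin (t / 2) \<noteq> 0" using sin_half_ge[OF t] by (metis abs_zero less_le_not_le)
  have st: "sin t = 2 * sin (t / 2) * cos (t / 2)" using sin_double[of "t / 2"] by simp
  have "N * (2 * (sin (t / 2))\<^sup>2) * (cfejer N t - cot (t / 2)) = - sin (real N * t)"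
    using fejer_closed(2)[OF N, of t] s0 unfolding st
    by (simp add: right_diff_distrib cot_def power2_eq_square)
  then have "\<bar>N * (2 * (sin (t / 2))\<^sup>2) * (cfejer N t - cot (t / 2))\<bar> \<le> 1" by simp
  then have 1: "A * (N * (2 * (sin (t / 2))\<^sup>2)) \<le> 1" by (simp add: abs_mult A_def mult_ac)
  have 2: "A * (N * t\<^sup>2) \<le> 8"
  proof -
    have "A * (N * t\<^sup>2) \<le> A * (N * (pi\<^sup>2 * (sin (t / 2))\<^sup>2))"
      using sin2_half_ge[OF t] by (intro mult_left_mono) (auto simp: A_def)
    also have "... = pi\<^sup>2 / 2 * (A * (N * (2 * (sin (t / 2))\<^sup>2)))" by simp
    also have "... \<le> 8 * 1" using 1 pi2_le by (intro mult_mono) (auto simp: A_def)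
    finally show ?thesis by simp
  qed
  \<comment> \<open>8 bounds \<pi>^2/2. As |t| \<ge> 1/(2N) gives 1 \<le> 4 N^2 t^2, the same bound
    yields A \<le> 4 * 8 * N, which is the 32.\<close>
  have "A \<le> (32 + 8) * kern N t"
  proof (rule le_kernI[OF _ 2])
    have "1 / (2 * N) \<le> \<bar>t\<bar>" using True eps(1) by linarith
    then have "1 \<le> 2 * (N * \<bar>t\<bar>)" using N by (simp add: field_simps)
    then have "1\<^sup>2 \<le> (2 * (N * \<bar>t\<bar>))\<^sup>2" by (intro power_mono) auto
    then have "1 \<le> 4 * ((N * t\<^sup>2) * N)" by (simp add: power_mult_distrib power2_eq_square mult_ac)
    then have "A * 1 \<le> A * (4 * ((N * t\<^sup>2) * N))" by (intro mult_left_mono) (auto simp: A_def)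
    also have "... = 4 * (A * (N * t\<^sup>2)) * N" by simp
    also have "... \<le> 4 * 8 * real N" using 2 by (intro mult_right_mono mult_left_mono) auto
    finally show "A \<le> 32 * real N" by simp
  qed
  then show ?thesis using True by (simp add: A_def)
qed

subsection \<open>Fejer means and duality\<close>

lemma measure_circ [simp]: "measure circ UNIV = 2 * pi"
  by (simp add: measure_def emeasure_circ)

text \<open>The phase c lets one formula serve for sines too, as sin y = cos (y - \<pi>/2). The
  frequency is an integer because the product formulas produce differences of frequencies.\<close>

lemma integral_circ_cos:
  fixes m :: int
  shows "(LINT y|circ. cos (of_int m * y + c)) = (if m = 0 then 2 * pi * cos c else 0)"
proof -
  have eq: "(LINT y|circ. cos (of_int m * y + c)) = integral {-pi..pi} (\<lambda>y. cos (of_int m * y + c))"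
    by (intro integral_circ_HK continuous_intros)
  show ?thesis
  proof (cases "m = 0")
    case False
    have "((\<lambda>y. cos (of_int m * y + c)) has_integral
        (sin (of_int m * pi + c) / of_int m - sin (of_int m * (-pi) + c) / of_int m)) {-pi..pi}"
      by (rule fundamental_theorem_of_calculus)
         (use False in \<open>auto intro!: derivative_eq_intros simp flip: has_real_derivative_iff_has_vector_derivative\<close>)
    moreover have "sin (of_int m * pi + c) = sin (of_int m * (-pi) + c)"
    proof -
      have "of_int m * pi + c = (of_int m * (-pi) + c) + 2 * pi * of_int m" by (simp add: algebra_simps)
      moreover have "periodic sin" by (simp add: periodic_def)
      ultimately show ?thesis using periodic_int by metis
    qed
    ultimately show ?thesis using False by (simp add: eq integral_unique)
  qed (simp add: eq)
qed

lemma integral_circ_cos_cos: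
  assumes "j \<ge> 1" "k \<ge> 1"
  shows "(LINT y|circ. cos (real k * y + b) * cos (real j * y + a)) = (if j = k then pi * cos (b - a) else 0)"
proof -
  have i: "integrable circ (\<lambda>y. cos (of_int m * y + c) / 2)" for m :: int and c
    by (intro integral_circ_HK(1) continuous_intros) auto
  have "(\<lambda>y. cos (real k * y + b) * cos (real j * y + a))
     = (\<lambda>y. cos (of_int (int k - int j) * y + (b - a)) / 2 + cos (of_int (int k + int j) * y + (b + a)) / 2)"
    unfolding cos_times_cos by (intro ext) (simp add: algebra_simps add_divide_distrib)
  then have "(LINT y|circ. cos (real k * y + b) * cos (real j * y + a))
    = (LINT y|circ. cos (of_int (int k - int j) * y + (b - a)) / 2) + (LINT y|circ. cos (of_int (int k + int j) * y + (b + a)) / 2)"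
    using Bochner_Integration.integral_add[OF i[of "int k - int j" "b - a"] i[of "int k + int j" "b + a"]] by (simp only:)
  also have "... = (if j = k then pi * cos (b - a) else 0)"
    unfolding integral_divide_zero integral_circ_cos using assms by auto
  finally show ?thesis .
qed

lemma integral_circ_orthogonal:
  assumes "j \<ge> 1" "k \<ge> 1"
  shows "(LINT y|circ. cos (real k * y) * cos (real j * y)) = (if j = k then pi else 0)"
    and "(LINT y|circ. sin (real k * y) * cos (real j * y)) = 0"
    and "(LINT y|circ. cos (real k * y) * sin (real j * y)) = 0"
    and "(LINT y|circ. sin (real k * y) * sin (real j * y)) = (if j = k then pi else 0)"
  using integral_circ_cos_cos[OF assms, of 0 0] integral_circ_cos_cos[OF assms, of "- (pi/2)" 0]
    integral_circ_cos_cos[OF assms, of 0 "- (pi/2)"] integral_circ_cos_cos[OF assms, of "- (pi/2)" "- (pi/2)"]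
  by (simp_all add: cos_diff)

section \<open>Fejer means in terms of Fourier coefficients\<close>

text \<open>Taken without the usual factor 1/\<pi>, which therefore shows up in the coefficients of
  the means.\<close>

definition fourier_cos :: "(real \<Rightarrow> real) \<Rightarrow> nat \<Rightarrow> real" where
  "fourier_cos f k = (LINT y|circ. f y * cos (real k * y))"

definition fourier_sin :: "(real \<Rightarrow> real) \<Rightarrow> nat \<Rightarrow> real" where
  "fourier_sin f k = (LINT y|circ. f y * sin (real k * y))"

lemma integrable_circ_trig:
  assumes "integrable circ f"
  shows "integrable circ (\<lambda>y. f y * cos (c * y))" "integrable circ (\<lambda>y. f y * sin (c * y))"
  by (rule integrable_circ_mult_bounded[OF assms, of _ 1]; simp)+

lemma integral_mult_trigpoly:
  assumes f: "integrable circ f"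
  shows "(LINT y|circ. f y * trigpoly n a \<alpha> \<beta> y)
    = a * integral\<^sup>L circ f + (\<Sum>k=1..n. \<alpha> k * fourier_cos f k + \<beta> k * fourier_sin f k)"
proof -
  note i = integrable_circ_trig[OF f]
  have "(\<lambda>y. f y * trigpoly n a \<alpha> \<beta> y)
    = (\<lambda>y. a * f y + (\<Sum>k=1..n. \<alpha> k * (f y * cos (real k * y)) + \<beta> k * (f y * sin (real k * y))))"
    by (simp add: trigpoly_def distrib_left sum_distrib_left mult_ac)
  then show ?thesis
    using f i by (simp add: fourier_cos_def fourier_sin_def)
qed

lemma integrable_circ_trigpoly: "integrable circ (trigpoly n a \<alpha> \<beta>)"
  by (intro integral_circ_HK(1) continuous_intros)

lemma trigpoly_coeffs:
  shows "integral\<^sup>L circ (trigpoly n a \<alpha> \<beta>) = 2 * pi * a"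
    and "j \<ge> 1 \<Longrightarrow> fourier_cos (trigpoly n a \<alpha> \<beta>) j = (if j \<le> n then pi * \<alpha> j else 0)"
    and "j \<ge> 1 \<Longrightarrow> fourier_sin (trigpoly n a \<alpha> \<beta>) j = (if j \<le> n then pi * \<beta> j else 0)"
proof -
  have zc: "(LINT y|circ. cos (real k * y)) = 0" "(LINT y|circ. sin (real k * y)) = 0" if "k \<ge> 1" for k
    using integral_circ_cos[of "int k" 0] integral_circ_cos[of "int k" "- (pi/2)"] that
    by (simp_all add: cos_diff)
  have ic: "integrable circ (\<lambda>y. cos (real k * y))" "integrable circ (\<lambda>y. sin (real k * y))" for k
    by (intro integral_circ_HK(1) continuous_intros)+
  have one: "integral\<^sup>L circ (\<lambda>_. 1 :: real) = 2 * pi" by (simp add: measure_def emeasure_circ)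
  have "integral\<^sup>L circ (trigpoly n a \<alpha> \<beta>) = a * (2 * pi) + (\<Sum>k=1..n. \<alpha> k * fourier_cos (\<lambda>_. 1) k + \<beta> k * fourier_sin (\<lambda>_. 1) k)"
    using integral_mult_trigpoly[of "\<lambda>_. 1" n a \<alpha> \<beta>] one by simp
  also have "(\<Sum>k=1..n. \<alpha> k * fourier_cos (\<lambda>_. 1) k + \<beta> k * fourier_sin (\<lambda>_. 1) k) = 0"
    by (intro sum.neutral) (auto simp: fourier_cos_def fourier_sin_def zc)
  finally show "integral\<^sup>L circ (trigpoly n a \<alpha> \<beta>) = 2 * pi * a" by simp
  { assume j: "j \<ge> 1"
    have "fourier_cos (trigpoly n a \<alpha> \<beta>) j = (LINT y|circ. cos (real j * y) * trigpoly n a \<alpha> \<beta> y)"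
      by (simp add: fourier_cos_def mult.commute)
    also have "... = (\<Sum>k=1..n. if k = j then pi * \<alpha> j else 0)"
      unfolding integral_mult_trigpoly[OF ic(1)] zc(1)[OF j] mult_zero_right add_0
      by (intro sum.cong refl) (use j in \<open>auto simp: fourier_cos_def fourier_sin_def integral_circ_orthogonal\<close>)
    also have "... = (if j \<le> n then pi * \<alpha> j else 0)" using j by (simp add: sum.delta)
    finally show "fourier_cos (trigpoly n a \<alpha> \<beta>) j = (if j \<le> n then pi * \<alpha> j else 0)" .
    have "fourier_sin (trigpoly n a \<alpha> \<beta>) j = (LINT y|circ. sin (real j * y) * trigpoly n a \<alpha> \<beta> y)"
      by (simp add: fourier_sin_def mult.commute)
    also have "... = (\<Sum>k=1..n. if k = j then pi * \<beta> j else 0)"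
      unfolding integral_mult_trigpoly[OF ic(2)] zc(2)[OF j] mult_zero_right add_0
      by (intro sum.cong refl) (use j in \<open>auto simp: fourier_cos_def fourier_sin_def integral_circ_orthogonal\<close>)
    also have "... = (if j \<le> n then pi * \<beta> j else 0)" using j by (simp add: sum.delta)
    finally show "fourier_sin (trigpoly n a \<alpha> \<beta>) j = (if j \<le> n then pi * \<beta> j else 0)" . }
qed

definition fmean :: "nat \<Rightarrow> (real \<Rightarrow> real) \<Rightarrow> real \<Rightarrow> real" where
  "fmean N f x = (1 / (2 * pi)) * (LINT y|circ. f y * fejer N (x - y))"

definition cmean :: "nat \<Rightarrow> (real \<Rightarrow> real) \<Rightarrow> real \<Rightarrow> real" where
  "cmean N f x = (1 / (2 * pi)) * (LINT y|circ. f y * cfejer N (x - y))"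

text \<open>The addition theorems make each kernel a trigonometric polynomial in y with coefficients
  depending on x. The result displays \<open>cmean N f\<close> as the conjugate of
  \<open>fmean N f\<close>, in the exact form to which the polynomial inequality applies.\<close>

lemma
  assumes f: "integrable circ f"
  shows fmean_trigpoly: "fmean N f = trigpoly N (integral\<^sup>L circ f / (2 * pi))
      (\<lambda>k. (1 - k / N) / pi * fourier_cos f k) (\<lambda>k. (1 - k / N) / pi * fourier_sin f k)"
    and cmean_trigpoly: "cmean N f = trigpoly N 0
      (\<lambda>k. - ((1 - k / N) / pi * fourier_sin f k)) (\<lambda>k. (1 - k / N) / pi * fourier_cos f k)"
proof -
  have e: "fejer N (x - y) = trigpoly N 1 (\<lambda>k. 2 * (1 - k / N) * cos (real k * x)) (\<lambda>k. 2 * (1 - k / N) * sin (real k * x)) y"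
    "cfejer N (x - y) = trigpoly N 0 (\<lambda>k. 2 * (1 - k / N) * sin (real k * x)) (\<lambda>k. - 2 * (1 - k / N) * cos (real k * x)) y" for x y
    unfolding fejer_def cfejer_def trigpoly_def
    by (auto intro!: sum.cong simp: right_diff_distrib cos_diff sin_diff) (simp_all add: algebra_simps)
  show "fmean N f = trigpoly N (integral\<^sup>L circ f / (2 * pi))
      (\<lambda>k. (1 - k / N) / pi * fourier_cos f k) (\<lambda>k. (1 - k / N) / pi * fourier_sin f k)"
    unfolding fmean_def e integral_mult_trigpoly[OF f]
    by (auto simp: fun_eq_iff trigpoly_def distrib_left sum_distrib_left intro!: sum.cong) (simp add: field_simps)
  show "cmean N f = trigpoly N 0
      (\<lambda>k. - ((1 - k / N) / pi * fourier_sin f k)) (\<lambda>k. (1 - k / N) / pi * fourier_cos f k)"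
    unfolding cmean_def e integral_mult_trigpoly[OF f]
    by (auto simp: fun_eq_iff trigpoly_def distrib_left sum_distrib_left intro!: sum.cong) (simp add: field_simps)
qed

text \<open>The conjugate kernel is odd, so convolution with it is antisymmetric; here this is read
  off from the Fourier coefficients.\<close>

lemma integral_cmean_commute:
  assumes f: "integrable circ f" and g: "integrable circ g"
  shows "(LINT x|circ. g x * cmean N f x) = - (LINT x|circ. f x * cmean N g x)"
  unfolding cmean_trigpoly[OF f] cmean_trigpoly[OF g] integral_mult_trigpoly[OF f] integral_mult_trigpoly[OF g]
  by (auto intro!: sum.cong simp: mult_ac sum_negf[symmetric])

text \<open>Conjugation and Fejer summation are both Fourier multipliers and hence commute.\<close>

lemma cmean_eq_fmean_conjugate:
  "cmean N (trigpoly n a \<alpha> \<beta>) = fmean N (trigpoly n 0 (\<lambda>k. - \<beta> k) \<alpha>)"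
  unfolding fmean_trigpoly[OF integrable_circ_trigpoly] cmean_trigpoly[OF integrable_circ_trigpoly]
  by (auto simp: fun_eq_iff trigpoly_def trigpoly_coeffs intro!: sum.cong)

lemma fmean_trigpoly_tendsto:
  "(\<lambda>N. fmean N (trigpoly n a \<alpha> \<beta>) x) \<longlonglongrightarrow> trigpoly n a \<alpha> \<beta> x"
proof (rule Lim_transform_eventually)
  have "(\<lambda>N. 1 - real k / real N) \<longlonglongrightarrow> 1 - 0" for k
    by (intro tendsto_intros lim_const_over_n)
  then have w: "(\<lambda>N. 1 - real k / real N) \<longlonglongrightarrow> 1" for k by simp
  have "(\<lambda>N. trigpoly n a (\<lambda>k. (1 - real k / real N) * \<alpha> k) (\<lambda>k. (1 - real k / real N) * \<beta> k) x)
     \<longlonglongrightarrow> a + (\<Sum>k=1..n. (1 * \<alpha> k) * cos (real k * x) + (1 * \<beta> k) * sin (real k * x))"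
    unfolding trigpoly_def by (intro tendsto_intros w)
  then show "(\<lambda>N. trigpoly n a (\<lambda>k. (1 - real k / real N) * \<alpha> k) (\<lambda>k. (1 - real k / real N) * \<beta> k) x)
     \<longlonglongrightarrow> trigpoly n a \<alpha> \<beta> x" by (simp add: trigpoly_def)
  show "\<forall>\<^sub>F N in sequentially. trigpoly n a (\<lambda>k. (1 - real k / real N) * \<alpha> k) (\<lambda>k. (1 - real k / real N) * \<beta> k) x
     = fmean N (trigpoly n a \<alpha> \<beta>) x"
    using eventually_ge_at_top[of n]
  proof eventually_elim
    case (elim N)
    have "(\<Sum>k=1..N. (1 - real k / real N) / pi * fourier_cos (trigpoly n a \<alpha> \<beta>) k * cos (real k * x)
           + (1 - real k / real N) / pi * fourier_sin (trigpoly n a \<alpha> \<beta>) k * sin (real k * x))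
       = (\<Sum>k=1..n. (1 - real k / real N) * \<alpha> k * cos (real k * x) + (1 - real k / real N) * \<beta> k * sin (real k * x))"
      using elim by (intro sum.mono_neutral_cong_right) (auto simp: trigpoly_coeffs)
    then show ?case
      unfolding fmean_trigpoly[OF integrable_circ_trigpoly] by (simp add: trigpoly_def trigpoly_coeffs)
  qed
qed

lemma fejer_mass: "(LINT y|circ. fejer N (x - y)) = 2 * pi"
proof -
  have "integral\<^sup>L circ (\<lambda>_. 1::real) = 2 * pi" by (simp add: measure_def emeasure_circ)
  moreover have "integral\<^sup>L circ (\<lambda>y. fejer N (x - y)) = integral\<^sup>L circ (fejer N)"
    by (intro integral_circ_reflect) (auto simp: fejer_def periodic_trigpoly)
  ultimately show ?thesis by (simp add: fejer_def trigpoly_coeffs)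
qed

lemma integrable_mult_fejer:
  assumes "integrable circ f"
  shows "integrable circ (\<lambda>y. f y * fejer N (x - y))" "integrable circ (\<lambda>y. f y * cfejer N (x - y))"
  using fejer_crude[of N]
  by (auto intro!: integrable_circ_mult_bounded[OF assms, where B = "1 + 2 * N"] order_trans[OF fejer_crude(2)])

lemma fmean_mono:
  assumes "integrable circ f" "integrable circ g" "\<And>x. f x \<le> g x"
  shows "fmean N f x \<le> fmean N g x"
  unfolding fmean_def using assms fejer_nonneg
  by (intro mult_left_mono integral_mono integrable_mult_fejer mult_right_mono) auto

lemma fmean_linear:
  assumes "integrable circ f"
  shows "fmean N (\<lambda>y. c * f y + d) x = c * fmean N f x + d"
proof -
  have i: "integrable circ (\<lambda>y. fejer N (x - y))" using integrable_mult_fejer(1)[of "\<lambda>_. 1"] by simp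
  have "(LINT y|circ. (c * f y + d) * fejer N (x - y)) = (LINT y|circ. c * (f y * fejer N (x - y)) + d * fejer N (x - y))"
    by (simp add: algebra_simps)
  also have "... = c * (LINT y|circ. f y * fejer N (x - y)) + d * (2 * pi)"
    using i integrable_mult_fejer(1)[OF assms, of N x] by (simp add: fejer_mass)
  finally show ?thesis unfolding fmean_def by (simp add: field_simps)
qed

section \<open>Fejer means contract L_p\<close>

text \<open>The left side is the tangent line of |y|^p at y = m; that it lies below the graph is
  Young's inequality for |y| and |m|^(p-1).\<close>

lemma abs_powr_tangent:
  fixes p m y :: real
  assumes p: "p > 1"
  shows "p * (\<bar>m\<bar> powr (p - 1) * sgn m) * y + (1 - p) * \<bar>m\<bar> powr p \<le> \<bar>y\<bar> powr p"
proof -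
  define q where "q = p / (p - 1)"
  have q: "q > 1" "1 / p + 1 / q = 1" using p by (auto simp: q_def field_simps)
  have "\<bar>y\<bar> * \<bar>m\<bar> powr (p - 1) \<le> \<bar>y\<bar> powr p / p + (\<bar>m\<bar> powr (p - 1)) powr q / q"
    by (rule Youngs_inequality) (use p q in auto)
  also have "(\<bar>m\<bar> powr (p - 1)) powr q = \<bar>m\<bar> powr p" using p by (simp add: powr_powr q_def)
  finally have "p * (\<bar>y\<bar> * \<bar>m\<bar> powr (p - 1)) \<le> p * (\<bar>y\<bar> powr p / p + \<bar>m\<bar> powr p / q)"
    using p by (intro mult_left_mono) auto
  also have "... = \<bar>y\<bar> powr p + (p - 1) * \<bar>m\<bar> powr p"
    using p by (simp add: q_def field_simps)
  finally have 1: "p * (\<bar>y\<bar> * \<bar>m\<bar> powr (p - 1)) \<le> \<bar>y\<bar> powr p + (p - 1) * \<bar>m\<bar> powr p" .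
  have "p * (\<bar>m\<bar> powr (p - 1) * sgn m) * y = p * \<bar>m\<bar> powr (p - 1) * (sgn m * y)" by simp
  also have "... \<le> p * \<bar>m\<bar> powr (p - 1) * \<bar>y\<bar>"
    using p by (intro mult_left_mono) (auto simp: sgn_if)
  finally show ?thesis using 1 by (simp add: algebra_simps)
qed

lemma abs_powr_sgn: "\<bar>m\<bar> powr (p - 1) * sgn m * m = \<bar>m\<bar> powr p" for m p :: real
proof (cases "m = 0")
  case False
  then have "\<bar>m\<bar> powr p = \<bar>m\<bar> powr (p - 1) * \<bar>m\<bar>"
    by (simp add: powr_diff)
  then show ?thesis by (simp add: sgn_if abs_if split: if_splits)
qed simp

lemma integrable_powr_imp_integrable:
  fixes f :: "real \<Rightarrow> real"
  assumes [measurable]: "f \<in> borel_measurable borel" and p: "p \<ge> 1" and i: "integrable circ (\<lambda>x. \<bar>f x\<bar> powr p)"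
  shows "integrable circ f"
proof (rule Bochner_Integration.integrable_bound)
  show "integrable circ (\<lambda>x. \<bar>f x\<bar> powr p + 1)" using i by simp
  have "\<bar>y\<bar> \<le> \<bar>y\<bar> powr p + 1" for y :: real
  proof (cases "\<bar>y\<bar> \<le> 1")
    case False
    then have "\<bar>y\<bar> powr 1 \<le> \<bar>y\<bar> powr p" using p by (intro powr_mono) auto
    then show ?thesis by simp
  qed (simp add: add_increasing)
  then show "AE x in circ. norm (f x) \<le> norm (\<bar>f x\<bar> powr p + 1)" by (simp add: add_nonneg_nonneg)
qed auto

text \<open>A Fejer mean is a positive linear functional that preserves constants. It is applied to
  the tangent line at the mean \<open>m\<close> itself, where the line takes the value
  |m|^p.\<close>

lemma fmean_jensen:
  fixes f :: "real \<Rightarrow> real"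
  assumes f: "f \<in> borel_measurable borel" and p: "p > 1" and i: "integrable circ (\<lambda>x. \<bar>f x\<bar> powr p)"
  shows "\<bar>fmean N f x\<bar> powr p \<le> fmean N (\<lambda>x. \<bar>f x\<bar> powr p) x"
proof -
  have f1: "integrable circ f" using integrable_powr_imp_integrable[OF f _ i] p by simp
  define m where "m = fmean N f x"
  let ?c = "p * (\<bar>m\<bar> powr (p - 1) * sgn m)" and ?d = "(1 - p) * \<bar>m\<bar> powr p"
  have "fmean N (\<lambda>y. ?c * f y + ?d) x \<le> fmean N (\<lambda>x. \<bar>f x\<bar> powr p) x"
    by (rule fmean_mono) (use f1 i abs_powr_tangent[OF p, of m] in auto)
  also have "fmean N (\<lambda>y. ?c * f y + ?d) x = p * (\<bar>m\<bar> powr (p - 1) * sgn m * m) + ?d"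
    unfolding fmean_linear[OF f1] by (simp add: m_def)
  also have "... = \<bar>m\<bar> powr p" unfolding abs_powr_sgn by (simp add: algebra_simps)
  finally show ?thesis by (simp add: m_def)
qed

lemma integrable_circ_trigpoly_powr: "p > 0 \<Longrightarrow> integrable circ (\<lambda>x. \<bar>trigpoly n a \<alpha> \<beta> x\<bar> powr p)"
  by (intro integral_circ_HK(1) continuous_on_powr' continuous_intros) auto

text \<open>After Jensen, the mean of |f|^p is a trigonometric polynomial whose constant term is the
  average of |f|^p, so its integral is unchanged.\<close>

lemma fmean_contraction:
  fixes f :: "real \<Rightarrow> real"
  assumes f: "f \<in> borel_measurable borel" and p: "p > 1" and i: "integrable circ (\<lambda>x. \<bar>f x\<bar> powr p)"
  shows "(LINT x|circ. \<bar>fmean N f x\<bar> powr p) \<le> (LINT x|circ. \<bar>f x\<bar> powr p)"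
proof -
  have f1: "integrable circ f" using integrable_powr_imp_integrable[OF f _ i] p by simp
  have "(LINT x|circ. \<bar>fmean N f x\<bar> powr p) \<le> (LINT x|circ. fmean N (\<lambda>x. \<bar>f x\<bar> powr p) x)"
  proof (rule integral_mono)
    show "integrable circ (\<lambda>x. \<bar>fmean N f x\<bar> powr p)"
      unfolding fmean_trigpoly[OF f1] using p by (intro integrable_circ_trigpoly_powr) auto
    show "integrable circ (fmean N (\<lambda>x. \<bar>f x\<bar> powr p))"
      unfolding fmean_trigpoly[OF i] by (rule integrable_circ_trigpoly)
  qed (rule fmean_jensen[OF f p i])
  also have "... = (LINT x|circ. \<bar>f x\<bar> powr p)"
    unfolding fmean_trigpoly[OF i] trigpoly_coeffs by simp
  finally show ?thesis .
qed

lemma fmean_bounded: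
  assumes "f \<in> borel_measurable borel" "\<And>x. \<bar>f x\<bar> \<le> B"
  shows "\<bar>fmean N f x\<bar> \<le> B"
proof -
  have i: "integrable circ f" by (rule integrable_circ_bounded[OF assms])
  have c: "fmean N (\<lambda>_. d) x = d" for d using fmean_linear[of "\<lambda>_. 0" N 0 d x] by simp
  have "fmean N f x \<le> fmean N (\<lambda>_. B) x" "fmean N (\<lambda>_. -B) x \<le> fmean N f x"
    using assms(2) by (intro fmean_mono i; force simp: abs_le_iff minus_le_iff)+
  then show ?thesis unfolding c by linarith
qed

section \<open>The polynomial inequality for all exponents, by duality\<close>

lemma conjugate_trigpoly_tan:
  assumes p: "1 < p" "p \<le> 2"
  shows "(LINT t|circ. \<bar>trigpoly n 0 (\<lambda>k. - \<beta> k) \<alpha> t\<bar> powr p)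
    \<le> tan (pi / (2 * p)) powr p * (LINT t|circ. \<bar>trigpoly n a \<alpha> \<beta> t\<bar> powr p)"
proof -
  have "continuous_on UNIV (\<lambda>t. \<bar>trigpoly n a \<alpha> \<beta> t\<bar> powr p)" for a \<alpha> \<beta>
    using p by (intro continuous_on_powr' continuous_intros) auto
  then show ?thesis using conjugate_trigpoly_le_2[OF p] by (simp add: integral_circ_HK(2))
qed

text \<open>
  The conjugate \<open>S\<close> of \<open>T\<close> is tested against \<open>\<phi> = \<bar>S\<bar>\<^bsup>p-1\<^esup> sgn S\<close>, and conjugation is moved onto the Fejer
  means of \<open>\<phi>\<close>. With \<open>\<chi>\<close> the conjugate mean, Young's inequality for \<open>(K \<bar>T\<bar>) (\<bar>\<chi>\<bar> / K)\<close> bounds the second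
  summand by \<open>(\<integral>\<bar>S\<bar>\<^sup>p) / q\<close> exactly because of the weight \<open>K\<close>, and this is absorbed on the left.
\<close>

lemma conjugate_trigpoly_dual:
  fixes \<alpha> \<beta> :: "nat \<Rightarrow> real"
  assumes q: "1 < q" "q \<le> 2" and pq: "1 / p + 1 / q = 1"
  shows "(LINT t|circ. \<bar>trigpoly n 0 (\<lambda>k. - \<beta> k) \<alpha> t\<bar> powr p)
    \<le> tan (pi / (2 * q)) powr p * (LINT t|circ. \<bar>trigpoly n a \<alpha> \<beta> t\<bar> powr p)"
proof -
  define S where "S = trigpoly n 0 (\<lambda>k. - \<beta> k) \<alpha>"
  define T where "T = trigpoly n a \<alpha> \<beta>"
  define K where "K = tan (pi / (2 * q))"
  have K: "K > 0" unfolding K_def using q by (intro tan_gt_zero) (auto simp: field_simps)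
  have p: "p > 1" "q * (p - 1) = p"
  proof -
    have "1 / q < 1" using q by simp
    then have "1 / p > 0" using pq by linarith
    then have p0: "p > 0" by simp
    then show e: "q * (p - 1) = p" using pq q by (simp add: field_simps)
    then show "p > 1" using q p0 by (metis diff_gt_0_iff_gt zero_less_mult_pos less_trans zero_less_one)
  qed
  have [measurable]: "S \<in> borel_measurable borel" "T \<in> borel_measurable borel" by (auto simp: S_def T_def)
  define \<phi> where "\<phi> y = \<bar>S y\<bar> powr (p - 1) * sgn (S y)" for y
  have [measurable]: "\<phi> \<in> borel_measurable borel" unfolding \<phi>_def by measurable
  obtain B where B: "\<And>x. \<bar>S x\<bar> \<le> B" using trigpoly_bounded unfolding S_def by blast
  have \<phi>B: "\<bar>\<phi> y\<bar> \<le> B powr (p - 1)" for y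
  proof -
    have "\<bar>S y\<bar> powr (p - 1) * \<bar>sgn (S y)\<bar> \<le> B powr (p - 1) * 1"
      using B p by (intro mult_mono powr_mono2) (auto simp: sgn_if)
    then show ?thesis by (simp add: \<phi>_def abs_mult)
  qed
  have i: "integrable circ \<phi>" "integrable circ S" "integrable circ T"
  proof -
    show "integrable circ \<phi>" by (rule integrable_circ_bounded[OF _ \<phi>B]) measurable
    show "integrable circ S" "integrable circ T" unfolding S_def T_def by (rule integrable_circ_trigpoly)+
  qed
  have \<phi>q: "\<bar>\<phi> y\<bar> powr q = \<bar>S y\<bar> powr p" for y
    using p by (cases "S y = 0") (auto simp: \<phi>_def abs_mult powr_powr mult.commute)
  have \<phi>S: "\<phi> y * S y = \<bar>S y\<bar> powr p" for y unfolding \<phi>_def by (rule abs_powr_sgn)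
  define I where "I f r = (LINT x|circ. \<bar>f x\<bar> powr r)" for f :: "real \<Rightarrow> real" and r
  have iS: "integrable circ (\<lambda>x. \<bar>S x\<bar> powr p)" "integrable circ (\<lambda>x. \<bar>T x\<bar> powr p)"
    unfolding S_def T_def using p by (auto intro!: integrable_circ_trigpoly_powr)
  have le: "(LINT x|circ. \<phi> x * fmean N S x) \<le> K powr p * I T p / p + I S p / q" for N
  proof -
    have ic: "integrable circ (\<lambda>x. \<bar>cmean N \<phi> x\<bar> powr q)"
      unfolding cmean_trigpoly[OF i(1)] using q by (auto intro!: integrable_circ_trigpoly_powr)
    have iT: "integrable circ (\<lambda>x. T x * cmean N \<phi> x)"
      unfolding cmean_trigpoly[OF i(1)] T_def by (intro integral_circ_HK(1) continuous_intros)
    have "(LINT x|circ. \<phi> x * fmean N S x) = (LINT x|circ. \<phi> x * cmean N T x)"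
      by (simp add: S_def T_def cmean_eq_fmean_conjugate)
    also have "... = (LINT x|circ. - (T x * cmean N \<phi> x))"
      using integral_cmean_commute[OF i(3) i(1)] by simp
    also have "... \<le> (LINT x|circ. K powr p / p * \<bar>T x\<bar> powr p + K powr (- q) / q * \<bar>cmean N \<phi> x\<bar> powr q)"
    proof (rule integral_mono)
      fix x
      have "- (T x * cmean N \<phi> x) \<le> \<bar>T x\<bar> * \<bar>cmean N \<phi> x\<bar>"
        using abs_ge_minus_self[of "T x * cmean N \<phi> x"] by (simp add: abs_mult)
      also have "... = (K * \<bar>T x\<bar>) * (\<bar>cmean N \<phi> x\<bar> / K)" using K by simp
      also have "... \<le> (K * \<bar>T x\<bar>) powr p / p + (\<bar>cmean N \<phi> x\<bar> / K) powr q / q"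
        by (rule Youngs_inequality) (use p q pq K in auto)
      also have "... = K powr p / p * \<bar>T x\<bar> powr p + K powr (- q) / q * \<bar>cmean N \<phi> x\<bar> powr q"
        using K by (simp add: powr_mult powr_divide powr_minus field_simps)
      finally show "- (T x * cmean N \<phi> x) \<le> K powr p / p * \<bar>T x\<bar> powr p + K powr (- q) / q * \<bar>cmean N \<phi> x\<bar> powr q" .
    qed (use iS ic iT in auto)
    also have "... = K powr p / p * I T p + K powr (- q) / q * I (cmean N \<phi>) q"
      using iS ic by (simp add: I_def)
    also have "I (cmean N \<phi>) q \<le> K powr q * I (fmean N \<phi>) q"
      unfolding I_def K_def cmean_trigpoly[OF i(1)] fmean_trigpoly[OF i(1)] by (rule conjugate_trigpoly_tan[OF q])
    also have "I (fmean N \<phi>) q \<le> I \<phi> q"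
      unfolding I_def by (rule fmean_contraction) (use q iS \<phi>q in auto)
    also have "I \<phi> q = I S p" by (simp add: I_def \<phi>q)
    finally show ?thesis using K q by (simp add: powr_minus mult_left_mono field_simps)
  qed
  \<comment> \<open>The test function \<phi> need not be a polynomial, so conjugation was moved
    across the means of order N. Letting N grow recovers the integral of \<phi> S = |S|^p.\<close>
  have "(\<lambda>N. LINT x|circ. \<phi> x * fmean N S x) \<longlonglongrightarrow> (LINT x|circ. \<phi> x * S x)"
  proof (rule integral_dominated_convergence[where w = "\<lambda>_. B powr (p - 1) * B"])
    show "AE x in circ. (\<lambda>N. \<phi> x * fmean N S x) \<longlonglongrightarrow> \<phi> x * S x"
      unfolding S_def by (intro AE_I2 tendsto_intros fmean_trigpoly_tendsto)
    fix N
    show "AE x in circ. norm (\<phi> x * fmean N S x) \<le> B powr (p - 1) * B"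
      using \<phi>B fmean_bounded[OF _ B] by (intro AE_I2) (auto simp: abs_mult intro!: mult_mono)
    have "fmean N S \<in> borel_measurable borel" unfolding fmean_trigpoly[OF i(2)] by simp
    then show "(\<lambda>x. \<phi> x * fmean N S x) \<in> borel_measurable circ" by simp
  qed auto
  then have "I S p \<le> K powr p * I T p / p + I S p / q"
    unfolding \<phi>S I_def[symmetric] by (rule LIMSEQ_le_const2) (use le in auto)
  moreover have "I S p / q = I S p - I S p / p"
  proof -
    have "1 / q = 1 - 1 / p" using pq by simp
    then have "I S p * (1 / q) = I S p * (1 - 1 / p)" by simp
    then show ?thesis by (simp add: right_diff_distrib)
  qed
  ultimately have "I S p / p \<le> K powr p * I T p / p" by simp
  then have "I S p \<le> K powr p * I T p" using p by (simp add: divide_le_cancel)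
  then show ?thesis by (simp add: I_def S_def T_def K_def)
qed

lemma K_H_pos:
  assumes "p > 1" shows "K_H p > 0"
proof -
  have 1: "0 < pi / (2 * p)" "pi / (2 * p) < pi / 2" using assms by (auto simp: field_simps)
  have "pi / (2 * p) < pi" by (rule less_trans[OF 1(2)]) simp
  then have "tan (pi / (2 * p)) > 0" "sin (pi / (2 * p)) > 0" "cos (pi / (2 * p)) > 0"
    using 1 tan_gt_zero sin_gt_zero cos_gt_zero by blast+
  then show ?thesis by (simp add: K_H_def cot_def)
qed

theorem conjugate_trigpoly_bound:
  assumes p: "1 < p"
  shows "(LINT t|circ. \<bar>trigpoly n 0 (\<lambda>k. - \<beta> k) \<alpha> t\<bar> powr p)
    \<le> K_H p powr p * (LINT t|circ. \<bar>trigpoly n a \<alpha> \<beta> t\<bar> powr p)"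
proof (cases "p \<le> 2")
  case True
  then show ?thesis using conjugate_trigpoly_tan[OF p True] by (simp add: K_H_def)
next
  case False
  define q where "q = p / (p - 1)"
  have q: "1 < q" "q \<le> 2" "1 / p + 1 / q = 1" using False by (auto simp: q_def field_simps)
  have "pi / (2 * q) = pi / 2 - pi / (2 * p)" using False by (simp add: q_def field_simps)
  then have "tan (pi / (2 * q)) = cot (pi / (2 * p))"
    by (simp add: tan_def cot_def cos_diff sin_diff)
  then show ?thesis using conjugate_trigpoly_dual[OF q] False by (simp add: K_H_def)
qed

subsection \<open>Lebesgue points\<close>

text \<open>Take the least j with |t| N \<le> 2^j. Minimality gives (N t)^2 \<ge> 4^(j-1) when j >
  0, which accounts for the factor 4.\<close>

lemma kern_le_dyadic:
  assumes N: "N > 0"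
  shows "\<exists>j. \<bar>t\<bar> \<le> 2 ^ j / real N \<and> kern N t \<le> 4 * real N / 4 ^ j"
proof -
  have "\<exists>j. \<bar>t\<bar> * N \<le> 2 ^ j"
    using real_arch_pow[of 2 "\<bar>t\<bar> * N"] by (auto intro: less_imp_le)
  define j where "j = (LEAST j. \<bar>t\<bar> * N \<le> 2 ^ j)"
  have j: "\<bar>t\<bar> * N \<le> 2 ^ j" unfolding j_def by (rule LeastI_ex) fact
  have pos: "1 + (N * t)\<^sup>2 > 0" by (intro add_pos_nonneg) auto
  have "kern N t \<le> 4 * real N / 4 ^ j"
  proof (cases j)
    case 0
    have "real N / (1 + (N * t)\<^sup>2) \<le> real N / 1" using pos by (intro divide_left_mono) auto
    then show ?thesis using 0 by (simp add: kern_def)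
  next
    case (Suc i)
    have "\<not> \<bar>t\<bar> * N \<le> 2 ^ i" using not_less_Least[of i "\<lambda>j. \<bar>t\<bar> * N \<le> 2 ^ j"] Suc unfolding j_def by auto
    then have "(2 ^ i)\<^sup>2 \<le> (\<bar>t\<bar> * N)\<^sup>2" by (intro power_mono) auto
    then have "4 ^ i \<le> (N * t)\<^sup>2"
      by (simp add: power_mult_distrib power2_eq_square mult_ac flip: power_mult_distrib)
    then have "real N / (1 + (N * t)\<^sup>2) \<le> real N / 4 ^ i"
      using pos by (intro divide_left_mono) (auto intro: mult_pos_pos)
    then show ?thesis using Suc by (simp add: kern_def)
  qed
  then show ?thesis using j N by (intro exI[of _ j]) (simp add: field_simps)
qed

lemma kern_le: "kern N t \<le> N"
proof -
  have "1 + (N * t)\<^sup>2 > 0" by (intro add_pos_nonneg) auto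
  then have "real N / (1 + (N * t)\<^sup>2) \<le> real N / 1" by (intro divide_left_mono) auto
  then show ?thesis by (simp add: kern_def)
qed

text \<open>The dyadic bound dominates the integral by a sum over j of 4 * 2^(-j) * A (2^j/N), with
  A s the mass of h on [-s, s] divided by s. Each term tends to 0 by hypothesis and A is bounded, so
  Tannery's theorem allows the limit to be taken under the sum.\<close>

lemma kern_average_tendsto_0:
  fixes h :: "real \<Rightarrow> real"
  assumes h: "integrable circ h" "\<And>t. h t \<ge> 0"
    and lim: "((\<lambda>s. (LINT t|circ. h t * indicator {-s..s} t) / s) \<longlongrightarrow> 0) (at_right 0)"
  shows "(\<lambda>N. LINT t|circ. h t * kern N t) \<longlonglongrightarrow> 0"
proof -
  have [measurable]: "h \<in> borel_measurable borel" using borel_measurable_integrable[OF h(1)] by simp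
  define \<Phi> where "\<Phi> s = (LINT t|circ. h t * indicator {-s..s} t)" for s
  define A where "A s = \<Phi> s / s" for s
  have ih: "integrable circ (\<lambda>t. h t * indicator {-s..s} t)" for s
    by (rule integrable_circ_mult_bounded[OF h(1), of _ 1]) (auto simp: indicator_def)
  have \<Phi>0: "\<Phi> s \<ge> 0" for s unfolding \<Phi>_def using h(2) by (intro Bochner_Integration.integral_nonneg) (auto simp: indicator_def)
  have \<Phi>1: "\<Phi> s \<le> integral\<^sup>L circ h" for s
    unfolding \<Phi>_def using h ih by (intro integral_mono) (auto simp: indicator_def)
  \<comment> \<open>Near 0 the assumed limit bounds A, and away from 0 the total mass of h does. The
    value s = 0, where A is 0 by division by zero, is included because 2^j / real N is 0 for N =
    0.\<close>
  obtain C where C: "\<And>s. s \<ge> 0 \<Longrightarrow> \<bar>A s\<bar> \<le> C" "C \<ge> 0"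
  proof -
    have "\<forall>\<^sub>F s in at_right 0. A s < 1"
      using order_tendstoD(2)[OF lim, of 1] by (simp add: A_def \<Phi>_def)
    then obtain \<delta> where \<delta>: "\<delta> > 0" "\<And>s. 0 < s \<Longrightarrow> s < \<delta> \<Longrightarrow> A s < 1"
      unfolding eventually_at_right_field by auto
    have "\<bar>A s\<bar> \<le> max 1 (integral\<^sup>L circ h / \<delta>)" if "s \<ge> 0" for s
    proof (cases "s < \<delta>")
      case True
      have "A s \<ge> 0" using \<Phi>0[of s] that by (simp add: A_def)
      moreover have "A s \<le> 1" using \<delta>(2)[of s] that True by (cases "s = 0") (auto simp: A_def[of 0])
      ultimately show ?thesis by simp
    next
      case False
      then have "A s \<le> integral\<^sup>L circ h / \<delta>"
        unfolding A_def using \<delta> \<Phi>0[of s] \<Phi>1[of s] by (intro frac_le) auto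
      then show ?thesis using \<Phi>0[of s] that by (auto simp: A_def)
    qed
    moreover have "0 \<le> max 1 (integral\<^sup>L circ h / \<delta>)" by (rule order_trans[OF zero_le_one max.cobounded1])
    ultimately show ?thesis by (rule that)
  qed
  define a where "a j N = 4 * (1/2) ^ j * A (2 ^ j / real N)" for j N
  have a0: "a j N \<ge> 0" for j N using \<Phi>0 by (auto simp: a_def A_def)
  have aM: "norm (a j N) \<le> 4 * C * (1/2) ^ j" for j N
    using mult_left_mono[OF C(1)[of "2 ^ j / real N"], of "4 * (1/2) ^ j"] by (simp add: a_def abs_mult mult_ac)
  have sumM: "summable (\<lambda>j. 4 * C * (1/2::real) ^ j)" by (intro summable_mult summable_geometric) simp
  have suma: "summable (\<lambda>j. a j N)" for N by (rule summable_comparison_test'[OF sumM aM])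
  have "(\<lambda>N. \<Sum>j. a j N) \<longlonglongrightarrow> (\<Sum>j. 0)"
  proof (rule tannerys_theorem[THEN conjunct2, THEN conjunct2])
    fix j
    have "filterlim (\<lambda>N. 2 ^ j / real N) (at_right 0) sequentially"
      unfolding filterlim_at by (auto intro!: lim_const_over_n eventually_sequentiallyI[of 1] simp: field_simps)
    then have "(\<lambda>N. A (2 ^ j / real N)) \<longlonglongrightarrow> 0"
      using lim unfolding A_def \<Phi>_def by (rule filterlim_compose[rotated])
    then show "(\<lambda>N. a j N) \<longlonglongrightarrow> 0" unfolding a_def by (rule tendsto_mult_right_zero)
  next
    show "\<forall>\<^sub>F (j, N) in sequentially \<times>\<^sub>F sequentially. norm (a j N) \<le> 4 * C * (1/2) ^ j"
      using aM by (auto intro!: always_eventually)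
  qed (use sumM in auto)
  then have S: "(\<lambda>N. \<Sum>j. a j N) \<longlonglongrightarrow> 0" by simp
  have ik: "integrable circ (\<lambda>t. h t * kern N t)" for N
    by (rule integrable_circ_mult_bounded[OF h(1)]) (use kern_nonneg[of N] kern_le[of N] in auto)
  have le: "(LINT t|circ. h t * kern N t) \<le> (\<Sum>j. a j N)" if N: "N \<ge> 1" for N
  proof -
    define b where "b j t = 4 * real N / 4 ^ j * (h t * indicator {-(2^j/real N)..2^j/real N} t)" for j t
    have [measurable]: "b j \<in> borel_measurable borel" for j unfolding b_def by measurable
    have "ennreal (LINT t|circ. h t * kern N t) = (\<integral>\<^sup>+t. ennreal (h t * kern N t) \<partial>circ)"
      using h(2) kern_nonneg ik by (intro nn_integral_eq_integral[symmetric]) auto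
    also have "... \<le> (\<integral>\<^sup>+t. (\<Sum>j. ennreal (b j t)) \<partial>circ)"
    proof (rule nn_integral_mono)
      fix t
      obtain j where j: "\<bar>t\<bar> \<le> 2 ^ j / real N" "kern N t \<le> 4 * real N / 4 ^ j"
        using kern_le_dyadic[of N t] N by auto
      have "ennreal (h t * kern N t) \<le> ennreal (b j t)"
        using j h(2)[of t] mult_left_mono[OF j(2) h(2)[of t]] by (intro ennreal_leI) (auto simp: b_def indicator_def mult_ac)
      also have "... \<le> (\<Sum>j. ennreal (b j t))"
        using sum_le_suminf[OF summableI, of "{j}" "\<lambda>j. ennreal (b j t)"] by simp
      finally show "ennreal (h t * kern N t) \<le> (\<Sum>j. ennreal (b j t))" .
    qed
    also have "... = (\<Sum>j. (\<integral>\<^sup>+t. ennreal (b j t) \<partial>circ))"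
      by (rule nn_integral_suminf) simp
    also have "... = (\<Sum>j. ennreal (a j N))"
    proof (rule arg_cong[where f = suminf], rule ext)
      fix j
      have "(\<integral>\<^sup>+t. ennreal (b j t) \<partial>circ)
        = ennreal (LINT t|circ. b j t)"
        unfolding b_def using h(2) by (intro nn_integral_eq_integral integrable_mult_right ih) (auto simp: indicator_def)
      also have "(LINT t|circ. b j t) = 4 * real N / 4 ^ j * \<Phi> (2^j / real N)"
        unfolding \<Phi>_def b_def by (rule integral_mult_right_zero)
      also have "... = a j N"
        using N by (simp add: a_def A_def field_simps flip: power_mult_distrib)
      finally show "(\<integral>\<^sup>+t. ennreal (b j t) \<partial>circ) = ennreal (a j N)" .
    qed
    also have "... = ennreal (\<Sum>j. a j N)"
      using a0 suma by (intro suminf_ennreal_eq summable_sums) auto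
    finally show ?thesis using a0 suma by (simp add: suminf_nonneg)
  qed
  show ?thesis
  proof (rule real_tendsto_sandwich[OF _ _ tendsto_const S])
    show "\<forall>\<^sub>F N in sequentially. 0 \<le> (LINT t|circ. h t * kern N t)"
      using h(2) kern_nonneg by (intro always_eventually allI Bochner_Integration.integral_nonneg) auto
    show "\<forall>\<^sub>F N in sequentially. (LINT t|circ. h t * kern N t) \<le> (\<Sum>j. a j N)"
      using le by (intro eventually_sequentiallyI[of 1])
  qed
qed

lemma AE_lborel_uminus: "AE x in lborel. P x \<Longrightarrow> AE x in lborel. P (- x :: real)"
  by (rule AE_distrD[of uminus lborel borel]) (simp_all only: lborel_distr_uminus, simp)

lemma integrable_indicator_Icc: "integrable lborel (indicat_real {a..b::real})"
  by (rule integrable_real_indicator) (auto simp: emeasure_lborel_Icc_eq)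

text \<open>The differentiation theorem is applied to |g - q| for every rational q, and the
  countably many null sets are united. At a remaining point x a rational q within e/4 of g x
  replaces the constant g x.\<close>

lemma forward_lebesgue_point:
  fixes g :: "real \<Rightarrow> real"
  assumes g: "integrable lborel g"
  shows "AE x in lborel. \<forall>e>0. \<forall>\<^sub>F s in at_right 0. (LINT y:{x..x+s}|lborel. \<bar>g y - g x\<bar>) < e * s"
proof -
  have si: "set_integrable lborel {a..b} (\<lambda>y. \<bar>g y - q\<bar>)" for a b q
  proof -
    have "set_integrable lborel {a..b} (\<lambda>y. g y - q)"
      by (intro set_integral_diff)
         (use integrable_indicator_Icc[of a b] in \<open>auto simp: set_integrable_def integrable_mult_indicator[OF _ g, simplified]\<close>)
    then show ?thesis by (rule set_integrable_abs)
  qed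
  let ?A = "\<lambda>q x h. integral (cbox x (x + h *\<^sub>R One)) (\<lambda>y. \<bar>g y - q\<bar>) /\<^sub>R h ^ DIM(real)"
  let ?P = "\<lambda>q x e. \<exists>d>0. \<forall>h. 0 < h \<and> h < d \<longrightarrow> norm (?A q x h - \<bar>g x - q\<bar>) < e"
  have "\<exists>N. \<forall>q\<in>\<rat>. negligible (N q) \<and> (\<forall>x e. x \<notin> N q \<and> 0 < e \<longrightarrow>
     ?P q x e)"
  proof (intro bchoice ballI)
    fix q :: real
    obtain N where "negligible N" "\<And>x e. \<lbrakk>x \<notin> N; 0 < e\<rbrakk> \<Longrightarrow>
     ?P q x e"
      by (rule integrable_ccontinuous_explicit[of "\<lambda>y. \<bar>g y - q\<bar>"])
         (use set_borel_integral_eq_integral(1)[OF si] in auto)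
    then show "\<exists>N. negligible N \<and> (\<forall>x e. x \<notin> N \<and> 0 < e \<longrightarrow>
     ?P q x e)"
      by blast
  qed
  then obtain N where N: "\<And>q. q \<in> \<rat> \<Longrightarrow> negligible (N q)"
    "\<And>q x e. q \<in> \<rat> \<Longrightarrow> x \<notin> N q \<Longrightarrow> 0 < e \<Longrightarrow>
     ?P q x e"
    by metis
  have "(\<Union>q\<in>\<rat>. N q) \<in> null_sets lebesgue"
    by (intro null_sets_UN' countable_rat) (use N(1) negligible_iff_null_sets in auto)
  then have "AE x in lebesgue. x \<notin> (\<Union>q\<in>\<rat>. N q)" by (rule AE_not_in)
  then have "AE x in lborel. x \<notin> (\<Union>q\<in>\<rat>. N q)" by (simp only: AE_completion_iff)
  then show ?thesis
  proof eventually_elim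
    case (elim x)
    show ?case
    proof (intro allI impI)
      fix e :: real assume e: "e > 0"
      obtain q where q: "q \<in> \<rat>" "g x - e/4 < q" "q < g x"
        using Rats_dense_in_real[of "g x - e/4" "g x"] e by auto
      then have gq: "\<bar>g x - q\<bar> < e/4" by simp
      obtain d where d: "d > 0" "\<And>h. 0 < h \<Longrightarrow> h < d \<Longrightarrow> norm (?A q x h - \<bar>g x - q\<bar>) < e/4"
        using N(2)[OF q(1), of x "e/4"] elim q(1) e by auto
      have "(LINT y:{x..x+s}|lborel. \<bar>g y - g x\<bar>) < e * s" if s: "0 < s" "s < d" for s
      proof -
        define I where "I = (LINT y:{x..x+s}|lborel. \<bar>g y - q\<bar>)"
        have Ieq: "I = integral (cbox x (x + s *\<^sub>R One)) (\<lambda>y. \<bar>g y - q\<bar>)"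
          using set_borel_integral_eq_integral(2)[OF si] by (simp add: I_def)
        have "\<bar>I / s - \<bar>g x - q\<bar>\<bar> < e/4"
        proof -
          have e1: "I /\<^sub>R s ^ DIM(real) = I / s"
            unfolding real_scaleR_def DIM_real power_one_right divide_inverse by (rule mult.commute)
          show ?thesis using d(2)[OF s] unfolding Ieq[symmetric] e1 real_norm_def .
        qed
        \<comment> \<open>e/4 from the differentiation theorem and e/4 from |g x - q|. Exchanging q
          for g x in the integrand costs another e/4, which leaves a total below e.\<close>
        then have "I / s < e/2" using gq by linarith
        then have I: "I < e/2 * s" using s by (simp add: field_simps)
        have c: "set_integrable lborel {x..x+s} (\<lambda>y. e/4 :: real)"
          unfolding set_integrable_def by (intro integrable_scaleR_left integrable_indicator_Icc)
        have "(LINT y:{x..x+s}|lborel. \<bar>g y - g x\<bar>) \<le> (LINT y:{x..x+s}|lborel. \<bar>g y - q\<bar> + e/4)"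
        proof (intro set_integral_mono set_integral_add si c)
          fix y show "\<bar>g y - g x\<bar> \<le> \<bar>g y - q\<bar> + e/4" using gq by linarith
        qed
        also have "... = I + e/4 * s"
          using s by (subst set_integral_add(2)[OF si c]) (simp add: I_def set_lebesgue_integral_def)
        also have "... < e * s" using I mult_pos_pos[OF e s(1)] by linarith
        finally show ?thesis .
      qed
      then show "\<forall>\<^sub>F s in at_right 0. (LINT y:{x..x+s}|lborel. \<bar>g y - g x\<bar>) < e * s"
        unfolding eventually_at_right_field using d(1) by (intro exI[of _ d]) auto
    qed
  qed
qed

text \<open>The left neighbourhood of x is a right neighbourhood of -x for the reflected function,
  so the one-sided statement is used twice.\<close>

lemma lebesgue_point:
  fixes g :: "real \<Rightarrow> real"
  assumes g: "integrable lborel g"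
  shows "AE x in lborel. ((\<lambda>s. (LINT t|lborel. \<bar>g (x - t) - g x\<bar> * indicator {-s..s} t) / s) \<longlongrightarrow> 0) (at_right 0)"
proof -
  let ?R = "\<lambda>x s. LINT y:{x..x+s}|lborel. \<bar>g y - g x\<bar>"
  let ?L = "\<lambda>x s. LINT y:{-x..-x+s}|lborel. \<bar>g (-y) - g x\<bar>"
  let ?I = "\<lambda>x a b. LINT t|lborel. \<bar>g (x - t) - g x\<bar> * indicator {a..b} t"
  have [measurable]: "g \<in> borel_measurable borel" using borel_measurable_integrable[OF g] by simp
  have g': "integrable lborel (\<lambda>x. g (- x))"
    using lborel_integrable_real_affine[OF g, of "-1" 0] by simp
  have AE2: "AE x in lborel. \<forall>e>0. \<forall>\<^sub>F s in at_right 0. ?L x s < e * s"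
    using AE_lborel_uminus[OF forward_lebesgue_point[OF g']] by simp
  show ?thesis
    using forward_lebesgue_point[OF g] AE2
  proof eventually_elim
    case (elim x)
    have int: "integrable lborel (\<lambda>t. \<bar>g (x - t) - g x\<bar> * indicator {a..b} t)" for a b
    proof -
      have "integrable lborel (\<lambda>t. g (x - t))" using lborel_integrable_real_affine[OF g, of "-1" x] by simp
      moreover have "integrable lborel (\<lambda>t. indicat_real {a..b} t *\<^sub>R g x)"
        by (intro integrable_scaleR_left integrable_indicator_Icc)
      ultimately have "integrable lborel (\<lambda>t. indicator {a..b} t *\<^sub>R g (x - t) - indicator {a..b} t *\<^sub>R g x)"
        by (intro Bochner_Integration.integrable_diff integrable_mult_indicator[of _ _ "\<lambda>t. g (x - t)"]) auto
      then have "integrable lborel (\<lambda>t. \<bar>indicator {a..b} t *\<^sub>R g (x - t) - indicator {a..b} t *\<^sub>R g x\<bar>)"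
        by (rule integrable_abs)
      then show ?thesis by (rule Bochner_Integration.integrable_cong[THEN iffD1, rotated -1]) (auto simp: indicator_def)
    qed
    define L where "L s = ?I x (-s) s" for s
    have L0: "L s \<ge> 0" for s unfolding L_def by (intro Bochner_Integration.integral_nonneg) auto
    have L: "L s = ?R x s + ?L x s" if "s > 0" for s
    proof -
      have "L s = (LINT t|lborel. \<bar>g (x - t) - g x\<bar> * indicator {-s..0} t + \<bar>g (x - t) - g x\<bar> * indicator {0..s} t)"
        unfolding L_def using AE_lborel_singleton[of "0::real"] \<open>s > 0\<close>
        by (intro integral_cong_AE) (auto elim!: eventually_mono simp: indicator_def)
      also have "... = ?I x (-s) 0 + ?I x 0 s"
        by (intro Bochner_Integration.integral_add int)
      also have "?I x (-s) 0 = ?R x s"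
        unfolding set_lebesgue_integral_def
        using lborel_integral_real_affine[of "-1" "\<lambda>y. indicator {x..x+s} y *\<^sub>R \<bar>g y - g x\<bar>" x]
        by (simp add: indicator_def if_distrib cong: if_cong) (auto intro!: Bochner_Integration.integral_cong simp: indicator_def)
      also have "?I x 0 s = ?L x s"
        unfolding set_lebesgue_integral_def
        using lborel_integral_real_affine[of "1" "\<lambda>y. indicator {-x..-x+s} y *\<^sub>R \<bar>g (-y) - g x\<bar>" "-x"]
        by (simp add: indicator_def if_distrib cong: if_cong) (auto intro!: Bochner_Integration.integral_cong simp: indicator_def)
      finally show ?thesis .
    qed
    have "((\<lambda>s. L s / s) \<longlongrightarrow> 0) (at_right 0)"
    proof (rule tendstoI)
      fix e :: real assume e: "e > 0"
      have 1: "\<forall>\<^sub>F s in at_right 0. ?R x s < e/2 * s"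
        and 2: "\<forall>\<^sub>F s in at_right 0. ?L x s < e/2 * s"
        using elim e half_gt_zero[OF e] by blast+
      have 3: "\<forall>\<^sub>F s in at_right 0. s > (0::real)" by (simp add: eventually_at_right_less)
      show "\<forall>\<^sub>F s in at_right 0. dist (L s / s) 0 < e"
        using 1 2 3
      proof eventually_elim
        case (elim s)
        then have "L s < e * s" using L[of s] by simp
        then show ?case using elim(3) L0[of s] by (simp add: field_simps)
      qed
    qed
    then show ?case by (simp add: L_def)
  qed
qed

subsection \<open>Pointwise convergence of Fejer means and truncated Hilbert transforms\<close>

definition is_lebesgue_point :: "(real \<Rightarrow> real) \<Rightarrow> real \<Rightarrow> bool" where
  "is_lebesgue_point f x \<longleftrightarrow> ((\<lambda>s. (LINT t|circ. \<bar>f (x - t) - f x\<bar> * indicator {-s..s} t) / s) \<longlongrightarrow> 0) (at_right 0)"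

lemma AE_is_lebesgue_point:
  fixes f :: "real \<Rightarrow> real"
  assumes [measurable]: "f \<in> borel_measurable borel" and p: "periodic f" and i: "integrable circ f"
  shows "AE x in circ. is_lebesgue_point f x"
proof -
  let ?w = "\<lambda>a y. ennreal \<bar>f y\<bar> * indicator {a..<a + 2 * pi} y"
  let ?I = "\<lambda>a. integral\<^sup>N lborel (?w a)"
  \<comment> \<open>A periodic function is rarely integrable on the line. Three periods suffice,
    because x - t lies in (-2\<pi>, 2\<pi>) for |x| \<le> \<pi> and |t| < \<pi>.\<close>
  define g where "g y = f y * indicator {-3*pi..<3*pi} y" for y
  have [measurable]: "g \<in> borel_measurable borel" unfolding g_def by measurable
  have w: "?I a < \<infinity>" for a
  proof -
    have "?I a = (\<integral>\<^sup>+y. ennreal \<bar>f y\<bar> \<partial>circ)"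
      by (subst nn_integral_period_window) (auto simp: nn_integral_circ_half_open periodic_compose[OF p, of "\<lambda>x. ennreal \<bar>x\<bar>"])
    then show ?thesis using i by (simp add: integrable_iff_bounded)
  qed
  have "integrable lborel g"
  proof (rule integrableI_bounded)
    have "(\<integral>\<^sup>+y. ennreal (norm (g y)) \<partial>lborel)
      = (\<integral>\<^sup>+y. ?w (-3*pi) y
          + (?w (-pi) y + ?w pi y) \<partial>lborel)"
      using pi_gt_zero by (intro nn_integral_cong) (auto simp: g_def indicator_def)
    also have "... = ?I (-3*pi)
          + (?I (-pi)
          + ?I pi)"
      by (simp add: nn_integral_add)
    also have "... < \<infinity>" using w[of "-3*pi"] w[of "-pi"] w[of pi] by (simp add: ennreal_add_less_top)
    finally show "(\<integral>\<^sup>+y. ennreal (norm (g y)) \<partial>lborel) < \<infinity>" .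
  qed simp
  from AE_circ_D[OF lebesgue_point[OF this]] AE_circ_range
  show ?thesis
  proof eventually_elim
    case (elim x)
    show ?case unfolding is_lebesgue_point_def
    proof (rule Lim_transform_eventually[OF elim(1)])
      have "\<forall>\<^sub>F s in at_right 0. 0 < s \<and> s < pi"
        using eventually_at_right_field pi_gt_zero by blast
      then show "\<forall>\<^sub>F s in at_right 0. (LINT t|lborel. \<bar>g (x - t) - g x\<bar> * indicator {-s..s} t) / s
         = (LINT t|circ. \<bar>f (x - t) - f x\<bar> * indicator {-s..s} t) / s"
      proof eventually_elim
        case (elim s)
        have "(LINT t|circ. \<bar>f (x - t) - f x\<bar> * indicator {-s..s} t)
           = (LINT t|lborel. indicator {-pi..pi} t *\<^sub>R (\<bar>f (x - t) - f x\<bar> * indicator {-s..s} t))"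
          by (subst integral_circ) (auto simp: set_lebesgue_integral_def)
        also have "... = (LINT t|lborel. \<bar>g (x - t) - g x\<bar> * indicator {-s..s} t)"
          using elim \<open>x \<in> {-pi..pi}\<close> by (intro Bochner_Integration.integral_cong) (auto simp: g_def indicator_def)
        finally show ?case by simp
      qed
    qed
  qed
qed

lemma integral_circ_kernel_reflect:
  fixes f K :: "real \<Rightarrow> real"
  assumes [measurable]: "f \<in> borel_measurable borel" "K \<in> borel_measurable borel" and "periodic f" "periodic K"
  shows "(LINT y|circ. f y * K (x - y)) = (LINT t|circ. f (x - t) * K t)"
proof -
  have "periodic (\<lambda>t. f t * K (x - t))"
    using assms(3) periodic_reflect[OF assms(4), of x] by (simp add: periodic_def)
  from integral_circ_reflect[OF _ this, of x] show ?thesis by simp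
qed

lemma periodic_fejer: "periodic (fejer N)" "periodic (cfejer N)"
  by (simp_all add: fejer_def cfejer_def periodic_trigpoly)

lemma integrable_reflect_diff:
  fixes f :: "real \<Rightarrow> real"
  assumes "f \<in> borel_measurable borel" "periodic f" "integrable circ f"
  shows "integrable circ (\<lambda>t. f (x - t) - c)"
  using integrable_circ_reflect[OF assms(1,2), of x] assms(3) by simp

lemma fmean_tendsto:
  fixes f :: "real \<Rightarrow> real"
  assumes m[measurable]: "f \<in> borel_measurable borel" and p: "periodic f" and i: "integrable circ f" and l: "is_lebesgue_point f x"
  shows "(\<lambda>N. fmean N f x) \<longlonglongrightarrow> f x"
proof -
  define h where "h t = \<bar>f (x - t) - f x\<bar>" for t
  have id: "integrable circ (\<lambda>t. f (x - t) - f x)" by (rule integrable_reflect_diff[OF m p i])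
  have h: "integrable circ h" "\<And>t. h t \<ge> 0" unfolding h_def using integrable_abs[OF id] by auto
  have lim: "(\<lambda>N. LINT t|circ. h t * kern N t) \<longlonglongrightarrow> 0"
    by (rule kern_average_tendsto_0[OF h]) (use l in \<open>simp add: is_lebesgue_point_def h_def\<close>)
  have "\<bar>fmean N f x - f x\<bar> \<le> (LINT t|circ. h t * kern N t) * (19 / (2 * pi))" if N: "N \<ge> 1" for N
  proof -
    have ik: "integrable circ (\<lambda>t. h t * (19 * kern N t))"
      by (rule integrable_circ_mult_bounded[OF h(1), of _ "19 * N"]) (use kern_nonneg[of N] kern_le[of N] in auto)
    have ij: "integrable circ (\<lambda>t. (f (x - t) - f x) * fejer N t)"
      by (rule integrable_circ_mult_bounded[OF id, of _ "1 + 2 * N"]) (use fejer_crude(1)[of N] in auto)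
    have "fmean N f x - f x = fmean N (\<lambda>y. f y - f x) x" using fmean_linear[OF i, of N 1 "- f x" x] by simp
    also have "... = 1 / (2 * pi) * (LINT t|circ. (f (x - t) - f x) * fejer N t)"
      unfolding fmean_def
      by (subst integral_circ_kernel_reflect) (auto simp: periodic_fejer periodic_compose[OF p, of "\<lambda>y. y - f x"])
    finally have "\<bar>fmean N f x - f x\<bar> = 1 / (2 * pi) * \<bar>LINT t|circ. (f (x - t) - f x) * fejer N t\<bar>"
      by (simp add: abs_mult)
    also have "\<bar>LINT t|circ. (f (x - t) - f x) * fejer N t\<bar> \<le> (LINT t|circ. \<bar>(f (x - t) - f x) * fejer N t\<bar>)"
      by (rule integral_abs_bound)
    also have "... \<le> (LINT t|circ. h t * (19 * kern N t))"
    proof (rule integral_mono_AE[OF integrable_abs[OF ij] ik])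
      show "AE t in circ. \<bar>(f (x - t) - f x) * fejer N t\<bar> \<le> h t * (19 * kern N t)"
        using AE_circ_range
      proof eventually_elim
        case (elim t)
        then show ?case using fejer_le_kern[of N t] fejer_nonneg[of N t] N
          by (auto simp: abs_mult h_def intro!: mult_left_mono)
      qed
    qed
    also have "... = 19 * (LINT t|circ. h t * kern N t)"
      by (simp only: mult.left_commute[of _ 19] integral_mult_right_zero)
    finally show ?thesis by (simp add: mult_left_mono field_simps)
  qed
  then have "\<forall>\<^sub>F N in sequentially. norm (fmean N f x - f x) \<le> (LINT t|circ. h t * kern N t) * (19 / (2 * pi))"
    by (intro eventually_sequentiallyI[of 1]) auto
  then have "(\<lambda>N. fmean N f x - f x) \<longlonglongrightarrow> 0"
    by (rule Lim_null_comparison) (use tendsto_mult_left_zero[OF lim] in auto)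
  then show ?thesis by (simp add: LIM_zero_iff)
qed

text \<open>With the cut-off at \<open>\<bar>t\<bar> = \<pi>\<close> the kernel is bounded on the whole line.\<close>

definition cotcut :: "real \<Rightarrow> real \<Rightarrow> real" where
  "cotcut eps t = (if eps \<le> \<bar>t\<bar> \<and> \<bar>t\<bar> \<le> pi then cot (t / 2) else 0)"

definition hilbert_trunc :: "real \<Rightarrow> (real \<Rightarrow> real) \<Rightarrow> real \<Rightarrow> real" where
  "hilbert_trunc eps f x = 1 / (2 * pi) * (LINT t|circ. f (x - t) * cotcut eps t)"

lemma cotcut_measurable [measurable]: "cotcut eps \<in> borel_measurable borel"
  unfolding cotcut_def cot_def by measurable

lemma cotcut_bounded: "eps > 0 \<Longrightarrow> \<bar>cotcut eps t\<bar> \<le> pi / eps"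
proof (cases "eps \<le> \<bar>t\<bar> \<and> \<bar>t\<bar> \<le> pi")
  case True
  assume e: "eps > 0"
  have s: "\<bar>sin (t / 2)\<bar> \<ge> eps / pi" 
    by (rule order_trans[OF _ sin_half_ge]) (use True in \<open>auto simp: field_simps\<close>)
  have "\<bar>cot (t / 2)\<bar> = \<bar>cos (t / 2)\<bar> / \<bar>sin (t / 2)\<bar>" by (simp add: cot_def)
  also have "... \<le> 1 / (eps / pi)" using s e by (intro frac_le) auto
  finally show ?thesis using True by (simp add: cotcut_def)
qed (auto simp: cotcut_def)

lemma integral_circ_odd:
  fixes k :: "real \<Rightarrow> real"
  assumes [measurable]: "k \<in> borel_measurable borel" and odd: "\<And>t. k (- t) = - k t"
  shows "integral\<^sup>L circ k = 0"
proof -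
  have "integral\<^sup>L circ (\<lambda>t. k (- t)) = integral\<^sup>L circ k"
    by (rule circ_integral_transfer(2)) (auto intro: nn_integral_circ_uminus[where f = "\<lambda>x. h (k x)" for h])
  then show ?thesis by (simp add: odd)
qed

text \<open>The difference \<open>d\<close> of the two kernels is odd and has integral 0, so the
  constant f x may be subtracted from f (x - t). The kernel majorant then bounds what
  remains.\<close>

lemma cmean_hilbert_trunc:
  fixes f :: "real \<Rightarrow> real"
  assumes m[measurable]: "f \<in> borel_measurable borel" and p: "periodic f" and i: "integrable circ f"
    and N: "N > 0" and e: "1 / (2 * N) \<le> eps" "eps \<le> 1 / N"
  shows "\<bar>cmean N f x - hilbert_trunc eps f x\<bar> \<le> (LINT t|circ. \<bar>f (x - t) - f x\<bar> * kern N t) * (40 / (2 * pi))"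
proof -
  have "0 < 1 / (2 * real N)" using N by simp
  then have e0: "eps > 0" using e(1) by linarith
  define d where "d t = cfejer N t - cotcut eps t" for t
  have [measurable]: "d \<in> borel_measurable borel" unfolding d_def by measurable
  have dB: "\<bar>d t\<bar> \<le> 2 * N + pi / eps" for t
    using fejer_crude(2)[of N t] cotcut_bounded[OF e0, of t] by (simp add: d_def)
  have d0: "integral\<^sup>L circ d = 0"
  proof (rule integral_circ_odd)
    fix t
    have "cfejer N (- t) = - cfejer N t" by (simp add: cfejer_def trigpoly_def sum_negf)
    moreover have "cotcut eps (- t) = - cotcut eps t" by (simp add: cotcut_def cot_def)
    ultimately show "d (- t) = - d t" by (simp add: d_def)
  qed simp
  have id: "integrable circ (\<lambda>t. f (x - t) - c)" for c by (rule integrable_reflect_diff[OF m p i])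
  have i1: "integrable circ (\<lambda>t. (f (x - t) - c) * k t)"
    if "k \<in> borel_measurable borel" "\<And>t. \<bar>k t\<bar> \<le> B" for k B c
    by (rule integrable_circ_mult_bounded[OF id that])
  have ic: "integrable circ (\<lambda>t. f (x - t) * cfejer N t)" "integrable circ (\<lambda>t. f (x - t) * cotcut eps t)"
    using i1[of "cfejer N" "2 * N" 0] i1[of "cotcut eps" "pi / eps" 0] fejer_crude(2)[of N] cotcut_bounded[OF e0]
    by simp_all
  have idd: "integrable circ d" by (rule integrable_circ_bounded[OF _ dB]) simp
  have "cmean N f x - hilbert_trunc eps f x = 1 / (2 * pi) * (LINT t|circ. f (x - t) * d t)"
    unfolding cmean_def hilbert_trunc_def d_def
    using ic by (subst integral_circ_kernel_reflect) (auto simp: periodic_fejer p right_diff_distrib)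
  also have "(LINT t|circ. f (x - t) * d t) = (LINT t|circ. (f (x - t) - f x) * d t)"
  proof -
    have "(LINT t|circ. f (x - t) * d t) = (LINT t|circ. (f (x - t) - f x) * d t + f x * d t)"
      by (simp add: algebra_simps)
    also have "... = (LINT t|circ. (f (x - t) - f x) * d t) + (LINT t|circ. f x * d t)"
      using i1[OF _ dB] idd by (intro Bochner_Integration.integral_add) auto
    finally show ?thesis by (simp add: d0)
  qed
  finally have "\<bar>cmean N f x - hilbert_trunc eps f x\<bar> = 1 / (2 * pi) * \<bar>LINT t|circ. (f (x - t) - f x) * d t\<bar>"
    by (simp add: abs_mult)
  also have "\<bar>LINT t|circ. (f (x - t) - f x) * d t\<bar> \<le> (LINT t|circ. \<bar>(f (x - t) - f x) * d t\<bar>)"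
    by (rule integral_abs_bound)
  also have "... \<le> (LINT t|circ. \<bar>f (x - t) - f x\<bar> * (40 * kern N t))"
  proof (rule integral_mono_AE)
    show "integrable circ (\<lambda>t. \<bar>(f (x - t) - f x) * d t\<bar>)" by (intro integrable_abs i1[OF _ dB]) simp
    show "integrable circ (\<lambda>t. \<bar>f (x - t) - f x\<bar> * (40 * kern N t))"
      by (rule integrable_circ_mult_bounded[OF integrable_abs[OF id], of _ "40 * N"]) (use kern_nonneg[of N] kern_le[of N] in auto)
    show "AE t in circ. \<bar>(f (x - t) - f x) * d t\<bar> \<le> \<bar>f (x - t) - f x\<bar> * (40 * kern N t)"
      using AE_circ_range
    proof eventually_elim
      case (elim t)
      then have t: "\<bar>t\<bar> \<le> pi" by auto
      have "d t = cfejer N t - (if eps \<le> \<bar>t\<bar> then cot (t / 2) else 0)" using t by (simp add: d_def cotcut_def)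
      then have "\<bar>d t\<bar> \<le> 40 * kern N t" using cfejer_approx_cot[OF N t e] by simp
      then show ?case by (simp only: abs_mult) (intro mult_left_mono; simp)
    qed
  qed
  also have "... = 40 * (LINT t|circ. \<bar>f (x - t) - f x\<bar> * kern N t)"
    by (simp only: mult.left_commute[of _ 40] integral_mult_right_zero)
  finally show ?thesis by (simp add: mult_left_mono field_simps)
qed

lemma hilbert_trunc_tendsto:
  fixes f :: "real \<Rightarrow> real"
  assumes m[measurable]: "f \<in> borel_measurable borel" and p: "periodic f" and i: "integrable circ f" and l: "is_lebesgue_point f x"
    and y: "(\<lambda>N. cmean N f x) \<longlonglongrightarrow> y"
  shows "((\<lambda>eps. hilbert_trunc eps f x) \<longlongrightarrow> y) (at_right 0)"
proof -
  define J where "J N = (LINT t|circ. \<bar>f (x - t) - f x\<bar> * kern N t) * (40 / (2 * pi))" for N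
  have "(\<lambda>N. LINT t|circ. \<bar>f (x - t) - f x\<bar> * kern N t) \<longlonglongrightarrow> 0"
    by (rule kern_average_tendsto_0) (use l integrable_abs[OF integrable_reflect_diff[OF m p i]] in \<open>auto simp: is_lebesgue_point_def\<close>)
  then have J: "J \<longlonglongrightarrow> 0" unfolding J_def by (rule tendsto_mult_left_zero)
  \<comment> \<open>For 0 < eps < 1 this n satisfies 1/(2n) \<le> eps \<le> 1/n, the range of the
    kernel comparison. It turns the limit of a sequence into one over the continuous
    parameter.\<close>
  define n where "n eps = nat \<lfloor>1 / eps\<rfloor>" for eps :: real
  have n: "filterlim n sequentially (at_right 0)"
    unfolding n_def divide_inverse mult_1
    by (intro filterlim_compose[OF filterlim_nat_sequentially] filterlim_compose[OF filterlim_floor_sequentially] filterlim_inverse_at_top_right)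
  have 1: "((\<lambda>eps. cmean (n eps) f x) \<longlongrightarrow> y) (at_right 0)" by (rule filterlim_compose[OF y n])
  have "((\<lambda>eps. cmean (n eps) f x - hilbert_trunc eps f x) \<longlongrightarrow> 0) (at_right 0)"
  proof (rule Lim_null_comparison[OF _ filterlim_compose[OF J n]])
    have "\<forall>\<^sub>F eps in at_right 0. 0 < eps \<and> eps < (1::real)"
      using eventually_at_right_field zero_less_one by blast
    then show "\<forall>\<^sub>F eps in at_right 0. norm (cmean (n eps) f x - hilbert_trunc eps f x) \<le> J (n eps)"
    proof eventually_elim
      case (elim eps)
      then have "1 / eps > 1" by simp
      then have r: "real (n eps) \<le> 1 / eps" "1 / eps < real (n eps) + 1" "n eps \<ge> 1"
        unfolding n_def by linarith+
      then have "1 / eps \<le> 2 * real (n eps)" by linarith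
      then have "1 / (2 * real (n eps)) \<le> eps" "eps \<le> 1 / real (n eps)"
        using r elim by (auto simp: field_simps)
      then show ?case using cmean_hilbert_trunc[OF m p i, of "n eps" eps x] r(3) by (simp add: J_def)
    qed
  qed
  from tendsto_diff[OF 1 this] show ?thesis by simp
qed

section \<open>Convergence of Fejer means in L_p\<close>

lemma fmean_diff:
  assumes "integrable circ f" "integrable circ g"
  shows "fmean N (\<lambda>x. f x - g x) x = fmean N f x - fmean N g x" "cmean N (\<lambda>x. f x - g x) x = cmean N f x - cmean N g x"
  using integrable_mult_fejer[OF assms(1), of N x] integrable_mult_fejer[OF assms(2), of N x]
  by (simp_all add: fmean_def cmean_def left_diff_distrib right_diff_distrib)

lemma abs_add_powr_le:
  fixes a b c p :: real
  assumes "p > 0"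
  shows "\<bar>a + b + c\<bar> powr p \<le> 3 powr p * (\<bar>a\<bar> powr p + \<bar>b\<bar> powr p + \<bar>c\<bar> powr p)"
proof -
  define m where "m = max \<bar>a\<bar> (max \<bar>b\<bar> \<bar>c\<bar>)"
  have "\<bar>a + b + c\<bar> powr p \<le> (3 * m) powr p" using assms by (intro powr_mono2) (auto simp: m_def)
  also have "... = 3 powr p * m powr p" by (rule powr_mult)
  also have "m powr p \<le> \<bar>a\<bar> powr p + \<bar>b\<bar> powr p + \<bar>c\<bar> powr p"
    unfolding m_def max_def by (auto simp: add_increasing add_increasing2)
  finally show ?thesis by simp
qed

lemma integrable_fmean_powr:
  assumes f: "integrable circ f" and [measurable]: "g \<in> borel_measurable borel" and g: "integrable circ (\<lambda>x. \<bar>g x\<bar> powr p)" and p: "p > 0"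
  shows "integrable circ (\<lambda>x. \<bar>fmean N f x - g x\<bar> powr p)"
proof (rule Bochner_Integration.integrable_bound)
  have [measurable]: "fmean N f \<in> borel_measurable borel" by (simp add: fmean_trigpoly[OF f])
  show "(\<lambda>x. \<bar>fmean N f x - g x\<bar> powr p) \<in> borel_measurable circ" by measurable
  have "integrable circ (\<lambda>x. \<bar>fmean N f x\<bar> powr p)"
    unfolding fmean_trigpoly[OF f] by (rule integrable_circ_trigpoly_powr[OF p])
  then show "integrable circ (\<lambda>x. 3 powr p * (\<bar>fmean N f x\<bar> powr p + \<bar>g x\<bar> powr p))" using g by auto
  have "\<bar>fmean N f x - g x\<bar> powr p \<le> 3 powr p * (\<bar>fmean N f x\<bar> powr p + \<bar>g x\<bar> powr p)" for x
    using abs_add_powr_le[OF p, of "fmean N f x" "- g x" 0] by simp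
  then show "AE x in circ. norm (\<bar>fmean N f x - g x\<bar> powr p) \<le> norm (3 powr p * (\<bar>fmean N f x\<bar> powr p + \<bar>g x\<bar> powr p))"
    by (intro AE_I2) (simp add: abs_mult)
qed

text \<open>For the bounded truncations \<open>fM M\<close> almost everywhere convergence and
  dominated convergence suffice. The contraction property transfers the truncation error to the
  means uniformly in N.\<close>

lemma fmean_Lp_tendsto:
  fixes f :: "real \<Rightarrow> real"
  assumes m[measurable]: "f \<in> borel_measurable borel" and per: "periodic f" and p: "p > 1" and i: "integrable circ (\<lambda>x. \<bar>f x\<bar> powr p)"
  shows "(\<lambda>N. LINT x|circ. \<bar>fmean N f x - f x\<bar> powr p) \<longlonglongrightarrow> 0"
proof -
  have f1: "integrable circ f" using integrable_powr_imp_integrable[OF m _ i] p by simp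
  define fM where "fM M y = max (- real M) (min (real M) (f y))" for M y
  have mM[measurable]: "fM M \<in> borel_measurable borel" for M unfolding fM_def by measurable
  have fM: "\<bar>fM M y\<bar> \<le> M" "\<bar>fM M y - f y\<bar> \<le> \<bar>f y\<bar>" for M y by (auto simp: fM_def)
  have pM: "periodic (fM M)" for M unfolding fM_def using periodic_compose[OF per, of "\<lambda>y. max (- real M) (min (real M) y)"] by simp
  have iM: "integrable circ (fM M)" for M by (rule integrable_circ_bounded[OF mM fM(1)])
  have iMp: "integrable circ (\<lambda>x. \<bar>fM M x\<bar> powr p)" for M
    by (rule integrable_circ_bounded[where B = "real M powr p"]) (use fM(1) p in \<open>auto intro!: powr_mono2\<close>)
  have idp: "integrable circ (\<lambda>x. \<bar>fM M x - f x\<bar> powr p)" for M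
    by (rule Bochner_Integration.integrable_bound[OF i]) (use fM(2) p in \<open>auto intro!: powr_mono2\<close>)
  define \<delta> where "\<delta> M = (LINT x|circ. \<bar>fM M x - f x\<bar> powr p)" for M
  have "\<delta> \<longlonglongrightarrow> (LINT x|circ. 0)"
    unfolding \<delta>_def
  proof (rule integral_dominated_convergence[OF _ _ i])
    show "AE x in circ. (\<lambda>M. \<bar>fM M x - f x\<bar> powr p) \<longlonglongrightarrow> 0"
    proof (rule AE_I2)
      fix x
      obtain M0 :: nat where M0: "\<bar>f x\<bar> \<le> M0" using real_arch_simple by blast
      have "\<forall>\<^sub>F M in sequentially. \<bar>fM M x - f x\<bar> powr p = 0"
        by (rule eventually_sequentiallyI[of M0]) (use M0 in \<open>auto simp: fM_def\<close>)
      then show "(\<lambda>M. \<bar>fM M x - f x\<bar> powr p) \<longlonglongrightarrow> 0" by (rule tendsto_eventually)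
    qed
  qed (use fM(2) p in \<open>auto intro!: powr_mono2\<close>)
  then have \<delta>: "\<delta> \<longlonglongrightarrow> 0" by simp
  define E where "E M N = (LINT x|circ. \<bar>fmean N (fM M) x - fM M x\<bar> powr p)" for M N
  have E: "E M \<longlonglongrightarrow> 0" for M
  proof -
    have "E M \<longlonglongrightarrow> (LINT x|circ. 0)"
      unfolding E_def
    proof (rule integral_dominated_convergence[where w = "\<lambda>_. (2 * real M) powr p"])
      show "AE x in circ. (\<lambda>N. \<bar>fmean N (fM M) x - fM M x\<bar> powr p) \<longlonglongrightarrow> 0"
        using AE_is_lebesgue_point[OF mM pM iM, of M]
      proof eventually_elim
        case (elim x)
        have "(\<lambda>N. \<bar>fmean N (fM M) x - fM M x\<bar>) \<longlonglongrightarrow> \<bar>fM M x - fM M x\<bar>"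
          by (intro tendsto_intros fmean_tendsto mM pM iM elim)
        then show ?case
          using tendsto_powr'[of "\<lambda>N. \<bar>fmean N (fM M) x - fM M x\<bar>" 0 sequentially "\<lambda>_. p" p] p by simp
      qed
      fix N
      have "fmean N (fM M) \<in> borel_measurable borel" by (simp add: fmean_trigpoly[OF iM])
      then show "(\<lambda>x. \<bar>fmean N (fM M) x - fM M x\<bar> powr p) \<in> borel_measurable circ" by measurable
      have "\<bar>fmean N (fM M) x - fM M x\<bar> \<le> 2 * real M" for x
        using fmean_bounded[OF mM fM(1), of N M x] fM(1)[of M x] by linarith
      then show "AE x in circ. norm (\<bar>fmean N (fM M) x - fM M x\<bar> powr p) \<le> (2 * real M) powr p"
        using p by (intro AE_I2) (auto intro!: powr_mono2)
    qed auto
    then show ?thesis by simp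
  qed
  define D where "D N = (LINT x|circ. \<bar>fmean N f x - f x\<bar> powr p)" for N
  have D: "D N \<le> 3 powr p * (2 * \<delta> M + E M N)" for N M
  proof -
    have id: "integrable circ (\<lambda>x. f x - fM M x)" using f1 iM by simp
    have ie: "integrable circ (\<lambda>x. \<bar>f x - fM M x\<bar> powr p)" using idp[of M] by (simp add: abs_minus_commute)
    have i3: "integrable circ (\<lambda>x. \<bar>fmean N (\<lambda>x. f x - fM M x) x\<bar> powr p)"
      unfolding fmean_trigpoly[OF id] using p by (intro integrable_circ_trigpoly_powr) auto
    have i4: "integrable circ (\<lambda>x. \<bar>fmean N (fM M) x - fM M x\<bar> powr p)"
      using p by (intro integrable_fmean_powr iM iMp) auto
    \<comment> \<open>The error is the mean of f - fM, plus the error for fM, plus fM - f. The first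
      and the last each contribute at most \<delta> M.\<close>
    let ?Q = "\<lambda>x. 3 powr p * (\<bar>fmean N (\<lambda>x. f x - fM M x) x\<bar> powr p + \<bar>fmean N (fM M) x - fM M x\<bar> powr p + \<bar>fM M x - f x\<bar> powr p)"
    have "D N \<le> (LINT x|circ. ?Q x)"
      unfolding D_def
    proof (rule integral_mono)
      show "integrable circ (\<lambda>x. \<bar>fmean N f x - f x\<bar> powr p)" using p by (intro integrable_fmean_powr f1 i) auto
      fix x
      show "\<bar>fmean N f x - f x\<bar> powr p \<le> ?Q x"
        using abs_add_powr_le[of p "fmean N (\<lambda>x. f x - fM M x) x" "fmean N (fM M) x - fM M x" "fM M x - f x"] p
        by (simp add: fmean_diff[OF f1 iM])
    qed (use i3 i4 idp in auto)
    also have "... = 3 powr p * ((LINT x|circ. \<bar>fmean N (\<lambda>x. f x - fM M x) x\<bar> powr p) + E M N + \<delta> M)"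
      using i3 i4 idp[of M] by (simp add: E_def \<delta>_def)
    also have "(LINT x|circ. \<bar>fmean N (\<lambda>x. f x - fM M x) x\<bar> powr p) \<le> (LINT x|circ. \<bar>f x - fM M x\<bar> powr p)"
      by (rule fmean_contraction[OF _ p ie]) simp
    also have "... = \<delta> M" by (simp add: \<delta>_def abs_minus_commute)
    finally show ?thesis by (simp add: algebra_simps)
  qed
  have D0: "D N \<ge> 0" for N unfolding D_def by (intro Bochner_Integration.integral_nonneg) auto
  have "D \<longlonglongrightarrow> 0"
  proof (rule tendstoI)
    fix e :: real assume e: "e > 0"
    define c where "c = e / (3 powr p)"
    have c: "c > 0" using e by (simp add: c_def)
    have "\<forall>\<^sub>F M in sequentially. \<delta> M < c / 4" using order_tendstoD(2)[OF \<delta>, of "c / 4"] c by simp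
    then obtain M where M: "\<delta> M < c / 4" by (auto dest: eventually_happens)
    have "\<forall>\<^sub>F N in sequentially. E M N < c / 2" using order_tendstoD(2)[OF E, of "c / 2"] c by simp
    then show "\<forall>\<^sub>F N in sequentially. dist (D N) 0 < e"
    proof eventually_elim
      case (elim N)
      have "2 * \<delta> M + E M N < c" using M elim by linarith
      then have "3 powr p * (2 * \<delta> M + E M N) < 3 powr p * c" by simp
      then show ?case using D[of N M] D0[of N] by (simp add: c_def)
    qed
  qed
  then show ?thesis by (simp add: D_def[abs_def])
qed

subsection \<open>The inequality of Riesz and Pichorides\<close>

text \<open>The Riesz-Fischer argument, keeping the dominating function: the absolute increments of
  the subsequence have a summable series of integrals, and their sum is integrable. The majorant
  later upgrades almost everywhere convergence to L_1 convergence.\<close>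

lemma L1_Cauchy_dominated_subsequence:
  fixes u :: "nat \<Rightarrow> 'a \<Rightarrow> real"
  assumes i: "\<And>n. integrable M (u n)"
    and cau: "\<And>e. e > 0 \<Longrightarrow> \<exists>N. \<forall>m\<ge>N. \<forall>n\<ge>N. (LINT x|M. \<bar>u m x - u n x\<bar>) < e"
  obtains r w where "\<And>k. r k \<ge> (k::nat)" "integrable M w" "AE x in M. convergent (\<lambda>k. u (r k) x)"
    "\<And>k. AE x in M. \<bar>u (r k) x\<bar> \<le> w x"
proof -
  have "\<forall>k. \<exists>N. \<forall>m\<ge>N. \<forall>n\<ge>N. (LINT x|M. \<bar>u m x - u n x\<bar>) < (1/2) ^ k"
    using cau by simp
  then obtain N0 where N0: "\<And>k m n. m \<ge> N0 k \<Longrightarrow> n \<ge> N0 k \<Longrightarrow> (LINT x|M. \<bar>u m x - u n x\<bar>) < (1/2) ^ k"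
    by metis
  \<comment> \<open>The sum places both r k and r (k + 1) beyond N0 k, and the added k makes r tend
    to infinity.\<close>
  define r where "r k = (\<Sum>j\<le>k. N0 j) + k" for k
  have r: "r k \<ge> k" "r k \<ge> N0 k" "r (Suc k) \<ge> N0 k" for k
    using member_le_sum[of k "{..k}" N0] by (auto simp: r_def)
  define f where "f k x = u (r (Suc k)) x - u (r k) x" for k x
  have [measurable]: "u n \<in> borel_measurable M" for n using i by auto
  have fi: "integrable M (f k)" for k unfolding f_def using i by simp
  have fn: "(LINT x|M. \<bar>f k x\<bar>) \<le> (1/2) ^ k" for k
    unfolding f_def using N0[OF r(3,2)] by (rule less_imp_le)
  have sg: "summable (\<lambda>k. (1/2::real) ^ k)" by (rule summable_geometric) simp
  have sI: "summable (\<lambda>k. LINT x|M. \<bar>f k x\<bar>)"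
  proof (rule summable_comparison_test'[OF sg])
    fix k :: nat
    have "(LINT x|M. \<bar>f k x\<bar>) \<ge> 0" by (intro Bochner_Integration.integral_nonneg) auto
    then show "norm (LINT x|M. \<bar>f k x\<bar>) \<le> (1/2) ^ k" using fn[of k] unfolding real_norm_def by linarith
  qed
  have "(\<integral>\<^sup>+x. (\<Sum>k. ennreal \<bar>f k x\<bar>) \<partial>M) = (\<Sum>k. (\<integral>\<^sup>+x. ennreal \<bar>f k x\<bar> \<partial>M))"
    unfolding f_def by (rule nn_integral_suminf) simp
  also have "... = (\<Sum>k. ennreal (LINT x|M. \<bar>f k x\<bar>))"
    using fi by (intro arg_cong[where f = suminf] ext nn_integral_eq_integral integrable_abs) auto
  also have "... \<noteq> \<infinity>"
    unfolding infinity_ennreal_def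
    by (rule ennreal_suminf_neq_top[OF sI]) (intro Bochner_Integration.integral_nonneg, auto)
  finally have "AE x in M. (\<Sum>k. ennreal \<bar>f k x\<bar>) \<noteq> \<infinity>"
    unfolding f_def by (intro nn_integral_noteq_infinite) (auto simp: f_def)
  then have sm: "AE x in M. summable (\<lambda>k. \<bar>f k x\<bar>)"
    by eventually_elim (rule summable_suminf_not_top, auto)
  define w where "w x = \<bar>u (r 0) x\<bar> + (\<Sum>k. \<bar>f k x\<bar>)" for x
  have tel: "u (r k) x = u (r 0) x + (\<Sum>j<k. f j x)" for k x
    using sum_lessThan_telescope[of "\<lambda>j. u (r j) x" k] by (simp add: f_def)
  show thesis
  proof
    show "r k \<ge> k" for k by (rule r)
    have "integrable M (\<lambda>x. \<Sum>k. \<bar>f k x\<bar>)"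
      by (rule integrable_suminf) (use fi sm sI in auto)
    then show "integrable M w" unfolding w_def using i by simp
    show "AE x in M. convergent (\<lambda>k. u (r k) x)"
      using sm
    proof eventually_elim
      case (elim x)
      then have "summable (\<lambda>k. f k x)" by (rule summable_rabs_cancel)
      then have "(\<lambda>k. u (r 0) x + (\<Sum>j<k. f j x)) \<longlonglongrightarrow> u (r 0) x + (\<Sum>k. f k x)"
        by (intro tendsto_intros summable_LIMSEQ)
      then show ?case unfolding tel[symmetric] by (auto simp: convergent_def)
    qed
    show "AE x in M. \<bar>u (r k) x\<bar> \<le> w x" for k
      using sm
    proof eventually_elim
      case (elim x)
      have "\<bar>u (r k) x\<bar> \<le> \<bar>u (r 0) x\<bar> + \<bar>\<Sum>j<k. f j x\<bar>" unfolding tel[of k] by (rule abs_triangle_ineq)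
      also have "\<bar>\<Sum>j<k. f j x\<bar> \<le> (\<Sum>j<k. \<bar>f j x\<bar>)" by (rule sum_abs)
      also have "... \<le> (\<Sum>k. \<bar>f k x\<bar>)" by (rule sum_le_suminf[OF elim]) auto
      finally show ?case by (simp add: w_def)
    qed
  qed
qed

text \<open>Splitting at |y| = \<delta> gives |y| \<le> \<delta> + \<delta>^(1-p) |y|^p. A small
  \<delta> controls the first term, and L_p smallness then controls the second.\<close>

lemma L1_le_Lp:
  fixes u :: "real \<Rightarrow> real"
  assumes [measurable]: "u \<in> borel_measurable borel" and p: "p > 1" and i: "integrable circ (\<lambda>x. \<bar>u x\<bar> powr p)" and d: "\<delta> > 0"
  shows "(LINT x|circ. \<bar>u x\<bar>) \<le> \<delta> * (2 * pi) + \<delta> powr (1 - p) * (LINT x|circ. \<bar>u x\<bar> powr p)"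
proof -
  have le: "\<bar>y\<bar> \<le> \<delta> + \<delta> powr (1 - p) * \<bar>y\<bar> powr p" for y
  proof (cases "\<bar>y\<bar> \<le> \<delta>")
    case False
    then have "1 = \<delta> powr (1 - p) * \<delta> powr (p - 1)" using d by (simp flip: powr_add)
    also have "... \<le> \<delta> powr (1 - p) * \<bar>y\<bar> powr (p - 1)"
      using False d p by (intro mult_left_mono powr_mono2) auto
    finally have "\<bar>y\<bar> * 1 \<le> \<bar>y\<bar> * (\<delta> powr (1 - p) * \<bar>y\<bar> powr (p - 1))" by (intro mult_left_mono) auto
    also have "... = \<delta> powr (1 - p) * \<bar>y\<bar> powr p" using False d by (simp add: powr_diff)
    finally show ?thesis using d by simp
  qed (simp add: add_increasing2)
  have "(LINT x|circ. \<bar>u x\<bar>) \<le> (LINT x|circ. \<delta> + \<delta> powr (1 - p) * \<bar>u x\<bar> powr p)"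
    using i p by (intro integral_mono integrable_abs integrable_powr_imp_integrable[of u p] Bochner_Integration.integrable_add
        integrable_mult_right circ.integrable_const le) auto
  then show ?thesis using i by (simp add: mult.commute)
qed

lemma L1_tendsto_of_Lp:
  fixes u :: "nat \<Rightarrow> real \<Rightarrow> real"
  assumes m: "\<And>n. u n \<in> borel_measurable borel" and p: "p > 1" and i: "\<And>n. integrable circ (\<lambda>x. \<bar>u n x\<bar> powr p)"
    and l: "(\<lambda>n. LINT x|circ. \<bar>u n x\<bar> powr p) \<longlonglongrightarrow> 0"
  shows "(\<lambda>n. LINT x|circ. \<bar>u n x\<bar>) \<longlonglongrightarrow> 0"
proof (rule tendstoI)
  fix e :: real assume e: "e > 0"
  define \<delta> where "\<delta> = e / (4 * pi)"
  have d: "\<delta> > 0" using e by (simp add: \<delta>_def)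
  have "(\<lambda>n. \<delta> powr (1 - p) * (LINT x|circ. \<bar>u n x\<bar> powr p)) \<longlonglongrightarrow> 0" by (rule tendsto_mult_right_zero[OF l])
  then have "\<forall>\<^sub>F n in sequentially. \<delta> powr (1 - p) * (LINT x|circ. \<bar>u n x\<bar> powr p) < e / 2"
    using e by (intro order_tendstoD(2)) auto
  then show "\<forall>\<^sub>F n in sequentially. dist (LINT x|circ. \<bar>u n x\<bar>) 0 < e"
  proof eventually_elim
    case (elim n)
    have "(LINT x|circ. \<bar>u n x\<bar>) \<le> \<delta> * (2 * pi) + \<delta> powr (1 - p) * (LINT x|circ. \<bar>u n x\<bar> powr p)"
      by (rule L1_le_Lp[OF m p i d])
    also have "\<delta> * (2 * pi) = e / 2" by (simp add: \<delta>_def)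
    finally show ?case using elim by (simp add: Bochner_Integration.integral_nonneg)
  qed
qed

text \<open>Padding with zero coefficients to a common degree makes differences of means of
  different orders accessible to the polynomial inequality.\<close>

lemma trigpoly_diff:
  "trigpoly n a \<alpha> \<beta> x - trigpoly m b \<gamma> \<delta> x = trigpoly (max n m) (a - b)
     (\<lambda>k. (if k \<le> n then \<alpha> k else 0) - (if k \<le> m then \<gamma> k else 0))
     (\<lambda>k. (if k \<le> n then \<beta> k else 0) - (if k \<le> m then \<delta> k else 0)) x"
proof -
  have e: "trigpoly n a \<alpha> \<beta> x = a + (\<Sum>k=1..M. (if k \<le> n then \<alpha> k else 0) * cos (real k * x) + (if k \<le> n then \<beta> k else 0) * sin (real k * x))"
    if "n \<le> M" for n M a \<alpha> \<beta>
    unfolding trigpoly_def using that by (intro arg_cong2[where f = "(+)"] refl sum.mono_neutral_cong_left) auto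
  show ?thesis
    unfolding e[of n "max n m", simplified] e[of m "max n m", simplified]
    by (simp add: trigpoly_def sum_subtractf[symmetric] left_diff_distrib algebra_simps)
qed

lemma cmean_diff_bound:
  assumes f: "integrable circ f" and p: "p > 1"
  shows "(LINT x|circ. \<bar>cmean N f x - cmean M f x\<bar> powr p) \<le> K_H p powr p * (LINT x|circ. \<bar>fmean N f x - fmean M f x\<bar> powr p)"
proof -
  \<comment> \<open>The padded coefficients must show the outer minus sign of the conjugate form
    before the bound matches.\<close>
  have neg: "(\<lambda>k. (if k \<le> N then - a k else 0) - (if k \<le> M then - b k else 0)) = (\<lambda>k. - ((if k \<le> N then a k else 0) - (if k \<le> M then b k else 0)))"
    for a b :: "nat \<Rightarrow> real" by auto
  show ?thesis
    unfolding fmean_trigpoly[OF f] cmean_trigpoly[OF f] trigpoly_diff neg diff_self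
    by (rule conjugate_trigpoly_bound[OF p])
qed

lemma cmean_bound:
  assumes f: "integrable circ f" and p: "p > 1"
  shows "(LINT x|circ. \<bar>cmean N f x\<bar> powr p) \<le> K_H p powr p * (LINT x|circ. \<bar>fmean N f x\<bar> powr p)"
  unfolding fmean_trigpoly[OF f] cmean_trigpoly[OF f] by (rule conjugate_trigpoly_bound[OF p])

lemma mean_tendsto_L1:
  fixes v :: "nat \<Rightarrow> real \<Rightarrow> real"
  assumes v: "\<And>k. integrable circ (v k)" "integrable circ w" and l: "(\<lambda>k. LINT x|circ. \<bar>v k x - w x\<bar>) \<longlonglongrightarrow> 0"
  shows "(\<lambda>k. fmean N (v k) x) \<longlonglongrightarrow> fmean N w x" "(\<lambda>k. cmean N (v k) x) \<longlonglongrightarrow> cmean N w x"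
proof -
  have *: "(\<lambda>k. 1 / (2 * pi) * (LINT y|circ. v k y * K (x - y))) \<longlonglongrightarrow> 1 / (2 * pi) * (LINT y|circ. w y * K (x - y))"
    if K[measurable]: "K \<in> borel_measurable borel" and B: "\<And>t. \<bar>K t\<bar> \<le> B" for K B
  proof (intro tendsto_mult tendsto_const)
    have ik: "integrable circ (\<lambda>y. h y * K (x - y))" if "integrable circ h" for h
      by (rule integrable_circ_mult_bounded[OF that _ B]) simp
    have "\<bar>(LINT y|circ. v k y * K (x - y)) - (LINT y|circ. w y * K (x - y))\<bar> \<le> (LINT x|circ. \<bar>v k x - w x\<bar>) * B" for k
    proof -
      have id: "integrable circ (\<lambda>x. v k x - w x)" using v by simp
      have "(LINT y|circ. v k y * K (x - y)) - (LINT y|circ. w y * K (x - y)) = (LINT y|circ. (v k y - w y) * K (x - y))"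
        using ik[OF v(1)[of k]] ik[OF v(2)] by (simp add: left_diff_distrib)
      also have "\<bar>...\<bar> \<le> (LINT y|circ. \<bar>(v k y - w y) * K (x - y)\<bar>)" by (rule integral_abs_bound)
      also have "... \<le> (LINT y|circ. \<bar>v k y - w y\<bar> * B)"
        by (intro integral_mono integrable_abs ik[OF id] integrable_mult_left) (auto simp: abs_mult intro!: mult_left_mono B id)
      finally show ?thesis by simp
    qed
    then have "(\<lambda>k. (LINT y|circ. v k y * K (x - y)) - (LINT y|circ. w y * K (x - y))) \<longlonglongrightarrow> 0"
      by (intro Lim_null_comparison[OF _ tendsto_mult_left_zero[OF l, of B]]) auto
    then show "(\<lambda>k. LINT y|circ. v k y * K (x - y)) \<longlonglongrightarrow> (LINT y|circ. w y * K (x - y))" by (simp add: LIM_zero_iff)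
  qed
  show "(\<lambda>k. fmean N (v k) x) \<longlonglongrightarrow> fmean N w x" "(\<lambda>k. cmean N (v k) x) \<longlonglongrightarrow> cmean N w x"
    unfolding fmean_def cmean_def using *[OF fejer_measurable(1) fejer_crude(1)] *[OF fejer_measurable(2) fejer_crude(2)] by auto
qed

text \<open>The limit is delivered as a Borel function g because the pointwise \<open>Lim\<close>
  defining \<open>hilbert\<close> is not known in advance to exist or to be measurable.\<close>

theorem riesz_pichorides:
  fixes f :: "real \<Rightarrow> real"
  assumes m[measurable]: "f \<in> borel_measurable borel" and per: "periodic f" and p: "p > 1" and i: "integrable circ (\<lambda>x. \<bar>f x\<bar> powr p)"
  obtains g where "g \<in> borel_measurable borel" "AE x in circ. ((\<lambda>eps. hilbert_trunc eps f x) \<longlongrightarrow> g x) (at_right 0)"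
    "(\<integral>\<^sup>+x. ennreal (\<bar>g x\<bar> powr p) \<partial>circ) \<le> ennreal (K_H p powr p * (LINT x|circ. \<bar>f x\<bar> powr p))"
proof -
  have f1: "integrable circ f" using integrable_powr_imp_integrable[OF m _ i] p by simp
  have p0: "p > 0" using p by simp
  define u where "u N = cmean N f" for N
  let ?R = "ennreal (K_H p powr p * (LINT x|circ. \<bar>f x\<bar> powr p))"
  let ?U = "\<lambda>N. \<integral>\<^sup>+x. ennreal (\<bar>u N x\<bar> powr p) \<partial>circ"
  let ?P = "\<lambda>m n. LINT x|circ. \<bar>u m x - u n x\<bar> powr p"
  define v where "v N = fmean N f" for N
  have um[measurable]: "u N \<in> borel_measurable borel" "v N \<in> borel_measurable borel" for N
    by (simp_all add: u_def v_def cmean_trigpoly[OF f1] fmean_trigpoly[OF f1])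
  have ui: "integrable circ (u N)" "integrable circ (v N)" for N
    by (simp_all add: u_def v_def cmean_trigpoly[OF f1] fmean_trigpoly[OF f1] integrable_circ_trigpoly)
  define D where "D N = (LINT x|circ. \<bar>v N x - f x\<bar> powr p)" for N
  have D: "D \<longlonglongrightarrow> 0" unfolding D_def v_def by (rule fmean_Lp_tendsto[OF m per p i])
  have D0: "D N \<ge> 0" for N unfolding D_def by (intro Bochner_Integration.integral_nonneg) auto
  have ivf: "integrable circ (\<lambda>x. \<bar>v N x - f x\<bar> powr p)" for N
    unfolding v_def by (rule integrable_fmean_powr[OF f1 m i p0])
  have v1: "(\<lambda>N. LINT x|circ. \<bar>v N x - f x\<bar>) \<longlonglongrightarrow> 0"
    by (rule L1_tendsto_of_Lp[OF _ p ivf]) (use D in \<open>simp_all add: D_def[abs_def]\<close>)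
  have iuu: "integrable circ (\<lambda>x. \<bar>u N x - u M x\<bar> powr p)" for N M
    unfolding u_def cmean_trigpoly[OF f1] trigpoly_diff by (rule integrable_circ_trigpoly_powr[OF p0])
  define C where "C = K_H p powr p * 3 powr p"
  have C: "C > 0" using K_H_pos[OF p] by (simp add: C_def)
  have uu: "?P N M \<le> C * (D N + D M)" for N M
  proof -
    have ivv: "integrable circ (\<lambda>x. \<bar>v N x - v M x\<bar> powr p)"
      unfolding v_def fmean_trigpoly[OF f1] trigpoly_diff by (rule integrable_circ_trigpoly_powr[OF p0])
    have "?P N M \<le> K_H p powr p * (LINT x|circ. \<bar>v N x - v M x\<bar> powr p)"
      unfolding u_def v_def by (rule cmean_diff_bound[OF f1 p])
    also have "(LINT x|circ. \<bar>v N x - v M x\<bar> powr p) \<le> (LINT x|circ. 3 powr p * (\<bar>v N x - f x\<bar> powr p + \<bar>v M x - f x\<bar> powr p))"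
    proof (rule integral_mono[OF ivv])
      fix x
      show "\<bar>v N x - v M x\<bar> powr p \<le> 3 powr p * (\<bar>v N x - f x\<bar> powr p + \<bar>v M x - f x\<bar> powr p)"
        using abs_add_powr_le[OF p0, of "v N x - f x" "f x - v M x" 0] by (simp add: abs_minus_commute)
    qed (use ivf in auto)
    also have "... = 3 powr p * (D N + D M)" using ivf by (simp add: D_def)
    finally show ?thesis by (simp add: C_def mult.assoc mult_left_mono)
  qed
  have cau: "\<exists>N. \<forall>m\<ge>N. \<forall>n\<ge>N. (LINT x|circ. \<bar>u m x - u n x\<bar>) < e" if e: "e > 0" for e
  proof -
    \<comment> \<open>\<delta> makes the first term of \<open>L1_le_Lp\<close> equal to e/2, and
      \<eta> then makes the bound of the second equal to e/2.\<close>
    define \<delta> where "\<delta> = e / (4 * pi)"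
    have d: "\<delta> > 0" using e by (simp add: \<delta>_def)
    define \<eta> where "\<eta> = e / (4 * \<delta> powr (1 - p) * C)"
    have \<eta>: "\<eta> > 0" using e d C by (simp add: \<eta>_def)
    obtain N where N: "\<And>n. n \<ge> N \<Longrightarrow> D n < \<eta>"
      using order_tendstoD(2)[OF D \<eta>] unfolding eventually_sequentially by blast
    show ?thesis
    proof (intro exI allI impI)
      fix m n assume mn: "m \<ge> N" "n \<ge> N"
      have "(LINT x|circ. \<bar>u m x - u n x\<bar>) \<le> \<delta> * (2 * pi) + \<delta> powr (1 - p) * ?P m n"
        by (rule L1_le_Lp[OF _ p iuu d]) simp
      also have "\<delta> powr (1 - p) * ?P m n \<le> \<delta> powr (1 - p) * (C * (D m + D n))"
        by (intro mult_left_mono uu) auto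
      also have "... < \<delta> powr (1 - p) * (C * (2 * \<eta>))"
        using N[OF mn(1)] N[OF mn(2)] C d by (intro mult_strict_left_mono) auto
      also have "... = e / 2" using d C by (simp add: \<eta>_def)
      also have "\<delta> * (2 * pi) = e / 2" by (simp add: \<delta>_def)
      finally show "(LINT x|circ. \<bar>u m x - u n x\<bar>) < e" by simp
    qed
  qed
  obtain r w where r: "\<And>k. r k \<ge> k" and w: "integrable circ w"
    and conv: "AE x in circ. convergent (\<lambda>k. u (r k) x)" and dom: "\<And>k. AE x in circ. \<bar>u (r k) x\<bar> \<le> w x"
    using L1_Cauchy_dominated_subsequence[OF ui(1) cau, of thesis] by presburger
  have rlim: "filterlim r sequentially sequentially"
    by (rule filterlim_at_top_mono[OF filterlim_ident]) (use r in auto)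
  define g where "g x = lim (\<lambda>k. u (r k) x)" for x
  have gm[measurable]: "g \<in> borel_measurable borel" unfolding g_def by measurable
  \<comment> \<open>This holds at every x, even where the sequence diverges: both values are
    \<open>lim\<close> of the same sequence.\<close>
  have gper: "periodic g"
  proof -
    have "u N (x + 2 * pi) = u N x" for N x
      using periodic_trigpoly unfolding u_def cmean_trigpoly[OF f1] by (rule periodicD)
    then show ?thesis by (simp add: periodic_def g_def)
  qed
  have glim: "AE x in circ. (\<lambda>k. u (r k) x) \<longlonglongrightarrow> g x"
    using conv by eventually_elim (simp add: g_def convergent_LIMSEQ_iff)
  have gdom: "AE x in circ. \<bar>g x\<bar> \<le> w x"
  proof -
    have "AE x in circ. \<forall>k. \<bar>u (r k) x\<bar> \<le> w x" using dom by (simp add: AE_all_countable)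
    then show ?thesis using glim
    proof eventually_elim
      case (elim x)
      then have "(\<lambda>k. \<bar>u (r k) x\<bar>) \<longlonglongrightarrow> \<bar>g x\<bar>" by (intro tendsto_rabs)
      then show ?case by (rule LIMSEQ_le_const2) (use elim(1) in auto)
    qed
  qed
  have gi: "integrable circ g"
    by (rule Bochner_Integration.integrable_bound[OF w]) (use gdom in \<open>auto elim!: eventually_mono\<close>)
  have "(\<lambda>k. LINT x|circ. \<bar>u (r k) x - g x\<bar>) \<longlonglongrightarrow> (LINT x|circ. 0)"
  proof (rule integral_dominated_convergence[where w = "\<lambda>x. 2 * w x"])
    show "AE x in circ. (\<lambda>k. \<bar>u (r k) x - g x\<bar>) \<longlonglongrightarrow> 0"
      using glim by eventually_elim (rule tendsto_rabs_zero, simp add: LIM_zero_iff)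
    fix k
    show "AE x in circ. norm \<bar>u (r k) x - g x\<bar> \<le> 2 * w x"
      using dom[of k] gdom by eventually_elim simp
  qed (use w in auto)
  then have ug: "(\<lambda>k. LINT x|circ. \<bar>u (r k) x - g x\<bar>) \<longlonglongrightarrow> 0" by simp
  \<comment> \<open>The operators commute: fmean N (cmean k f) = cmean N (fmean k f). Along the
    subsequence the left side tends to fmean N g and the right side to cmean N f. This recovers the
    full sequence of conjugate means from g.\<close>
  have key: "cmean N f x = fmean N g x" for N x
  proof (rule LIMSEQ_unique)
    have e: "fmean N (u k) x = cmean N (v k) x" for k
      unfolding u_def v_def cmean_trigpoly[OF f1] fmean_trigpoly[OF f1] cmean_eq_fmean_conjugate ..
    show "(\<lambda>k. cmean N (v (r k)) x) \<longlonglongrightarrow> fmean N g x"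
      using mean_tendsto_L1(1)[OF ui(1) gi ug, of N x] by (simp only: e)
    show "(\<lambda>k. cmean N (v (r k)) x) \<longlonglongrightarrow> cmean N f x"
      by (rule mean_tendsto_L1(2)[OF ui(2) f1 filterlim_compose[OF v1 rlim]])
  qed
  have ulim: "AE x in circ. (\<lambda>N. cmean N f x) \<longlonglongrightarrow> g x"
    using AE_is_lebesgue_point[OF gm gper gi] by eventually_elim (unfold key, rule fmean_tendsto[OF gm gper gi])
  show thesis
  proof
    show "AE x in circ. ((\<lambda>eps. hilbert_trunc eps f x) \<longlongrightarrow> g x) (at_right 0)"
      using ulim AE_is_lebesgue_point[OF m per f1] by eventually_elim (rule hilbert_trunc_tendsto[OF m per f1])
    have b: "?U N \<le> ?R" for N
    proof -
      have "?U N = ennreal (LINT x|circ. \<bar>u N x\<bar> powr p)"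
        by (intro nn_integral_eq_integral) (auto simp: u_def cmean_trigpoly[OF f1] integrable_circ_trigpoly_powr[OF p0])
      also have "(LINT x|circ. \<bar>u N x\<bar> powr p) \<le> K_H p powr p * (LINT x|circ. \<bar>v N x\<bar> powr p)"
        unfolding u_def v_def by (rule cmean_bound[OF f1 p])
      also have "... \<le> K_H p powr p * (LINT x|circ. \<bar>f x\<bar> powr p)"
        unfolding v_def by (intro mult_left_mono fmean_contraction[OF m p i]) auto
      finally show ?thesis by (simp add: ennreal_leI)
    qed
    have "(\<integral>\<^sup>+x. ennreal (\<bar>g x\<bar> powr p) \<partial>circ) = (\<integral>\<^sup>+x. liminf (\<lambda>N. ennreal (\<bar>u N x\<bar> powr p)) \<partial>circ)"
    proof (rule nn_integral_cong_AE)
      show "AE x in circ. ennreal (\<bar>g x\<bar> powr p) = liminf (\<lambda>N. ennreal (\<bar>u N x\<bar> powr p))"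
        using ulim
      proof eventually_elim
        case (elim x)
        have "(\<lambda>N. \<bar>u N x\<bar> powr p) \<longlonglongrightarrow> \<bar>g x\<bar> powr p"
          using elim p0 by (intro tendsto_powr' tendsto_rabs tendsto_const) (auto simp: u_def)
        then have "(\<lambda>N. ennreal (\<bar>u N x\<bar> powr p)) \<longlonglongrightarrow> ennreal (\<bar>g x\<bar> powr p)" by (rule tendsto_ennrealI)
        then show ?case by (rule lim_imp_Liminf[OF sequentially_bot, symmetric])
      qed
    qed
    also have "... \<le> liminf (\<lambda>N. ?U N)"
      by (rule nn_integral_liminf) simp
    also have "... \<le> limsup (\<lambda>N. ?U N)"
      by (rule Liminf_le_Limsup) simp
    also have "... \<le> ?R"
      by (rule Limsup_bounded) (use b in auto)
    finally show "(\<integral>\<^sup>+x. ennreal (\<bar>g x\<bar> powr p) \<partial>circ) \<le> ?R" .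
  qed simp
qed

subsection \<open>The Hilbert transform of the grand Lebesgue spaces\<close>

lemma periodic_ext_int: "periodic_ext f y = f (y + 2 * pi * of_int (- \<lfloor>(y + pi) / (2 * pi)\<rfloor>))"
  by (simp add: periodic_ext_def rmod_def algebra_simps)

lemma periodic_periodic_ext: "periodic (periodic_ext f)"
proof -
  have "(x + 2 * pi + pi) rmod (2 * pi) = (x + pi) rmod (2 * pi)" for x
    using rmod_add[of "x + pi" "2 * pi" "2 * pi"] by (simp add: add_ac)
  then show ?thesis by (simp add: periodic_def periodic_ext_def)
qed

lemma periodic_ext_periodic: "periodic f \<Longrightarrow> periodic_ext f = f"
  by (intro ext) (simp only: periodic_ext_int periodic_int)

lemma periodic_ext_measurable:
  assumes [measurable]: "f \<in> borel_measurable borel"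
  shows "periodic_ext f \<in> borel_measurable borel"
  unfolding periodic_ext_def[abs_def] rmod_def by measurable

lemma periodic_ext_eq: "x \<in> {-pi..<pi} \<Longrightarrow> periodic_ext f x = f x"
  unfolding periodic_ext_def by (subst rmod_idem) auto

lemma AE_lborel_shift:
  fixes c :: real
  assumes "AE x in lborel. P x" shows "AE x in lborel. P (x + c)"
proof -
  have "AE x in distr lborel borel ((+) c). P x" using assms by (simp only: lborel_distr_plus)
  then have "AE x in lborel. P (c + x)" by (rule AE_distrD[rotated]) simp
  then show ?thesis by (simp add: add.commute)
qed

text \<open>The periodic extension reads its argument at an integer translate. There are countably
  many translates, so almost every point has all of them outside the exceptional set.\<close>

lemma AE_periodic_ext_eq:
  assumes "AE x in lborel. f x = g x"
  shows "AE x in lborel. periodic_ext f x = periodic_ext g x"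
proof -
  have "AE x in lborel. \<forall>k::int. f (x + 2 * pi * of_int k) = g (x + 2 * pi * of_int k)"
    using AE_lborel_shift[OF assms] by (simp add: AE_all_countable)
  then show ?thesis by eventually_elim (simp only: periodic_ext_int)
qed

text \<open>Two agreements are needed: with f on the base interval for the norms, and with the
  periodic extension on the whole line for the convolution. They differ only in the end point \<pi>,
  a null set.\<close>

lemma periodic_borel_representative:
  fixes f :: "real \<Rightarrow> real"
  assumes f: "f \<in> borel_measurable (lebesgue_on {-pi..pi})"
  obtains F where "F \<in> borel_measurable borel" "periodic F" "AE x in circ. f x = F x"
    "AE x in lborel. periodic_ext f x = F x"
proof -
  define f0 where "f0 x = (if x \<in> {-pi..pi} then f x else 0)" for x
  have "f0 \<in> borel_measurable lebesgue"
    unfolding f0_def using borel_measurable_if_I[OF f] by simp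
  then obtain h where h: "h \<in> borel_measurable lborel" "AE x in lborel. f0 x = h x"
    using completion_ex_borel_measurable_real by blast
  have hm: "h \<in> borel_measurable borel" using h(1) by simp
  have "periodic_ext f = periodic_ext f0"
  proof
    fix x
    have "(x + pi) rmod (2 * pi) \<ge> 0" "(x + pi) rmod (2 * pi) < 2 * pi"
      by (intro rmod_nonneg rmod_less; simp)+
    then show "periodic_ext f x = periodic_ext f0 x" by (simp add: periodic_ext_def f0_def)
  qed
  then have e: "AE x in lborel. periodic_ext f x = periodic_ext h x"
    using AE_periodic_ext_eq[OF h(2)] by simp
  show thesis
  proof
    show "periodic_ext h \<in> borel_measurable borel" by (rule periodic_ext_measurable[OF hm])
    show "periodic (periodic_ext h)" by (rule periodic_periodic_ext)
    show "AE x in lborel. periodic_ext f x = periodic_ext h x" by (rule e)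
    show "AE x in circ. f x = periodic_ext h x"
      using AE_circ_D[OF e] AE_circ_range AE_circ_D[OF AE_lborel_singleton[of pi]]
    proof eventually_elim
      case (elim x)
      then show ?case using periodic_ext_eq[of x f] by simp
    qed
  qed
qed

text \<open>The equality holds at every x, not just almost every x: changing the function on a null
  set alters no truncated integral, and \<open>Lim\<close> sees only these.\<close>

lemma hilbert_eq_Lim_circ:
  assumes m[measurable]: "F \<in> borel_measurable borel" and e: "AE y in lborel. periodic_ext f y = F y"
  shows "hilbert f x = 1 / (2 * pi) * Lim (at_right 0) (\<lambda>eps. LINT t|circ. F (x - t) * cotcut eps t)"
proof -
  have "(LINT t:{t. eps \<le> \<bar>t\<bar> \<and> \<bar>t\<bar> \<le> pi}|lebesgue. periodic_ext f (x - t) * cot (t / 2)) = (LINT t|circ. F (x - t) * cotcut eps t)" for eps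
  proof -
    let ?i = "indicator {t. eps \<le> \<bar>t\<bar> \<and> \<bar>t\<bar> \<le> pi} :: real \<Rightarrow> real"
    let ?F = "\<lambda>t. ?i t *\<^sub>R (F (x - t) * cot (t / 2))"
    let ?f = "\<lambda>t. ?i t *\<^sub>R (periodic_ext f (x - t) * cot (t / 2))"
    have cc: "?i t *\<^sub>R (c * cot (t / 2)) = indicator {-pi..pi} t *\<^sub>R (c * cotcut eps t)" for t c
      by (auto simp: indicator_def cotcut_def)
    have "AE t in lborel. periodic_ext f (t + x) = F (t + x)" by (rule AE_lborel_shift[OF e])
    then have "AE t in lborel. periodic_ext f (x - t) = F (x - t)"
      using AE_lborel_uminus[of "\<lambda>t. periodic_ext f (t + x) = F (t + x)"] by (simp add: add.commute)
    then have ae: "AE t in lborel. ?F t = ?f t"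
      by eventually_elim simp
    then have ae': "AE t in lebesgue. ?F t = ?f t"
      by (simp only: AE_completion_iff)
    have mF: "?F \<in> borel_measurable borel"
      unfolding cc by measurable
    then have mF': "?F \<in> borel_measurable lebesgue"
      by (intro measurable_completion) simp
    have "(LINT t:{t. eps \<le> \<bar>t\<bar> \<and> \<bar>t\<bar> \<le> pi}|lebesgue. periodic_ext f (x - t) * cot (t / 2))
       = (LINT t|lebesgue. ?F t)"
      unfolding set_lebesgue_integral_def
      by (rule integral_cong_AE[symmetric, OF mF' borel_measurable_AE[OF mF' ae'] ae'])
    also have "... = (LINT t|lborel. ?F t)"
      by (rule integral_completion) (use mF in simp)
    also have "... = (LINT t|circ. F (x - t) * cotcut eps t)"
      unfolding cc by (subst integral_circ) (auto simp: set_lebesgue_integral_def)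
    finally show ?thesis .
  qed
  then show ?thesis by (simp add: hilbert_def)
qed

lemma hilbert_eq_limit:
  assumes m: "F \<in> borel_measurable borel" and e: "AE y in lborel. periodic_ext f y = F y"
    and l: "((\<lambda>eps. hilbert_trunc eps F x) \<longlongrightarrow> y) (at_right 0)"
  shows "hilbert f x = y"
proof -
  have "((\<lambda>eps. 2 * pi * hilbert_trunc eps F x) \<longlongrightarrow> 2 * pi * y) (at_right 0)"
    by (intro tendsto_intros l)
  then have "((\<lambda>eps. LINT t|circ. F (x - t) * cotcut eps t) \<longlongrightarrow> 2 * pi * y) (at_right 0)"
    by (simp add: hilbert_trunc_def)
  then have "Lim (at_right 0) (\<lambda>eps. LINT t|circ. F (x - t) * cotcut eps t) = 2 * pi * y"
    by (intro tendsto_Lim) simp_all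
  then show ?thesis by (simp add: hilbert_eq_Lim_circ[OF m e])
qed

lemma AE_circ_lebesgue_on: "(AE x in lebesgue_on {-pi..pi}. P x) \<longleftrightarrow> (AE x in circ. P x)"
  unfolding AE_circ by (subst AE_restrict_space_iff) (simp_all add: AE_completion_iff)

lemma nn_integral_lebesgue_on_circ:
  assumes [measurable]: "h \<in> borel_measurable borel" and e: "AE x in circ. k x = h x"
  shows "(\<integral>\<^sup>+x. k x \<partial>lebesgue_on {-pi..pi}) = (\<integral>\<^sup>+x. h x \<partial>circ)"
proof -
  have "(\<integral>\<^sup>+x. k x \<partial>lebesgue_on {-pi..pi}) = (\<integral>\<^sup>+x. h x \<partial>lebesgue_on {-pi..pi})"
    using e by (intro nn_integral_cong_AE) (simp add: AE_circ_lebesgue_on)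
  also have "... = (\<integral>\<^sup>+x. h x * indicator {-pi..pi} x \<partial>lborel)"
    by (subst nn_integral_restrict_space) (simp_all add: nn_integral_completion)
  finally show ?thesis by (simp add: nn_integral_circ)
qed

text \<open>Completeness of Lebesgue measure. It absorbs the unspecified values that
  \<open>hilbert\<close> takes where the principal value fails to exist.\<close>

lemma borel_measurable_lebesgue_on_circ:
  fixes g h :: "real \<Rightarrow> real"
  assumes h: "h \<in> borel_measurable borel" and e: "AE x in circ. g x = h x"
  shows "g \<in> borel_measurable (lebesgue_on {-pi..pi})"
proof -
  have 1: "(\<lambda>x. if x \<in> {-pi..pi} then h x else 0) \<in> borel_measurable lebesgue"
    by (rule measurable_completion) (use h in simp)
  have "AE x in lborel. (if x \<in> {-pi..pi} then h x else 0) = (if x \<in> {-pi..pi} then g x else 0)"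
    using e unfolding AE_circ by eventually_elim simp
  then have "AE x in lebesgue. (if x \<in> {-pi..pi} then h x else 0) = (if x \<in> {-pi..pi} then g x else 0)"
    by (simp only: AE_completion_iff)
  from borel_measurable_AE[OF 1 this]
  show ?thesis by (rule borel_measurable_if_D)
qed

lemma Lp_norm_circ:
  fixes g h :: "real \<Rightarrow> real"
  assumes [measurable]: "h \<in> borel_measurable borel" and e: "AE x in circ. g x = h x"
  shows "Lp_norm p g = (let I = (\<integral>\<^sup>+x. ennreal (\<bar>h x\<bar> powr p) \<partial>circ) in if I = \<infinity> then \<infinity> else ennreal (enn2real I powr (1 / p)))"
proof -
  have "(\<integral>\<^sup>+x. ennreal (\<bar>g x\<bar> powr p) \<partial>lebesgue_on {-pi..pi}) = (\<integral>\<^sup>+x. ennreal (\<bar>h x\<bar> powr p) \<partial>circ)"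
    by (rule nn_integral_lebesgue_on_circ) (use e in \<open>auto elim!: eventually_mono\<close>)
  then show ?thesis by (simp add: Lp_norm_def)
qed

lemma hilbert_Lp_bound:
  assumes f: "f \<in> borel_measurable (lebesgue_on {-pi..pi})" and p: "p > 1" and fin: "Lp_norm p f < \<infinity>"
  shows "hilbert f \<in> borel_measurable (lebesgue_on {-pi..pi})" "Lp_norm p (hilbert f) \<le> ennreal (K_H p) * Lp_norm p f"
proof -
  obtain F where F[measurable]: "F \<in> borel_measurable borel" and per: "periodic F" and ef: "AE x in circ. f x = F x"
    and ext: "AE x in lborel. periodic_ext f x = F x"
    by (rule periodic_borel_representative[OF f])
  define I where "I = (\<integral>\<^sup>+x. ennreal (\<bar>F x\<bar> powr p) \<partial>circ)"
  have Lf: "Lp_norm p f = (if I = \<infinity> then \<infinity> else ennreal (enn2real I powr (1 / p)))"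
    using Lp_norm_circ[OF F ef] by (simp add: I_def)
  then have I: "I \<noteq> \<infinity>" using fin by auto
  have i: "integrable circ (\<lambda>x. \<bar>F x\<bar> powr p)"
    using I by (intro integrableI_bounded) (auto simp: I_def top.not_eq_extremum)
  have Ii: "enn2real I = (LINT x|circ. \<bar>F x\<bar> powr p)"
    unfolding I_def by (subst nn_integral_eq_integral[OF i]) (auto intro: Bochner_Integration.integral_nonneg)
  obtain g where g: "g \<in> borel_measurable borel" "AE x in circ. ((\<lambda>eps. hilbert_trunc eps F x) \<longlongrightarrow> g x) (at_right 0)"
    "(\<integral>\<^sup>+x. ennreal (\<bar>g x\<bar> powr p) \<partial>circ) \<le> ennreal (K_H p powr p * (LINT x|circ. \<bar>F x\<bar> powr p))"
    by (rule riesz_pichorides[OF F per p i])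
  have hg: "AE x in circ. hilbert f x = g x"
    using g(2) by eventually_elim (rule hilbert_eq_limit[OF F ext])
  show "hilbert f \<in> borel_measurable (lebesgue_on {-pi..pi})"
    by (rule borel_measurable_lebesgue_on_circ[OF g(1) hg])
  define J where "J = (\<integral>\<^sup>+x. ennreal (\<bar>g x\<bar> powr p) \<partial>circ)"
  have J: "J \<le> ennreal (K_H p powr p * enn2real I)" using g(3) by (simp add: J_def Ii)
  then have J': "J \<noteq> \<infinity>" by (metis ennreal_neq_top infinity_ennreal_def neq_top_trans)
  have "Lp_norm p (hilbert f) = ennreal (enn2real J powr (1 / p))"
    using Lp_norm_circ[OF g(1) hg, of p] J' by (simp add: J_def[symmetric])
  also have "... \<le> ennreal ((K_H p powr p * enn2real I) powr (1 / p))"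
    using p J by (intro ennreal_leI powr_mono2 enn2real_leI) auto
  also have "(K_H p powr p * enn2real I) powr (1 / p) = K_H p * enn2real I powr (1 / p)"
    using p K_H_pos[OF p] by (simp add: powr_mult powr_powr)
  also have "ennreal ... = ennreal (K_H p) * Lp_norm p f"
    using I K_H_pos[OF p] by (simp add: Lf ennreal_mult)
  finally show "Lp_norm p (hilbert f) \<le> ennreal (K_H p) * Lp_norm p f" .
qed

lemma hilbert_Gspace:
  assumes A: "1 \<le> A" "ereal A < B" and \<psi>: "\<psi> \<in> Psi A B" and f: "f \<in> Gspace A B \<psi>"
  shows "hilbert f \<in> Gspace A B (psi_H \<psi>)" "Gnorm A B (psi_H \<psi>) (hilbert f) \<le> Gnorm A B \<psi> f"
proof -
  have fm: "f \<in> borel_measurable (lebesgue_on {-pi..pi})" and fG: "Gnorm A B \<psi> f < \<infinity>"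
    using f by (auto simp: Gspace_def)
  have p: "p > 1" if "p \<in> exponents A B" for p using that A by (auto simp: exponents_def)
  have pos: "\<psi> p > 0" if "p \<in> exponents A B" for p using that \<psi> by (auto simp: Psi_def)
  have le: "Lp_norm p f / ennreal (\<psi> p) \<le> Gnorm A B \<psi> f" if "p \<in> exponents A B" for p
    unfolding Gnorm_def using that by (rule SUP_upper)
  have fin: "Lp_norm p f < \<infinity>" if P: "p \<in> exponents A B" for p
  \<comment> \<open>An infinite L_p norm divided by the finite weight would be infinite and already
    exceed the G-norm.\<close>
  proof (rule ccontr)
    assume "\<not> Lp_norm p f < \<infinity>"
    then have "Lp_norm p f / ennreal (\<psi> p) = \<infinity>"
      by (simp add: top.not_eq_extremum[symmetric] ennreal_top_divide)
    then show False using le[OF P] fG by (metis infinity_ennreal_def neq_top_trans order_less_irrefl)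
  qed
  show G: "Gnorm A B (psi_H \<psi>) (hilbert f) \<le> Gnorm A B \<psi> f"
    unfolding Gnorm_def[of A B "psi_H \<psi>"]
  proof (rule SUP_least)
    fix p assume P: "p \<in> exponents A B"
    have K: "K_H p > 0" by (rule K_H_pos[OF p[OF P]])
    have "Lp_norm p (hilbert f) / ennreal (psi_H \<psi> p) \<le> (ennreal (K_H p) * Lp_norm p f) / ennreal (psi_H \<psi> p)"
      by (intro divide_right_mono_ennreal hilbert_Lp_bound(2)[OF fm p[OF P] fin[OF P]])
    also have "... = Lp_norm p f / ennreal (\<psi> p)"
      using K pos[OF P] fin[OF P]
      by (cases "Lp_norm p f") (auto simp: psi_H_def ennreal_mult'[symmetric] divide_ennreal)
    also have "... \<le> Gnorm A B \<psi> f" by (rule le[OF P])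
    finally show "Lp_norm p (hilbert f) / ennreal (psi_H \<psi> p) \<le> Gnorm A B \<psi> f" .
  qed
  \<comment> \<open>Measurability of the transform comes from the L_p theory, so one exponent in the
    interval is required; A < B supplies it.\<close>
  obtain p where "ereal A < ereal p" "ereal p < B" using A(2) ereal_dense2 by blast
  then have P: "p \<in> exponents A B" by (auto simp: exponents_def)
  have "hilbert f \<in> borel_measurable (lebesgue_on {-pi..pi})"
    by (rule hilbert_Lp_bound(1)[OF fm p[OF P] fin[OF P]])
  then show "hilbert f \<in> Gspace A B (psi_H \<psi>)"
    using G fG by (simp add: Gspace_def)
qed

subsection \<open>Sharpness\<close>

text \<open>The term \<open>- 0\<close> is kept so that the second equation has the literal form of
  a conjugate polynomial.\<close>

lemma trigpoly_cos_sin: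
  "trigpoly 1 0 (\<lambda>_. 1) (\<lambda>_. 0) = cos" "trigpoly 1 0 (\<lambda>_. - 0) (\<lambda>_. 1) = sin"
  by (simp_all add: trigpoly_def fun_eq_iff)

lemma hilbert_cos: "AE x in circ. hilbert cos x = sin x"
proof -
  have "cos \<in> borel_measurable (borel :: real measure)"
    by (intro borel_measurable_continuous_onI continuous_intros)
  then have c: "(cos :: real \<Rightarrow> real) \<in> borel_measurable borel" "periodic (cos :: real \<Rightarrow> real)" "integrable circ cos"
    using periodic_trigpoly[of 1 0 "\<lambda>_. 1" "\<lambda>_. 0"] integrable_circ_trigpoly[of 1 0 "\<lambda>_. 1" "\<lambda>_. 0"]
    unfolding trigpoly_cos_sin by auto
  have "(\<lambda>N. cmean N cos x) \<longlonglongrightarrow> sin x" for x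
    using fmean_trigpoly_tendsto[of 1 0 "\<lambda>_. - 0" "\<lambda>_. 1" x] cmean_eq_fmean_conjugate[of _ 1 0 "\<lambda>_. 1" "\<lambda>_. 0"]
    unfolding trigpoly_cos_sin by simp
  then show ?thesis
    using AE_is_lebesgue_point[OF c]
    by (auto elim!: eventually_mono intro!: hilbert_eq_limit[OF c(1)] hilbert_trunc_tendsto[OF c] simp: periodic_ext_periodic[OF c(2)])
qed

lemma integral_cos_sin_square: "(LINT x|circ. \<bar>cos x\<bar> powr 2) = pi" "(LINT x|circ. \<bar>sin x\<bar> powr 2) = pi"
  using integral_circ_orthogonal(1)[of 1 1] integral_circ_orthogonal(4)[of 1 1]
  by (simp_all add: power2_eq_square)

text \<open>
  The weight \<open>\<psi>(p) = \<parallel>cos\<parallel>\<^sub>p\<close> makes all quotients \<open>\<parallel>cos\<parallel>\<^sub>p / \<psi>(p)\<close> equal to \<open>1\<close>, so that the exponent \<open>p = 2\<close>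
  alone decides the lower bound.
\<close>

definition cos_norm :: "real \<Rightarrow> real" where
  "cos_norm p = (LINT x|circ. \<bar>cos x\<bar> powr p) powr (1 / p)"

lemma integrable_cos_powr: "p > 0 \<Longrightarrow> integrable circ (\<lambda>x. \<bar>cos x\<bar> powr p)" "p > 0 \<Longrightarrow> integrable circ (\<lambda>x. \<bar>sin x\<bar> powr p)"
  by (intro integral_circ_HK(1) continuous_on_powr' continuous_intros; simp)+

lemma integral_cos_powr_pos:
  assumes "p > 0" shows "(LINT x|circ. \<bar>cos x\<bar> powr p) > 0"
proof (rule ccontr)
  assume "\<not> (LINT x|circ. \<bar>cos x\<bar> powr p) > 0"
  moreover have "(LINT x|circ. \<bar>cos x\<bar> powr p) \<ge> 0" by (intro Bochner_Integration.integral_nonneg) auto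
  ultimately have "(LINT x|circ. \<bar>cos x\<bar> powr p) = 0" by simp
  then have "AE x in circ. \<bar>cos x\<bar> powr p = 0"
    by (subst (asm) integral_nonneg_eq_0_iff_AE[OF integrable_cos_powr(1)[OF assms]]) auto
  then have "AE x in circ. \<bar>cos x\<bar> powr 2 = 0" by eventually_elim simp
  then have "(LINT x|circ. \<bar>cos x\<bar> powr 2) = (LINT x|circ. 0)"
    by (intro integral_cong_AE) auto
  then show False by (simp only: integral_cos_sin_square) simp
qed

lemma exponents_1_3: "exponents 1 (ereal 3) = {1<..<3}"
  by (auto simp: exponents_def)

lemma Lp_norm_trig:
  assumes h: "h \<in> borel_measurable borel" "integrable circ (\<lambda>x. \<bar>h x\<bar> powr p)" and e: "AE x in circ. g x = h x"
  shows "Lp_norm p g = ennreal ((LINT x|circ. \<bar>h x\<bar> powr p) powr (1 / p))"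
  unfolding Lp_norm_circ[OF h(1) e] nn_integral_eq_integral[OF h(2) AE_I2, OF powr_ge_zero]
  by (simp add: Let_def Bochner_Integration.integral_nonneg)

lemma cos_norm_Psi: "cos_norm \<in> Psi 1 (ereal 3)"
proof -
  let ?J = "\<lambda>p. LINT x|circ. \<bar>cos x\<bar> powr p"
  have eq: "?J p = integral (cbox (-pi) pi) (\<lambda>x. \<bar>cos x\<bar> powr p)" if "p > 0" for p
    using that by (simp, intro integral_circ_HK(2) continuous_on_powr' continuous_intros; simp)
  have "continuous_on {1<..<3::real} (\<lambda>p. integral (cbox (-pi) pi) (\<lambda>x. \<bar>cos x\<bar> powr p))"
  proof (rule integral_continuous_on_param, unfold split_beta, rule continuous_on_powr')
    show "continuous_on ({1<..<3::real} \<times> cbox (- pi) pi) (\<lambda>x. \<bar>cos (snd x)\<bar>)" by (intro continuous_intros)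
  qed (auto intro: continuous_intros)
  then have c: "continuous_on {1<..<3} ?J"
    by (rule continuous_on_eq) (simp add: eq)
  have pos: "?J p > 0" if "p > 1" for p using that by (intro integral_cos_powr_pos) simp
  \<comment> \<open>As |cos x| \<le> 1, the integral decreases in p, so its value at 3 is a lower
    bound. The minimum with 1 ensures that c^(1/p) is at least c.\<close>
  define c where "c = min 1 (?J 3)"
  have c0: "c > 0" "c \<le> 1" using pos[of 3] by (auto simp: c_def)
  have cle: "c \<le> cos_norm p" if p: "1 < p" "p < 3" for p
  proof -
    have "?J 3 \<le> ?J p"
      using p by (intro integral_mono integrable_cos_powr powr_mono') auto
    then have "c \<le> ?J p" by (simp add: c_def)
    have "c = c powr 1" using c0 by simp
    also have "... \<le> c powr (1 / p)" using p c0 by (intro powr_mono') auto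
    also have "... \<le> ?J p powr (1 / p)" using p c0 \<open>c \<le> ?J p\<close> by (intro powr_mono2) auto
    finally show ?thesis by (simp add: cos_norm_def)
  qed
  have "(INF p\<in>{1<..<3}. cos_norm p) \<ge> c" by (rule cINF_greatest) (use cle in auto)
  then have "(INF p\<in>{1<..<3}. cos_norm p) > 0" using c0 by linarith
  moreover have "continuous_on {1<..<3} cos_norm"
    unfolding cos_norm_def using pos by (intro continuous_on_powr c continuous_intros) (auto, force)
  ultimately show ?thesis
    using cle c0 unfolding Psi_def exponents_1_3 by force
qed

lemma Gnorm_cos: "Gnorm 1 (ereal 3) cos_norm cos = 1"
proof -
  have "Lp_norm p cos / ennreal (cos_norm p) = 1" if "p \<in> exponents 1 (ereal 3)" for p
  proof -
    have p: "p > 1" using that by (simp add: exponents_1_3)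
    have "cos_norm p > 0" using cos_norm_Psi that by (simp add: Psi_def)
    moreover have "Lp_norm p cos = ennreal (cos_norm p)"
      unfolding cos_norm_def using p by (intro Lp_norm_trig integrable_cos_powr) auto
    ultimately show ?thesis by (simp add: divide_ennreal)
  qed
  moreover have "exponents 1 (ereal 3) \<noteq> {}" by (simp add: exponents_1_3)
  ultimately show ?thesis by (simp add: Gnorm_def)
qed

lemma Gnorm_hilbert_cos: "Gnorm 1 (ereal 3) (psi_H cos_norm) (hilbert cos) \<ge> 1"
proof -
  have "Lp_norm 2 (hilbert cos) = ennreal (cos_norm 2)"
    using Lp_norm_trig[OF _ integrable_cos_powr(2) hilbert_cos, of 2] integral_cos_sin_square
    by (simp add: cos_norm_def)
  moreover have "cos_norm 2 > 0" using integral_cos_sin_square by (simp add: cos_norm_def)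
  moreover have "K_H 2 = 1" by (simp add: K_H_def tan_45)
  ultimately have "Lp_norm 2 (hilbert cos) / ennreal (psi_H cos_norm 2) = 1"
    by (simp add: psi_H_def divide_ennreal)
  moreover have "Lp_norm 2 (hilbert cos) / ennreal (psi_H cos_norm 2) \<le> Gnorm 1 (ereal 3) (psi_H cos_norm) (hilbert cos)"
    unfolding Gnorm_def by (rule SUP_upper) (simp add: exponents_1_3)
  ultimately show ?thesis by simp
qed

theorem theoremH:
  shows "(\<forall>(A::real) (B::ereal) (\<psi>::real \<Rightarrow> real) (f::real \<Rightarrow> real).
            1 \<le> A \<longrightarrow> ereal A < B \<longrightarrow> \<psi> \<in> Psi A B \<longrightarrow> f \<in> Gspace A B \<psi> \<longrightarrow>
              hilbert f \<in> Gspace A B (psi_H \<psi>) \<and>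
              Gnorm A B (psi_H \<psi>) (hilbert f) \<le> 1 * Gnorm A B \<psi> f) \<and>
         (SUP A\<in>{1::real..}. SUP B\<in>{ereal A<..}. SUP \<psi>\<in>Psi A B.
            SUP f\<in>{f \<in> Gspace A B \<psi>. \<not> (AE x in lebesgue_on {-pi..pi}. f x = 0)}.
              Gnorm A B (psi_H \<psi>) (hilbert f) / Gnorm A B \<psi> f) = 1"
proof (intro conjI allI impI)
  fix A :: real and B :: ereal and \<psi> f :: "real \<Rightarrow> real"
  assume "1 \<le> A" "ereal A < B" "\<psi> \<in> Psi A B" "f \<in> Gspace A B \<psi>"
  from hilbert_Gspace[OF this]
  show "hilbert f \<in> Gspace A B (psi_H \<psi>)" "Gnorm A B (psi_H \<psi>) (hilbert f) \<le> 1 * Gnorm A B \<psi> f"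
    by simp_all
next
  let ?S = "SUP A\<in>{1::real..}. SUP B\<in>{ereal A<..}. SUP \<psi>\<in>Psi A B.
            SUP f\<in>{f \<in> Gspace A B \<psi>. \<not> (AE x in lebesgue_on {-pi..pi}. f x = 0)}.
              Gnorm A B (psi_H \<psi>) (hilbert f) / Gnorm A B \<psi> f"
  show "?S = 1"
  proof (rule antisym)
    show "?S \<le> 1"
    proof (intro SUP_least)
      fix A B \<psi> f
      assume "A \<in> {1::real..}" "B \<in> {ereal A<..}" "\<psi> \<in> Psi A B"
        "f \<in> {f \<in> Gspace A B \<psi>. \<not> (AE x in lebesgue_on {-pi..pi}. f x = 0)}"
      then have "Gnorm A B (psi_H \<psi>) (hilbert f) \<le> Gnorm A B \<psi> f" "Gnorm A B \<psi> f < \<infinity>"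
        by (auto intro!: hilbert_Gspace simp: Gspace_def)
      \<comment> \<open>When the denominator is 0, the bound forces the numerator to be 0, and 0 / 0
        = 0 in \<open>ennreal\<close>.\<close>
      then show "Gnorm A B (psi_H \<psi>) (hilbert f) / Gnorm A B \<psi> f \<le> 1"
        by (cases "Gnorm A B \<psi> f = 0") (auto intro!: divide_le_posI_ennreal simp: zero_less_iff_neq_zero)
    qed
    have c: "cos \<in> {f \<in> Gspace 1 (ereal 3) cos_norm. \<not> (AE x in lebesgue_on {-pi..pi}. f x = 0)}"
    proof -
      have "\<not> (AE x in circ. cos x = 0)"
      proof
        assume "AE x in circ. cos x = 0"
        then have "(LINT x|circ. \<bar>cos x\<bar> powr 2) = (LINT x|circ. 0)"
          by (intro integral_cong_AE) (auto elim!: eventually_mono)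
        then show False by (simp only: integral_cos_sin_square) simp
      qed
      moreover have "cos \<in> borel_measurable (lebesgue_on {-pi..pi})"
        by (rule borel_measurable_lebesgue_on_circ[of cos]) auto
      ultimately show ?thesis by (simp add: Gspace_def Gnorm_cos AE_circ_lebesgue_on)
    qed
    have "1 \<le> Gnorm 1 (ereal 3) (psi_H cos_norm) (hilbert cos) / Gnorm 1 (ereal 3) cos_norm cos"
      using Gnorm_hilbert_cos by (simp add: Gnorm_cos divide_ennreal_def)
    also have "\<dots> \<le> ?S"
      by (intro SUP_upper2[of 1] SUP_upper2[of "ereal 3"] SUP_upper2[OF cos_norm_Psi] SUP_upper2[OF c]) auto
    finally show "1 \<le> ?S" .
  qed
qed

end
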